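(* Let $B$ be a finite dimensional $C^*$-algebra equipped with a faithful positive functional $\psi$ such that $mm^*=\mathrm{Id}$. Then the map $A\mapsto \Psi^{\mathrm{KMS}}(A)$ restricts to a one-to-one correspondence between quantum adjacency matrices $A:B\to B$ and (orthogonal) projections in $B\otimes B^{\mathrm{op}}$. Moreover, under this correspondence the tensor flip of the projection corresponds to taking the KMS adjoint of $A$: for every quantum adjacency matrix $A$ one has $\Sigma(\Psi^{\mathrm{KMS}}(A))=\Psi^{\mathrm{KMS}}(A^*_{\mathrm{KMS}})$.
   Context: Write $B=\bigoplus_\alpha M_{n_\alpha}$ (finite direct sum) and $\psi(x)=\sum_\alpha \mathrm{Tr}(\rho_\alpha^{-1})\,\mathrm{Tr}(\rho_\alpha x_\alpha)$ with $\rho_\alpha\in M_{n_\alpha}$ positive definite; faithful positive functionals with $mm^*=\mathrm{Id}$ are exactly those of this form. Here $m:B\otimes B\to B$ is the multiplication map and $m^*$ its Hilbert space adjoint. Put $\rho=(\rho_\alpha)_\alpha$ and $\sigma_z(x)=\rho^{iz}x\rho^{-iz}$ for $z\in\mathbb C$ (modular group). The KMS inner product on $B$ is $\langle x,y\rangle_{\mathrm{KMS}}=\psi(x^*\sigma_{-i/2}(y))$ (linear in the second variable); on $B\otimes B$ one uses $\psi\otimes\psi$. The adjoint $m^*$ is the same for the KMS and for the GNS inner product $\psi(x^*y)$. A quantum adjacency matrix on $(B,\psi)$ is a completely positive map $A:B\to B$ with $m(A\otimes A)m^*=A$. $B^{\mathrm{op}}$ is $B$ with multiplication $x^{\mathrm{op}}y^{\mathrm{op}}=(yx)^{\mathrm{op}}$,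 where $x^{\mathrm{op}}$ denotes $x$ viewed in $B^{\mathrm{op}}$. The linear map $\Psi^{\mathrm{KMS}}:\mathrm{End}(B)\to B\otimes B^{\mathrm{op}}$ is determined by $\Psi^{\mathrm{KMS}}(|a\rangle\langle b|)=a\otimes (b^* )^{\mathrm{op}}$, where $|a\rangle\langle b|$ is the rank one operator $c\mapsto a\langle b,c\rangle_{\mathrm{KMS}}$. The tensor flip is $\Sigma:B\otimes B^{\mathrm{op}}\to B\otimes B^{\mathrm{op}}$, $\Sigma(a\otimes b^{\mathrm{op}})=b\otimes a^{\mathrm{op}}$. $A^*_{\mathrm{KMS}}$ is the adjoint of $A$ with respect to $\langle\cdot,\cdot\rangle_{\mathrm{KMS}}$. *)

theory Defs
  imports
    "HOL-Library.FuncSet"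
    "HOL-Analysis.Complex_Transcendental"
    "Jordan_Normal_Form.Schur_Decomposition"
begin

text \<open>
  The algebra \<open>\<Oplus>\<^sub>\<alpha> M\<^bsub>n \<alpha>\<^esub>\<close>, with summands indexed by a finite type. Blocks of size 0 are
  allowed; they are zero summands, so the zero algebra is included.
\<close>

definition fd_alg :: "('k::finite \<Rightarrow> nat) \<Rightarrow> ('k \<Rightarrow> complex mat) set" where
  "fd_alg n = {x. \<forall>\<alpha>. x \<alpha> \<in> carrier_mat (n \<alpha>) (n \<alpha>)}"

definition fd_zero :: "('k::finite \<Rightarrow> nat) \<Rightarrow> 'k \<Rightarrow> complex mat" where
  "fd_zero n = (\<lambda>\<alpha>. 0\<^sub>m (n \<alpha>) (n \<alpha>))"

definition fd_add :: "('k::finite \<Rightarrow> complex mat) \<Rightarrow> ('k \<Rightarrow> complex mat) \<Rightarrow> 'k \<Rightarrow> complex mat" where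
  "fd_add x y = (\<lambda>\<alpha>. x \<alpha> + y \<alpha>)"

definition fd_scale :: "complex \<Rightarrow> ('k::finite \<Rightarrow> complex mat) \<Rightarrow> 'k \<Rightarrow> complex mat" where
  "fd_scale c x = (\<lambda>\<alpha>. c \<cdot>\<^sub>m x \<alpha>)"

definition fd_mult :: "('k::finite \<Rightarrow> complex mat) \<Rightarrow> ('k \<Rightarrow> complex mat) \<Rightarrow> 'k \<Rightarrow> complex mat" where
  "fd_mult x y = (\<lambda>\<alpha>. x \<alpha> * y \<alpha>)"

definition fd_star :: "('k::finite \<Rightarrow> complex mat) \<Rightarrow> 'k \<Rightarrow> complex mat" where
  "fd_star x = (\<lambda>\<alpha>. mat_adjoint (x \<alpha>))"

definition fd_functional :: "('k::finite \<Rightarrow> nat) \<Rightarrow> (('k \<Rightarrow> complex mat) \<Rightarrow> complex) \<Rightarrow> bool" where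
  "fd_functional n \<psi> \<longleftrightarrow>
     (\<forall>x\<in>fd_alg n. \<forall>y\<in>fd_alg n. \<psi> (fd_add x y) = \<psi> x + \<psi> y) \<and>
     (\<forall>c. \<forall>x\<in>fd_alg n. \<psi> (fd_scale c x) = c * \<psi> x)"

text \<open>
  The order on \<^typ>\<open>complex\<close> is the one in which \<open>0 \<le> z\<close> means that \<open>z\<close> is real and nonnegative
  (and \<open>0 < z\<close> that it is real and positive).
\<close>

definition faithful_positive_functional ::
    "('k::finite \<Rightarrow> nat) \<Rightarrow> (('k \<Rightarrow> complex mat) \<Rightarrow> complex) \<Rightarrow> bool" where
  "faithful_positive_functional n \<psi> \<longleftrightarrow>
     fd_functional n \<psi> \<and>
     (\<forall>x\<in>fd_alg n. 0 \<le> \<psi> (fd_mult (fd_star x) x)) \<and>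
     (\<forall>x\<in>fd_alg n. \<psi> (fd_mult (fd_star x) x) = 0 \<longrightarrow> x = fd_zero n)"

text \<open>
  Matrix units and tensor products. An element of \<open>B \<otimes> B\<close> or \<open>B \<otimes> B\<^sup>o\<^sup>p\<close> is given by its coefficients
  with respect to the basis \<open>e\<^sub>u \<otimes> e\<^sub>v\<close>, where \<open>u\<close> and \<open>v\<close> range over the labels \<open>(\<alpha>, i, j)\<close> of the
  matrix units of \<open>B\<close>; coefficients at other labels are 0. As a vector space \<open>B\<^sup>o\<^sup>p\<close> is \<open>B\<close>, so the
  same set represents both tensor products, and only the product below depends on \<open>B\<^sup>o\<^sup>p\<close>.
\<close>

type_synonym 'k mlabel = "'k \<times> nat \<times> nat"

type_synonym 'k fd_tensor = "'k mlabel \<times> 'k mlabel \<Rightarrow> complex"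

definition mlabels :: "('k::finite \<Rightarrow> nat) \<Rightarrow> 'k mlabel set" where
  "mlabels n = {(\<alpha>, i, j). i < n \<alpha> \<and> j < n \<alpha>}"

definition munit :: "('k::finite \<Rightarrow> nat) \<Rightarrow> 'k mlabel \<Rightarrow> 'k \<Rightarrow> complex mat" where
  "munit n = (\<lambda>(\<alpha>, i, j) \<beta>. Matrix.mat (n \<beta>) (n \<beta>)
     (\<lambda>(k, l). if \<beta> = \<alpha> \<and> k = i \<and> l = j then 1 else 0))"

definition mcoeff :: "('k::finite \<Rightarrow> complex mat) \<Rightarrow> 'k mlabel \<Rightarrow> complex" where
  "mcoeff x = (\<lambda>(\<alpha>, i, j). x \<alpha> $$ (i, j))"

definition tensor_space :: "('k::finite \<Rightarrow> nat) \<Rightarrow> 'k fd_tensor set" where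
  "tensor_space n = {S. \<forall>p. p \<notin> mlabels n \<times> mlabels n \<longrightarrow> S p = 0}"

definition fd_tens ::
    "('k::finite \<Rightarrow> nat) \<Rightarrow> ('k \<Rightarrow> complex mat) \<Rightarrow> ('k \<Rightarrow> complex mat) \<Rightarrow> 'k fd_tensor" where
  "fd_tens n x y = (\<lambda>(u, v). if u \<in> mlabels n \<and> v \<in> mlabels n then mcoeff x u * mcoeff y v else 0)"

text \<open>
  The multiplication map \<open>m\<close>, the map \<open>A \<otimes> A'\<close>, and the inner product of \<open>H \<otimes> H\<close> for an inner
  product \<open>ip\<close> on \<open>B\<close> that is linear in the second variable.
\<close>

definition mult_map :: "('k::finite \<Rightarrow> nat) \<Rightarrow> 'k fd_tensor \<Rightarrow> 'k \<Rightarrow> complex mat" where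
  "mult_map n S = (\<lambda>\<alpha>. Matrix.mat (n \<alpha>) (n \<alpha>)
     (\<lambda>(i, j). \<Sum>p<n \<alpha>. S ((\<alpha>, i, p), (\<alpha>, p, j))))"

definition tensor_map ::
    "('k::finite \<Rightarrow> nat) \<Rightarrow> (('k \<Rightarrow> complex mat) \<Rightarrow> 'k \<Rightarrow> complex mat) \<Rightarrow>
     (('k \<Rightarrow> complex mat) \<Rightarrow> 'k \<Rightarrow> complex mat) \<Rightarrow> 'k fd_tensor \<Rightarrow> 'k fd_tensor" where
  "tensor_map n A A' S =
     (\<lambda>p. \<Sum>(u, v)\<in>mlabels n \<times> mlabels n.
        S (u, v) * fd_tens n (A (munit n u)) (A' (munit n v)) p)"

definition tensor_ip ::
    "('k::finite \<Rightarrow> nat) \<Rightarrow> (('k \<Rightarrow> complex mat) \<Rightarrow> ('k \<Rightarrow> complex mat) \<Rightarrow> complex) \<Rightarrow>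
     'k fd_tensor \<Rightarrow> 'k fd_tensor \<Rightarrow> complex" where
  "tensor_ip n ip S T =
     (\<Sum>(u, v)\<in>mlabels n \<times> mlabels n. \<Sum>(u', v')\<in>mlabels n \<times> mlabels n.
        cnj (S (u, v)) * T (u', v') * (ip (munit n u) (munit n u') * ip (munit n v) (munit n v')))"

definition gns_ip ::
    "(('k::finite \<Rightarrow> complex mat) \<Rightarrow> complex) \<Rightarrow> ('k \<Rightarrow> complex mat) \<Rightarrow> ('k \<Rightarrow> complex mat) \<Rightarrow> complex" where
  "gns_ip \<psi> x y = \<psi> (fd_mult (fd_star x) y)"

text \<open>
  The adjoint \<open>m\<^sup>*\<close> is taken for the GNS inner products, so that it makes sense before the modular
  group is introduced; the KMS inner products give the same map.
\<close>

definition mult_adj ::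
    "('k::finite \<Rightarrow> nat) \<Rightarrow> (('k \<Rightarrow> complex mat) \<Rightarrow> complex) \<Rightarrow> ('k \<Rightarrow> complex mat) \<Rightarrow> 'k fd_tensor" where
  "mult_adj n \<psi> x =
     (THE T. T \<in> tensor_space n \<and>
        (\<forall>S\<in>tensor_space n. tensor_ip n (gns_ip \<psi>) T S = gns_ip \<psi> x (mult_map n S)))"

text \<open>The modular group and the KMS inner product.\<close>

definition mat_trace :: "complex mat \<Rightarrow> complex" where
  "mat_trace A = (\<Sum>i<dim_row A. A $$ (i, i))"

definition pos_def_mat :: "nat \<Rightarrow> complex mat \<Rightarrow> bool" where
  "pos_def_mat d A \<longleftrightarrow> A \<in> carrier_mat d d \<and>
     (\<forall>v\<in>carrier_vec d. v \<noteq> 0\<^sub>v d \<longrightarrow> 0 < (A *\<^sub>v v) \<bullet>c v)"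

definition is_density ::
    "('k::finite \<Rightarrow> nat) \<Rightarrow> (('k \<Rightarrow> complex mat) \<Rightarrow> complex) \<Rightarrow> ('k \<Rightarrow> complex mat) \<Rightarrow> bool" where
  "is_density n \<psi> \<rho> \<longleftrightarrow>
     (\<forall>\<alpha>. pos_def_mat (n \<alpha>) (\<rho> \<alpha>)) \<and>
     (\<forall>x\<in>fd_alg n.
        \<psi> x = (\<Sum>\<alpha>\<in>UNIV. mat_trace (the (mat_inverse (\<rho> \<alpha>))) * mat_trace (\<rho> \<alpha> * x \<alpha>)))"

text \<open>
  For a faithful positive \<open>\<psi>\<close> with \<open>m m\<^sup>* = Id\<close> a density exists. Each block \<open>\<rho>\<^sub>\<alpha>\<close> is determined up
  to a positive factor, which cancels in \<open>\<rho>\<^sup>i\<^sup>z x \<rho>\<^sup>-\<^sup>i\<^sup>z\<close>; hence the choice below is immaterial.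
\<close>

definition density ::
    "('k::finite \<Rightarrow> nat) \<Rightarrow> (('k \<Rightarrow> complex mat) \<Rightarrow> complex) \<Rightarrow> 'k \<Rightarrow> complex mat" where
  "density n \<psi> = (SOME \<rho>. is_density n \<psi> \<rho>)"

text \<open>
  Complex powers of a positive definite matrix by functional calculus: \<open>A\<^sup>w\<close> acts as \<open>c\<^sup>w\<close> on the
  eigenspace of \<open>A\<close> for the eigenvalue \<open>c > 0\<close>.
\<close>

definition mat_cpow :: "complex mat \<Rightarrow> complex \<Rightarrow> complex mat" where
  "mat_cpow A w = (THE X. X \<in> carrier_mat (dim_row A) (dim_row A) \<and>
     (\<forall>v c. eigenvector A v c \<longrightarrow> X *\<^sub>v v = (c powr w) \<cdot>\<^sub>v v))"

definition modular_group ::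
    "('k::finite \<Rightarrow> complex mat) \<Rightarrow> complex \<Rightarrow> ('k \<Rightarrow> complex mat) \<Rightarrow> 'k \<Rightarrow> complex mat" where
  "modular_group \<rho> z x = (\<lambda>\<alpha>. mat_cpow (\<rho> \<alpha>) (\<i> * z) * x \<alpha> * mat_cpow (\<rho> \<alpha>) (- (\<i> * z)))"

definition kms_ip ::
    "('k::finite \<Rightarrow> nat) \<Rightarrow> (('k \<Rightarrow> complex mat) \<Rightarrow> complex) \<Rightarrow>
     ('k \<Rightarrow> complex mat) \<Rightarrow> ('k \<Rightarrow> complex mat) \<Rightarrow> complex" where
  "kms_ip n \<psi> x y = \<psi> (fd_mult (fd_star x) (modular_group (density n \<psi>) (- (\<i> / 2)) y))"

text \<open>
  Linear maps \<open>B \<rightarrow> B\<close>, required to be undefined outside \<open>B\<close> so that equality of such functions is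
  equality of maps on \<open>B\<close>.
\<close>

definition fd_end :: "('k::finite \<Rightarrow> nat) \<Rightarrow> (('k \<Rightarrow> complex mat) \<Rightarrow> 'k \<Rightarrow> complex mat) set" where
  "fd_end n = {A \<in> fd_alg n \<rightarrow>\<^sub>E fd_alg n.
     (\<forall>x\<in>fd_alg n. \<forall>y\<in>fd_alg n. A (fd_add x y) = fd_add (A x) (A y)) \<and>
     (\<forall>c. \<forall>x\<in>fd_alg n. A (fd_scale c x) = fd_scale c (A x))}"

definition rank_one ::
    "('k::finite \<Rightarrow> nat) \<Rightarrow> (('k \<Rightarrow> complex mat) \<Rightarrow> complex) \<Rightarrow>
     ('k \<Rightarrow> complex mat) \<Rightarrow> ('k \<Rightarrow> complex mat) \<Rightarrow> ('k \<Rightarrow> complex mat) \<Rightarrow> 'k \<Rightarrow> complex mat" where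
  "rank_one n \<psi> a b = (\<lambda>c\<in>fd_alg n. fd_scale (kms_ip n \<psi> b c) a)"

definition kms_adjoint ::
    "('k::finite \<Rightarrow> nat) \<Rightarrow> (('k \<Rightarrow> complex mat) \<Rightarrow> complex) \<Rightarrow>
     (('k \<Rightarrow> complex mat) \<Rightarrow> 'k \<Rightarrow> complex mat) \<Rightarrow> ('k \<Rightarrow> complex mat) \<Rightarrow> 'k \<Rightarrow> complex mat" where
  "kms_adjoint n \<psi> A = (\<lambda>x\<in>fd_alg n.
     (THE y. y \<in> fd_alg n \<and> (\<forall>z\<in>fd_alg n. kms_ip n \<psi> y z = kms_ip n \<psi> x (A z))))"

text \<open>
  Complete positivity. A \<open>d \<times> d\<close> matrix \<open>X\<close> over \<open>B\<close> is an element of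
  \<open>M\<^sub>d(B) = \<Oplus>\<^sub>\<alpha> M\<^sub>d(M\<^bsub>n \<alpha>\<^esub>)\<close>; it is positive iff, for each \<open>\<alpha>\<close>, the operator
  \<open>(X\<^sub>a\<^sub>b \<alpha>)\<^sub>a\<^sub>b\<close> on the direct sum of \<open>d\<close> copies of \<open>\<complex>\<^sup>n\<^sup>\<alpha>\<close> is positive semidefinite.
\<close>

definition matrix_positive ::
    "('k::finite \<Rightarrow> nat) \<Rightarrow> nat \<Rightarrow> (nat \<Rightarrow> nat \<Rightarrow> 'k \<Rightarrow> complex mat) \<Rightarrow> bool" where
  "matrix_positive n d X \<longleftrightarrow>
     (\<forall>\<alpha> v. (\<forall>a<d. v a \<in> carrier_vec (n \<alpha>)) \<longrightarrow>
        0 \<le> (\<Sum>a<d. \<Sum>b<d. (X a b \<alpha> *\<^sub>v v b) \<bullet>c v a))"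

definition completely_positive ::
    "('k::finite \<Rightarrow> nat) \<Rightarrow> (('k \<Rightarrow> complex mat) \<Rightarrow> 'k \<Rightarrow> complex mat) \<Rightarrow> bool" where
  "completely_positive n A \<longleftrightarrow> A \<in> fd_end n \<and>
     (\<forall>d X. (\<forall>a<d. \<forall>b<d. X a b \<in> fd_alg n) \<and> matrix_positive n d X \<longrightarrow>
        matrix_positive n d (\<lambda>a b. A (X a b)))"

definition quantum_adjacency ::
    "('k::finite \<Rightarrow> nat) \<Rightarrow> (('k \<Rightarrow> complex mat) \<Rightarrow> complex) \<Rightarrow>
     (('k \<Rightarrow> complex mat) \<Rightarrow> 'k \<Rightarrow> complex mat) \<Rightarrow> bool" where
  "quantum_adjacency n \<psi> A \<longleftrightarrow> completely_positive n A \<and>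
     (\<forall>x\<in>fd_alg n. mult_map n (tensor_map n A A (mult_adj n \<psi> x)) = A x)"

text \<open>
  The \<open>*\<close>-algebra \<open>B \<otimes> B\<^sup>o\<^sup>p\<close>: bilinear extension of
  \<open>(a \<otimes> b\<^sup>o\<^sup>p) (c \<otimes> d\<^sup>o\<^sup>p) = a c \<otimes> (d b)\<^sup>o\<^sup>p\<close> and conjugate-linear extension of
  \<open>(a \<otimes> b\<^sup>o\<^sup>p)\<^sup>* = a\<^sup>* \<otimes> (b\<^sup>*)\<^sup>o\<^sup>p\<close>.
\<close>

definition op_mult :: "('k::finite \<Rightarrow> nat) \<Rightarrow> 'k fd_tensor \<Rightarrow> 'k fd_tensor \<Rightarrow> 'k fd_tensor" where
  "op_mult n S T = (\<lambda>((\<alpha>, i, j), (\<beta>, k, l)).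
     \<Sum>p<n \<alpha>. \<Sum>q<n \<beta>. S ((\<alpha>, i, p), (\<beta>, q, l)) * T ((\<alpha>, p, j), (\<beta>, k, q)))"

definition op_star :: "'k::finite fd_tensor \<Rightarrow> 'k fd_tensor" where
  "op_star S = (\<lambda>((\<alpha>, i, j), (\<beta>, k, l)). cnj (S ((\<alpha>, j, i), (\<beta>, l, k))))"

definition op_projections :: "('k::finite \<Rightarrow> nat) \<Rightarrow> 'k fd_tensor set" where
  "op_projections n = {P \<in> tensor_space n. op_mult n P P = P \<and> op_star P = P}"

definition tensor_flip :: "'k::finite fd_tensor \<Rightarrow> 'k fd_tensor" where
  "tensor_flip S = (\<lambda>(u, v). S (v, u))"

definition Psi_KMS ::
    "('k::finite \<Rightarrow> nat) \<Rightarrow> (('k \<Rightarrow> complex mat) \<Rightarrow> complex) \<Rightarrow>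
     (('k \<Rightarrow> complex mat) \<Rightarrow> 'k \<Rightarrow> complex mat) \<Rightarrow> 'k fd_tensor" where
  "Psi_KMS n \<psi> = (THE F. F \<in> fd_end n \<rightarrow>\<^sub>E tensor_space n \<and>
     (\<forall>A\<in>fd_end n. \<forall>A'\<in>fd_end n.
        F (\<lambda>x\<in>fd_alg n. fd_add (A x) (A' x)) = (\<lambda>p. F A p + F A' p)) \<and>
     (\<forall>c. \<forall>A\<in>fd_end n. F (\<lambda>x\<in>fd_alg n. fd_scale c (A x)) = (\<lambda>p. c * F A p)) \<and>
     (\<forall>a\<in>fd_alg n. \<forall>b\<in>fd_alg n. F (rank_one n \<psi> a b) = fd_tens n a (fd_star b)))"

text \<open>The coordinate formulas above agree with the intended maps on simple tensors.\<close>

lemma mat_adjoint_index: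
  fixes A :: "complex mat"
  assumes "i < dim_col A" and "j < dim_row A"
  shows "mat_adjoint A $$ (i, j) = cnj (A $$ (j, i))"
  using assms by (simp add: mat_adjoint_def mat_of_rows_def)

lemma mult_map_tens:
  assumes "x \<in> fd_alg n" and "y \<in> fd_alg n"
  shows "mult_map n (fd_tens n x y) = fd_mult x y"
proof
  fix \<alpha>
  have "x \<alpha> \<in> carrier_mat (n \<alpha>) (n \<alpha>)" "y \<alpha> \<in> carrier_mat (n \<alpha>) (n \<alpha>)"
    using assms by (auto simp: fd_alg_def)
  then show "mult_map n (fd_tens n x y) \<alpha> = fd_mult x y \<alpha>"
    by (intro eq_matI)
      (auto simp: mult_map_def fd_mult_def fd_tens_def mlabels_def mcoeff_def scalar_prod_def
        lessThan_atLeast0 intro!: sum.cong)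
qed

lemma op_mult_tens:
  assumes "a \<in> fd_alg n" "b \<in> fd_alg n" "c \<in> fd_alg n" "d \<in> fd_alg n"
  shows "op_mult n (fd_tens n a b) (fd_tens n c d) = fd_tens n (fd_mult a c) (fd_mult d b)"
proof -
  have dims: "dim_row (x \<alpha>) = n \<alpha>" "dim_col (x \<alpha>) = n \<alpha>" if "x \<in> fd_alg n" for x \<alpha>
    using that by (auto simp: fd_alg_def)
  have "op_mult n (fd_tens n a b) (fd_tens n c d) ((\<alpha>, i, j), (\<beta>, k, l)) =
      fd_tens n (fd_mult a c) (fd_mult d b) ((\<alpha>, i, j), (\<beta>, k, l))" for \<alpha> i j \<beta> k l
  proof (cases "i < n \<alpha> \<and> j < n \<alpha> \<and> k < n \<beta> \<and> l < n \<beta>")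
    case True
    then show ?thesis
      using dims[OF assms(1)] dims[OF assms(2)] dims[OF assms(3)] dims[OF assms(4)]
      by (auto simp: op_mult_def fd_mult_def fd_tens_def mlabels_def mcoeff_def scalar_prod_def
        sum_product lessThan_atLeast0 mult_ac intro!: sum.cong)
  next
    case False
    then show ?thesis
      by (auto simp: op_mult_def fd_tens_def mlabels_def intro!: sum.neutral)
  qed
  then show ?thesis by (intro ext) (auto simp: split_paired_all)
qed

lemma op_star_tens:
  assumes "a \<in> fd_alg n" "b \<in> fd_alg n"
  shows "op_star (fd_tens n a b) = fd_tens n (fd_star a) (fd_star b)"
proof -
  have dims: "dim_row (x \<alpha>) = n \<alpha>" "dim_col (x \<alpha>) = n \<alpha>" if "x \<in> fd_alg n" for x \<alpha>
    using that by (auto simp: fd_alg_def)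
  show ?thesis
    using dims[OF assms(1)] dims[OF assms(2)]
    by (intro ext) (auto simp: op_star_def fd_tens_def fd_star_def mlabels_def mcoeff_def
        mat_adjoint_index split: prod.splits)
qed

lemma tensor_flip_tens: "tensor_flip (fd_tens n a b) = fd_tens n b a"
  by (auto simp: tensor_flip_def fd_tens_def fun_eq_iff)

end

theory Submission
  imports Defs "Jordan_Normal_Form.Jordan_Normal_Form_Existence"
    "Jordan_Normal_Form.Jordan_Normal_Form_Uniqueness"
begin

text \<open>
  Write \<open>H\<^sub>\<alpha>\<close> for the positive square root of \<open>Tr(\<rho>\<^sub>\<alpha>\<^sup>-\<^sup>1) \<rho>\<^sub>\<alpha>\<close>. Then \<open>\<psi>(x) = Tr(H\<^sup>2 x)\<close> and the KMS inner
  product is \<open>Tr(H x\<^sup>* H y)\<close>, so the endomorphism corresponding to a tensor \<open>S\<close> is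
  \<open>T\<^sub>S(x) = (id \<otimes> Tr)(S (1 \<otimes> H x H))\<close>. Three identities give the theorem. First,
  \<open>m (T\<^sub>S \<otimes> T\<^sub>S) m\<^sup>* = T\<^bsub>S S\<^esub>\<close>, so the Schur idempotent maps are the idempotents of \<open>B \<otimes> B\<^sup>o\<^sup>p\<close>.
  Second, \<open>S\<close> is, up to relabelling, the Choi matrix of \<open>x \<mapsto> T\<^sub>S(H\<^sup>-\<^sup>1 x H\<^sup>-\<^sup>1)\<close>, so complete positivity forces
  \<open>S\<^sup>* = S\<close>, and conversely \<open>S = S\<^sup>* S\<close> is a Kraus decomposition of \<open>T\<^sub>S\<close>. Third, the KMS adjoint
  of \<open>T\<^sub>S\<close> is \<open>T\<^bsub>\<Sigma>(S\<^sup>*)\<^esub>\<close>.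

  The hypothesis \<open>m m\<^sup>* = Id\<close> enters only through the existence of the density: it says that the inverse of the
  matrix representing \<open>\<psi>\<close> has trace 1 on every block, so that this matrix is itself a density.
\<close>

text \<open>Several notions in the statement are given by descriptions, and each needs its own
  uniqueness argument. \<open>mat_cpow\<close> fixes a matrix only by its action on eigenvectors,
  which determines it because the eigenvectors of a positive definite matrix span; hence the
  diagonalisation. \<open>density\<close> is an arbitrary choice, so the density whose existence is
  proved need not be the one inside \<open>kms_ip\<close>; the scalar Tr(\<rho>^-1) is therefore
  kept and absorbed into H. \<open>Psi_KMS\<close> is prescribed on rank one maps and extended
  linearly, so it is compared with explicit coefficients.

  The formula for T_S is forced by the rank one case: <b, c> = Tr(b^* H c H), so c |-> a <b, c> is
  T_S for S = a (x) b^*. The twist by H also fits m^*, which inserts H^-2 between its two legs: the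
  inner factors H of T_S (x) T_S cancel it and leave second legs of S multiplied in the opposite
  order.\<close>

unbundle no vec_syntax

section \<open>Complex powers of positive definite matrices\<close>

lemma mat_mult_index:
  assumes "A \<in> carrier_mat m k" "B \<in> carrier_mat k l" "i < m" "j < l"
  shows "(A * B) $$ (i, j) = (\<Sum>p<k. A $$ (i, p) * B $$ (p, j))"
  using assms by (auto simp: scalar_prod_def lessThan_atLeast0 intro!: sum.cong)

lemma mult_mat_vec_index:
  assumes "A \<in> carrier_mat m k" "v \<in> carrier_vec k" "i < m"
  shows "(A *\<^sub>v v) $ i = (\<Sum>p<k. A $$ (i, p) * v $ p)"
  using assms by (auto simp: scalar_prod_def lessThan_atLeast0 intro!: sum.cong)

lemma mult_mat_vec_cscalar_prod:
  fixes A :: "complex mat"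
  assumes "A \<in> carrier_mat m k" "v \<in> carrier_vec k" "w \<in> carrier_vec m"
  shows "(A *\<^sub>v v) \<bullet>c w = (\<Sum>i<m. \<Sum>j<k. A $$ (i, j) * v $ j * cnj (w $ i))"
proof -
  have "(A *\<^sub>v v) \<bullet>c w = (\<Sum>i<m. (A *\<^sub>v v) $ i * cnj (w $ i))"
    using assms by (auto simp: scalar_prod_def lessThan_atLeast0 intro!: sum.cong)
  also have "\<dots> = (\<Sum>i<m. \<Sum>j<k. A $$ (i, j) * v $ j * cnj (w $ i))"
    using assms by (intro sum.cong refl)
      (simp add: mult_mat_vec_index[of A m k] sum_distrib_right del: index_mult_mat_vec)
  finally show ?thesis .
qed

text \<open>Polarisation on two indices: vectors supported on x and y already see all four entries
  concerned. The index set is an arbitrary finite set so that the lemma serves ordinary matrices as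
  well as Choi matrices, whose indices are pairs.\<close>

lemma nonneg_form_hermitian:
  fixes M :: "'i \<Rightarrow> 'i \<Rightarrow> complex"
  assumes fin: "finite I"
    and nonneg: "\<And>v. 0 \<le> (\<Sum>x\<in>I. \<Sum>y\<in>I. M x y * v y * cnj (v x))"
    and x: "x \<in> I" and y: "y \<in> I"
  shows "M y x = cnj (M x y)"
proof -
  have form: "0 \<le> M x x * a * cnj a + M x y * b * cnj a + M y x * a * cnj b + M y y * b * cnj b"
    for a b
  proof -
    \<comment> \<open>A sum of two indicators rather than a case distinction, so that x = y needs no
      separate treatment.\<close>
    define v where "v = (\<lambda>z. (if z = x then a else 0) + (if z = y then b else 0))"
    have inner: "(\<Sum>z\<in>I. M u z * v z * c) = (M u x * a + M u y * b) * c" for u c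
      using fin x y unfolding v_def
      by (simp add: distrib_left distrib_right sum.distrib if_distrib[of "\<lambda>t. M u _ * t"]
          if_distrib[of "\<lambda>t. t * c"] cong: if_cong)
    have "(\<Sum>u\<in>I. \<Sum>z\<in>I. M u z * v z * cnj (v u)) = (\<Sum>u\<in>I. (M u x * a + M u y * b) * cnj (v u))"
      by (simp only: inner)
    also have "\<dots> = (M x x * a + M x y * b) * cnj a + (M y x * a + M y y * b) * cnj b"
    proof -
      have "(M u x * a + M u y * b) * cnj (v u) =
          (if u = x then (M x x * a + M x y * b) * cnj a else 0) +
          (if u = y then (M y x * a + M y y * b) * cnj b else 0)" for u
        by (simp add: v_def distrib_left)
      then show ?thesis
        using fin x y by (simp only: sum.distrib) simp
    qed
    finally show ?thesis
      using nonneg[of v] by (simp add: algebra_simps)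
  qed
  \<comment> \<open>Reality of the form at (1, 0), (0, 1), (1, 1) and (1, i): the diagonal is real,
    the off-diagonal imaginary parts cancel, and the off-diagonal real parts agree.\<close>
  have "Im (M x x) = 0" "Im (M y y) = 0"
    using form[of 1 0] form[of 0 1] by (auto simp: less_eq_complex_def)
  moreover have "Im (M x y) + Im (M y x) = 0" if "Im (M x x) = 0" "Im (M y y) = 0"
    using form[of 1 1] that by (simp add: less_eq_complex_def)
  moreover have "Re (M x y) = Re (M y x)" if "Im (M x x) = 0" "Im (M y y) = 0"
    using form[of 1 \<i>] that by (simp add: less_eq_complex_def)
  ultimately show ?thesis
    by (simp add: complex_eq_iff)
qed

text \<open>\<open>pos_def_mat\<close> demands positivity of the form without self-adjointness. Over
  the complex numbers the latter follows, since the order on \<open>complex\<close> makes the form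
  real.\<close>

lemma pos_def_mat_hermitian:
  assumes A: "pos_def_mat d A" and i: "i < d" and j: "j < d"
  shows "A $$ (j, i) = cnj (A $$ (i, j))"
proof (rule nonneg_form_hermitian[of "{..<d}"])
  have carr: "A \<in> carrier_mat d d"
    using A by (simp add: pos_def_mat_def)
  fix v
  have "(A *\<^sub>v vec d v) \<bullet>c vec d v = (\<Sum>i<d. \<Sum>j<d. A $$ (i, j) * v j * cnj (v i))"
    by (simp add: mult_mat_vec_cscalar_prod[OF carr])
  moreover have "0 \<le> (A *\<^sub>v vec d v) \<bullet>c vec d v"
  proof (cases "vec d v = 0\<^sub>v d")
    case True
    then show ?thesis using carr by auto
  next
    case False
    then show ?thesis using A by (simp add: pos_def_mat_def less_imp_le)
  qed
  ultimately show "0 \<le> (\<Sum>x<d. \<Sum>y<d. A $$ (x, y) * v y * cnj (v x))"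
    by simp
qed (use i j in auto)

lemma hermitian_cscalar_prod:
  fixes A :: "complex mat"
  assumes A: "A \<in> carrier_mat d d"
    and herm: "\<And>i j. i < d \<Longrightarrow> j < d \<Longrightarrow> A $$ (j, i) = cnj (A $$ (i, j))"
    and v: "v \<in> carrier_vec d" and w: "w \<in> carrier_vec d"
  shows "(A *\<^sub>v v) \<bullet>c w = v \<bullet>c (A *\<^sub>v w)"
proof -
  have "v \<bullet>c (A *\<^sub>v w) = (\<Sum>j<d. v $ j * cnj ((A *\<^sub>v w) $ j))"
    using A v w by (auto simp: scalar_prod_def lessThan_atLeast0 intro!: sum.cong)
  also have "\<dots> = (\<Sum>j<d. \<Sum>i<d. v $ j * (cnj (A $$ (j, i)) * cnj (w $ i)))"
    using A w by (intro sum.cong refl)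
      (simp add: mult_mat_vec_index[of A d d] sum_distrib_left del: index_mult_mat_vec)
  also have "\<dots> = (\<Sum>j<d. \<Sum>i<d. A $$ (i, j) * v $ j * cnj (w $ i))"
    by (intro sum.cong refl) (auto simp: herm[symmetric])
  also have "\<dots> = (\<Sum>i<d. \<Sum>j<d. A $$ (i, j) * v $ j * cnj (w $ i))"
    by (rule sum.swap)
  finally show ?thesis
    by (simp add: mult_mat_vec_cscalar_prod[OF A v w])
qed

section \<open>Eigenvalues and diagonalisation of positive definite matrices\<close>

lemma pos_def_mat_eigenvalue_pos:
  assumes A: "pos_def_mat d A" and v: "v \<in> carrier_vec d" "v \<noteq> 0\<^sub>v d" "A *\<^sub>v v = c \<cdot>\<^sub>v v"
  shows "0 < c"
proof -
  have "0 < (A *\<^sub>v v) \<bullet>c v"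
    using A v by (auto simp: pos_def_mat_def)
  then have "0 < c * (v \<bullet>c v)"
    using v by simp
  moreover have "0 < v \<bullet>c v"
    using v conjugate_square_greater_0_vec by blast
  ultimately show ?thesis
    by (auto simp: less_complex_def zero_less_mult_iff)
qed

text \<open>Hence all Jordan blocks of a positive definite matrix have size 1.\<close>

lemma pos_def_mat_kernel_char_matrix_square:
  assumes A: "pos_def_mat d A" 
  shows "mat_kernel (char_matrix A c ^\<^sub>m 2) = mat_kernel (char_matrix A c)"
proof -
  let ?N = "char_matrix A c"
  have carr: "A \<in> carrier_mat d d"
    using A by (simp add: pos_def_mat_def)
  then have N: "?N \<in> carrier_mat d d" by simp
  have Nv: "?N *\<^sub>v v = A *\<^sub>v v - c \<cdot>\<^sub>v v" if "v \<in> carrier_vec d" for v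
    using that carr by (intro eq_vecI) (auto simp: char_matrix_def add_mult_distrib_mat_vec[of _ d d])
  have sq: "?N ^\<^sub>m 2 = ?N * ?N"
    using N by (simp add: numeral_2_eq_2)
  have NN: "(?N * ?N) *\<^sub>v v = ?N *\<^sub>v (?N *\<^sub>v v)" if "v \<in> carrier_vec d" for v
    using that N by simp
  have "?N *\<^sub>v v = 0\<^sub>v d" if v: "v \<in> carrier_vec d" and 0: "?N *\<^sub>v (?N *\<^sub>v v) = 0\<^sub>v d" for v
  proof (rule ccontr)
    \<comment> \<open>If w = (A - c) v is nonzero and A - c kills it, then w is an eigenvector, so c
      is positive and in particular real. Moving A - c across the inner product then gives <w, w> =
      <v, (A - c) w> = 0.\<close>
    define w where "w = ?N *\<^sub>v v"
    assume "?N *\<^sub>v v \<noteq> 0\<^sub>v d"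
    then have w: "w \<in> carrier_vec d" "w \<noteq> 0\<^sub>v d"
      using N v by (auto simp: w_def)
    have Aw: "A *\<^sub>v w = c \<cdot>\<^sub>v w"
      using eigenvector_char_matrix[OF carr, of w c] w 0 carr by (simp add: w_def eigenvector_def)
    then have "0 < c" 
      using pos_def_mat_eigenvalue_pos[OF A w] by simp
    then have c: "cnj c = c"
      by (simp add: less_complex_def complex_eq_iff)
    have "w \<bullet>c w = (A *\<^sub>v v - c \<cdot>\<^sub>v v) \<bullet>c w"
      by (simp add: w_def Nv v)
    also have "\<dots> = (A *\<^sub>v v) \<bullet>c w - c * (v \<bullet>c w)"
      using carr v w by (simp add: minus_scalar_prod_distrib[of _ d])
    also have "(A *\<^sub>v v) \<bullet>c w = v \<bullet>c (A *\<^sub>v w)"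
      using hermitian_cscalar_prod[OF carr _ v w(1)] pos_def_mat_hermitian[OF A] by blast
    also have "\<dots> = c * (v \<bullet>c w)"
      using v w c by (simp add: Aw conjugate_smult_vec)
    finally have "w \<bullet>c w = 0" by simp
    then show False
      using w by (simp add: conjugate_square_eq_0_vec)
  qed
  then show ?thesis
    unfolding sq mat_kernel[OF N] mat_kernel[OF mult_carrier_mat[OF N N]]
    using NN N by (auto simp del: assoc_mult_mat_vec)
qed

lemma jordan_matrix_diagonal:
  assumes "\<And>k a. (k, a) \<in> set n_as \<Longrightarrow> k = 1"
    and "i < length n_as" "j < length n_as" "i \<noteq> j"
  shows "jordan_matrix n_as $$ (i, j) = 0"
  using assms
proof (induction n_as arbitrary: i j)
  case (Cons ka n_as)
  obtain k a where ka: "ka = (k, a)" by force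
  have k: "k = 1" using Cons.prems(1)[of k a] ka by simp
  have len: "sum_list (map fst n_as) = length n_as"
    using Cons.prems(1) by (induction n_as) fastforce+
  have "jordan_matrix n_as $$ (i - 1, j - 1) = 0" if "i > 0" "j > 0"
    using that Cons.prems by (intro Cons.IH) auto
  then show ?case
    using Cons.prems(2-) by (auto simp: ka k jordan_matrix_Cons len less_Suc_eq_0_disj)
qed simp

text \<open>Generalised eigenspaces of order 1 and 2 coincide, which excludes Jordan blocks of size
  above 1. This route makes \<open>P\<close> invertible but says nothing about unitarity, so
  self-adjointness of real powers has to be argued separately later.\<close>

lemma pos_def_mat_diagonalizable:
  assumes A: "pos_def_mat d A"
  obtains P Q es where "P \<in> carrier_mat d d" "Q \<in> carrier_mat d d" "P * Q = 1\<^sub>m d" "Q * P = 1\<^sub>m d"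
    "A = P * mat d d (\<lambda>(i, j). if i = j then es i else 0) * Q" "\<And>i. i < d \<Longrightarrow> 0 < es i"
proof -
  have carr: "A \<in> carrier_mat d d"
    using A by (simp add: pos_def_mat_def)
  obtain n_as where jnf: "jordan_nf A n_as"
    using jordan_nf_exists[OF carr] char_poly_factorized[OF carr] by blast
  have size1: "k = 1" if mem: "(k, c) \<in> set n_as" for k c
  proof -
    let ?l = "map fst (filter (\<lambda>(n, e). e = c) n_as)"
    have "dim_gen_eigenspace A c 2 = dim_gen_eigenspace A c 1"
      unfolding dim_gen_eigenspace_def kernel_dim_def
      using pos_def_mat_kernel_char_matrix_square[OF A, of c] carr by simp
    \<comment> \<open>The dimension of a generalised eigenspace of order r is the sum of min r n
      over the block sizes n. Since min 1 n never exceeds min 2 n, equal sums force equality for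
      every block.\<close>
    then have eq: "(\<Sum>n\<leftarrow>?l. min 2 n) = (\<Sum>n\<leftarrow>?l. min 1 n)"
      by (simp only: dim_gen_eigenspace[OF jnf])
    have "\<forall>n\<in>set l. min 2 n = min 1 n" if "(\<Sum>n\<leftarrow>l. min 2 n) = (\<Sum>n\<leftarrow>l. min 1 n)" for l :: "nat list"
      using that
    proof (induction l)
      case (Cons a l)
      have "(\<Sum>n\<leftarrow>l. min 1 n) \<le> (\<Sum>n\<leftarrow>l. min 2 n)"
        by (rule sum_list_mono) auto
      then show ?case using Cons by auto
    qed simp
    from this[OF eq] have "min 2 k = min 1 k"
      using mem by force
    moreover have "k \<noteq> 0"
      using jnf mem by (force simp: jordan_nf_def)
    ultimately show "k = 1" by auto
  qed
  obtain P Q where "similar_mat_wit A (jordan_matrix n_as) P Q"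
    using jnf by (auto simp: jordan_nf_def similar_mat_def)
  note wit = similar_mat_witD2[OF carr this]
  have "sum_list (map fst n_as) = length n_as"
    using size1 by (induction n_as) fastforce+
  then have len: "length n_as = d"
    using wit(5) by auto
  define es where "es = (\<lambda>i. jordan_matrix n_as $$ (i, i))"
  let ?D = "mat d d (\<lambda>(i, j). if i = j then es i else 0)"
  have D: "jordan_matrix n_as = ?D"
    using wit(5) jordan_matrix_diagonal[of n_as, OF size1] len
    by (intro eq_matI) (auto simp: es_def)
  have pos: "0 < es i" if i: "i < d" for i
  proof (rule pos_def_mat_eigenvalue_pos[OF A, where v = "col P i"])
    show "col P i \<in> carrier_vec d" using wit(6) by auto
    show "col P i \<noteq> 0\<^sub>v d"
    proof
      assume 0: "col P i = 0\<^sub>v d"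
      have "(Q * P) $$ (i, i) = row Q i \<bullet> col P i"
        using wit(6,7) i by simp
      moreover have "(Q * P) $$ (i, i) = 1"
        using i by (simp add: wit(2))
      ultimately show False
        using wit(7) i 0 by simp
    qed
    have "A * P = P * ?D * (Q * P)"
      unfolding wit(3) D using wit(6,7) by (simp add: assoc_mult_mat[of _ d d _ d _ d] mult_carrier_mat[of _ d d _ d])
    also have "\<dots> = P * ?D"
      using wit(6) by (simp add: wit(2) right_mult_one_mat[of _ d d])
    finally have AP: "A * P = P * ?D" .
    have "A *\<^sub>v col P i = col (A * P) i"
      using col_mult2[OF wit(4,6) i] by simp
    also have "\<dots> = P *\<^sub>v col ?D i"
      unfolding AP using wit(6) i by (intro col_mult2) auto
    also have "\<dots> = es i \<cdot>\<^sub>v col P i"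
    proof (rule eq_vecI)
      fix j assume j: "j < dim_vec (es i \<cdot>\<^sub>v col P i)"
      then have j: "j < d" using wit(6) by simp
      have "(P *\<^sub>v col ?D i) $ j = (\<Sum>p<d. P $$ (j, p) * col ?D i $ p)"
        using wit(6) i j by (intro mult_mat_vec_index[of _ d]) auto
      also have "\<dots> = (\<Sum>p<d. if p = i then P $$ (j, p) * es i else 0)"
        using i by (intro sum.cong) auto
      also have "\<dots> = es i * P $$ (j, i)"
        using i by simp
      finally show "(P *\<^sub>v col ?D i) $ j = (es i \<cdot>\<^sub>v col P i) $ j"
        using wit(6) i j by simp
    qed (use wit(6) in auto)
    finally show "A *\<^sub>v col P i = es i \<cdot>\<^sub>v col P i" .
  qed
  show ?thesis
    using that[OF wit(6,7,1,2) _ pos] wit(3) D by simp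
qed

section \<open>Adjoints, diagonal matrices and functional calculus\<close>

lemma mat_adjoint_carrier [simp]:
  "A \<in> carrier_mat m k \<Longrightarrow> mat_adjoint A \<in> carrier_mat k m"
  by (auto simp: mat_adjoint_def)

lemma mat_adjoint_mult:
  fixes A B :: "complex mat"
  assumes A: "A \<in> carrier_mat m k" and B: "B \<in> carrier_mat k l"
  shows "mat_adjoint (A * B) = mat_adjoint B * mat_adjoint A"
proof (rule eq_matI)
  fix i j assume "i < dim_row (mat_adjoint B * mat_adjoint A)" "j < dim_col (mat_adjoint B * mat_adjoint A)"
  then have ij: "i < l" "j < m"
    using mat_adjoint_carrier[OF A] mat_adjoint_carrier[OF B] by auto
  have "mat_adjoint (A * B) $$ (i, j) = (\<Sum>p<k. cnj (A $$ (j, p)) * cnj (B $$ (p, i)))"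
    using A B ij by (simp add: mat_adjoint_index mat_mult_index[OF A B] del: index_mult_mat(1))
  also have "\<dots> = (mat_adjoint B * mat_adjoint A) $$ (i, j)"
    unfolding mat_mult_index[OF mat_adjoint_carrier[OF B] mat_adjoint_carrier[OF A] ij]
    using A B ij by (intro sum.cong) (auto simp: mat_adjoint_index)
  finally show "mat_adjoint (A * B) $$ (i, j) = (mat_adjoint B * mat_adjoint A) $$ (i, j)" .
qed (use mat_adjoint_carrier[OF A] mat_adjoint_carrier[OF B]
    mat_adjoint_carrier[OF mult_carrier_mat[OF A B]] in auto)

lemma mat_adjoint_eq_iff:
  fixes A :: "complex mat"
  assumes A: "A \<in> carrier_mat d d"
  shows "mat_adjoint A = A \<longleftrightarrow> (\<forall>i<d. \<forall>j<d. A $$ (j, i) = cnj (A $$ (i, j)))"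
proof
  assume eq: "mat_adjoint A = A"
  show "\<forall>i<d. \<forall>j<d. A $$ (j, i) = cnj (A $$ (i, j))"
  proof (intro allI impI)
    fix i j assume "i < d" "j < d"
    then show "A $$ (j, i) = cnj (A $$ (i, j))"
      using A mat_adjoint_index[of j A i] unfolding eq by auto
  qed
next
  assume herm: "\<forall>i<d. \<forall>j<d. A $$ (j, i) = cnj (A $$ (i, j))"
  show "mat_adjoint A = A"
  proof (rule eq_matI)
    fix i j assume "i < dim_row A" "j < dim_col A"
    then have "i < d" "j < d" using A by auto
    then show "mat_adjoint A $$ (i, j) = A $$ (i, j)"
      using mat_adjoint_index[of i A j] A herm[rule_format, of j i] by simp
  qed (use A carrier_matD[OF mat_adjoint_carrier[OF A]] in auto)
qed

abbreviation diag_of :: "nat \<Rightarrow> (nat \<Rightarrow> complex) \<Rightarrow> complex mat" where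
  "diag_of d f \<equiv> Matrix.mat d d (\<lambda>(i, j). if i = j then f i else 0)"

lemma diag_of_carrier: "diag_of d f \<in> carrier_mat d d"
  by simp

lemma diag_of_mult_left_index:
  assumes "A \<in> carrier_mat d d" "i < d" "j < d"
  shows "(diag_of d f * A) $$ (i, j) = f i * A $$ (i, j)"
proof -
  have "(diag_of d f * A) $$ (i, j) = (\<Sum>p<d. if p = i then f i * A $$ (i, j) else 0)"
    unfolding mat_mult_index[OF diag_of_carrier assms] using assms by (intro sum.cong) auto
  then show ?thesis using assms by simp
qed

lemma diag_of_mult_right_index:
  assumes "A \<in> carrier_mat d d" "i < d" "j < d"
  shows "(A * diag_of d f) $$ (i, j) = A $$ (i, j) * f j"
proof -
  have "(A * diag_of d f) $$ (i, j) = (\<Sum>p<d. if p = j then A $$ (i, j) * f j else 0)"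
    unfolding mat_mult_index[OF assms(1) diag_of_carrier assms(2,3)] using assms by (intro sum.cong) auto
  then show ?thesis using assms by simp
qed

lemma diag_of_mult_vec_index:
  assumes "v \<in> carrier_vec d" "i < d"
  shows "(diag_of d f *\<^sub>v v) $ i = f i * v $ i"
proof -
  have "(diag_of d f *\<^sub>v v) $ i = (\<Sum>p<d. if p = i then f i * v $ i else 0)"
    unfolding mult_mat_vec_index[OF diag_of_carrier assms] using assms by (intro sum.cong) auto
  then show ?thesis using assms by simp
qed

lemma diag_of_mult: "diag_of d f * diag_of d g = diag_of d (\<lambda>i. f i * g i)"
proof (rule eq_matI)
  fix i j assume "i < dim_row (diag_of d (\<lambda>i. f i * g i))" "j < dim_col (diag_of d (\<lambda>i. f i * g i))"
  then have "i < d" "j < d" by auto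
  then show "(diag_of d f * diag_of d g) $$ (i, j) = diag_of d (\<lambda>i. f i * g i) $$ (i, j)"
    using diag_of_mult_left_index[OF diag_of_carrier, of i d j f g] by simp
qed auto

text \<open>Uniqueness holds because the columns of \<open>P\<close> are eigenvectors forming a
  basis. Existence is the longer half: the prescription concerns every eigenvector and not just
  these columns, so an arbitrary one has to be expanded in the basis.\<close>

lemma mat_cpow_diagonalized:
  assumes P: "P \<in> carrier_mat d d" and Q: "Q \<in> carrier_mat d d"
    and PQ: "P * Q = 1\<^sub>m d" and QP: "Q * P = 1\<^sub>m d"
    and A: "A = P * diag_of d es * Q"
  shows "mat_cpow A w = P * diag_of d (\<lambda>i. es i powr w) * Q"
proof -
  note assoc = assoc_mult_mat[of _ d d _ d _ d] mult_carrier_mat[of _ d d _ d]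
  let ?D = "diag_of d es" and ?Dw = "diag_of d (\<lambda>i. es i powr w)"
  let ?X = "P * ?Dw * Q"
  have dim: "dim_row A = d"
    using P by (simp add: A)
  have X: "?X \<in> carrier_mat d d"
    using P Q by (auto intro!: mult_carrier_mat)
  have QA: "Q * A = ?D * Q"
  proof -
    have "Q * A = (Q * P) * (?D * Q)"
      unfolding A using P Q by (simp add: assoc)
    then show ?thesis using Q by (simp add: QP assoc)
  qed
  have AP: "A * P = P * ?D"
  proof -
    have "A * P = P * (?D * (Q * P))"
      unfolding A using P Q by (simp add: assoc)
    then show ?thesis by (simp add: QP right_mult_one_mat[OF diag_of_carrier])
  qed
  have Acarr: "A \<in> carrier_mat d d"
    unfolding A using P Q by (auto intro!: mult_carrier_mat)
  have exists: "?X *\<^sub>v v = (c powr w) \<cdot>\<^sub>v v" if ev: "eigenvector A v c" for v c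
  proof -
    have v: "v \<in> carrier_vec d" and Av: "A *\<^sub>v v = c \<cdot>\<^sub>v v"
      using ev by (auto simp: eigenvector_def dim)
    define u where "u = Q *\<^sub>v v"
    have u: "u \<in> carrier_vec d"
      using Q v by (auto simp: u_def)
    have "?D *\<^sub>v u = c \<cdot>\<^sub>v u"
    proof -
      have "?D *\<^sub>v u = (?D * Q) *\<^sub>v v"
        unfolding u_def using Q v by (intro assoc_mult_mat_vec[symmetric]) auto
      also have "\<dots> = Q *\<^sub>v (c \<cdot>\<^sub>v v)"
        unfolding QA[symmetric] Av[symmetric] using Q Acarr v by (intro assoc_mult_mat_vec) auto
      also have "\<dots> = c \<cdot>\<^sub>v u"
        unfolding u_def using Q v by (intro mult_mat_vec)
      finally show ?thesis .
    qed
    \<comment> \<open>A coordinate of \<open>u\<close> can therefore be nonzero only where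
      \<open>es i\<close> equals c, and there the two powers agree.\<close>
    then have "es i * u $ i = c * u $ i" if "i < d" for i
      using diag_of_mult_vec_index[OF u that, of es] u that by auto
    then have "?Dw *\<^sub>v u = (c powr w) \<cdot>\<^sub>v u"
      using u by (intro eq_vecI) (auto simp: diag_of_mult_vec_index simp del: index_mult_mat_vec)
    then have "P *\<^sub>v (?Dw *\<^sub>v u) = (c powr w) \<cdot>\<^sub>v (P *\<^sub>v u)"
      using mult_mat_vec[OF P u] by simp
    moreover have "P *\<^sub>v u = v"
    proof -
      have "P *\<^sub>v u = (P * Q) *\<^sub>v v"
        unfolding u_def using P Q v by (intro assoc_mult_mat_vec[symmetric]) auto
      then show ?thesis using v by (simp add: PQ)
    qed
    moreover have "?X *\<^sub>v v = P *\<^sub>v (?Dw *\<^sub>v u)"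
    proof -
      have "?X *\<^sub>v v = (P * ?Dw) *\<^sub>v u"
        unfolding u_def using P Q v by (intro assoc_mult_mat_vec) (auto intro!: mult_carrier_mat)
      also have "\<dots> = P *\<^sub>v (?Dw *\<^sub>v u)"
        using P u by (intro assoc_mult_mat_vec) auto
      finally show ?thesis .
    qed
    ultimately show ?thesis by simp
  qed
  have unique: "Y = ?X"
    if Y: "Y \<in> carrier_mat d d" and ev: "\<And>v c. eigenvector A v c \<Longrightarrow> Y *\<^sub>v v = (c powr w) \<cdot>\<^sub>v v" for Y
  proof -
    have col_P: "eigenvector A (col P i) (es i)" if i: "i < d" for i
    proof -
      have "A *\<^sub>v col P i = col (A * P) i"
        using col_mult2[OF Acarr P i] by simp
      also have "\<dots> = es i \<cdot>\<^sub>v col P i"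
        unfolding AP using P i 
        by (intro eq_vecI) (auto simp: diag_of_mult_right_index[OF P] simp del: index_mult_mat(1))
      finally have "A *\<^sub>v col P i = es i \<cdot>\<^sub>v col P i" .
      moreover have "col P i \<noteq> 0\<^sub>v d"
      proof
        assume 0: "col P i = 0\<^sub>v d"
        have "(Q * P) $$ (i, i) = row Q i \<bullet> col P i"
          using P Q i by simp
        moreover have "(Q * P) $$ (i, i) = 1"
          using i by (simp add: QP)
        ultimately show False
          using Q i 0 by simp
      qed
      ultimately show ?thesis
        using P by (auto simp: eigenvector_def dim)
    qed
    have "Y * P = P * ?Dw"
    proof (rule eq_matI)
      fix i j assume "i < dim_row (P * ?Dw)" "j < dim_col (P * ?Dw)"
      then have ij: "i < d" "j < d" using P by auto
      have "(Y * P) $$ (i, j) = (Y *\<^sub>v col P j) $ i"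
        using Y P ij by simp
      also have "\<dots> = P $$ (i, j) * es j powr w"
        unfolding ev[OF col_P[OF ij(2)]] using P ij by simp
      also have "\<dots> = (P * ?Dw) $$ (i, j)"
        using P ij by (simp only: diag_of_mult_right_index)
      finally show "(Y * P) $$ (i, j) = (P * ?Dw) $$ (i, j)" .
    qed (use Y P in auto)
    then have "(Y * P) * Q = ?X" by simp
    moreover have "(Y * P) * Q = Y"
      using Y P Q by (simp add: assoc PQ)
    ultimately show "Y = ?X" by simp
  qed
  show ?thesis
    unfolding mat_cpow_def dim
    by (rule the_equality) (use X exists unique in blast)+
qed

lemma pos_def_mat_cpow:
  assumes A: "pos_def_mat d A"
  shows "mat_cpow A w \<in> carrier_mat d d"
    and "mat_cpow A w * mat_cpow A w' = mat_cpow A (w + w')"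
    and "mat_cpow A 0 = 1\<^sub>m d"
    and "mat_cpow A 1 = A"
    and "mat_adjoint (mat_cpow A (of_real r)) = mat_cpow A (of_real r)"
proof -
  obtain P Q es where P: "P \<in> carrier_mat d d" and Q: "Q \<in> carrier_mat d d"
    and PQ: "P * Q = 1\<^sub>m d" and QP: "Q * P = 1\<^sub>m d"
    and A_eq: "A = P * diag_of d es * Q" and pos: "\<And>i. i < d \<Longrightarrow> 0 < es i"
    by (rule pos_def_mat_diagonalizable[OF A]) (rule that)
  note cpow = mat_cpow_diagonalized[OF P Q PQ QP A_eq]
  note assoc = assoc_mult_mat[of _ d d _ d _ d] mult_carrier_mat[of _ d d _ d]
  have cancel: "P * (Q * X) = X" "Q * (P * X) = X" if "X \<in> carrier_mat d d" for X
  proof -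
    show "P * (Q * X) = X"
      using assoc_mult_mat[OF P Q that] that by (simp add: PQ)
    show "Q * (P * X) = X"
      using assoc_mult_mat[OF Q P that] that by (simp add: QP)
  qed
  \<comment> \<open>Eigenvalue 0 has to be excluded because \<open>0 powr 0\<close> is 0, which
    would spoil the law for exponent 0.\<close>
  have nz: "es i \<noteq> 0" if "i < d" for i
    using pos[OF that] by auto
  show "mat_cpow A w \<in> carrier_mat d d"
    unfolding cpow using P Q by (simp add: assoc)
  have "mat_cpow A w * mat_cpow A w' =
      P * (diag_of d (\<lambda>i. es i powr w) * diag_of d (\<lambda>i. es i powr w')) * Q"
    unfolding cpow using P Q by (simp add: assoc cancel)
  also have "\<dots> = mat_cpow A (w + w')"
    unfolding cpow diag_of_mult by (simp add: powr_def exp_add distrib_right if_distrib cong: if_cong)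
  finally show "mat_cpow A w * mat_cpow A w' = mat_cpow A (w + w')" .
  have "diag_of d (\<lambda>i. es i powr 0) = 1\<^sub>m d"
    using nz by (intro eq_matI) auto
  then show "mat_cpow A 0 = 1\<^sub>m d"
    unfolding cpow using P by (simp add: PQ)
  have "diag_of d (\<lambda>i. es i powr 1) = diag_of d es"
    using nz by (intro eq_matI) (auto simp: powr_to_1)
  then show "mat_cpow A 1 = A"
    using cpow[of 1] A_eq by simp
  let ?P' = "mat_adjoint P" and ?Q' = "mat_adjoint Q"
  have P': "?P' \<in> carrier_mat d d" and Q': "?Q' \<in> carrier_mat d d"
    using P Q by auto
  have one: "mat_adjoint (1\<^sub>m d) = (1\<^sub>m d :: complex mat)"
    by (subst mat_adjoint_eq_iff) auto
  have Q'P': "?Q' * ?P' = 1\<^sub>m d" and P'Q': "?P' * ?Q' = 1\<^sub>m d"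
    by (simp_all add: mat_adjoint_mult[OF P Q, symmetric] mat_adjoint_mult[OF Q P, symmetric] PQ QP one)
  have cancel': "?P' * (?Q' * X) = X" "?Q' * (?P' * X) = X" if "X \<in> carrier_mat d d" for X
  proof -
    show "?P' * (?Q' * X) = X"
      using assoc_mult_mat[OF P' Q' that] that by (simp add: P'Q')
    show "?Q' * (?P' * X) = X"
      using assoc_mult_mat[OF Q' P' that] that by (simp add: Q'P')
  qed
  have adj_diag: "mat_adjoint (diag_of d f) = diag_of d f" if "\<And>i. i < d \<Longrightarrow> cnj (f i) = f i" for f
    using that by (subst mat_adjoint_eq_iff[of _ d]) auto
  have adj: "mat_adjoint (P * diag_of d f * Q) = ?Q' * (diag_of d f * ?P')"
    if "\<And>i. i < d \<Longrightarrow> cnj (f i) = f i" for f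
    using mat_adjoint_mult[OF mult_carrier_mat[OF P diag_of_carrier] Q, of f]
      mat_adjoint_mult[OF P diag_of_carrier, of f] by (simp add: adj_diag[OF that])
  \<comment> \<open>\<open>P\<close> need not be unitary, but its Gram matrix commutes with the eigenvalue matrix, hence with its powers.\<close>
  let ?G = "?P' * P"
  have G: "?G \<in> carrier_mat d d"
    using P P' by (rule mult_carrier_mat[rotated])
  have es_real: "cnj (es i) = es i" if "i < d" for i
    using pos[OF that] by (auto simp: less_complex_def complex_eq_iff)
  have A_adj: "A = mat_adjoint A"
  proof (rule sym, subst mat_adjoint_eq_iff)
    show "A \<in> carrier_mat d d" using A by (simp add: pos_def_mat_def)
    show "\<forall>i<d. \<forall>j<d. A $$ (j, i) = cnj (A $$ (i, j))"
      by (intro allI impI pos_def_mat_hermitian[OF A])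
  qed
  have "mat_adjoint A = ?Q' * (diag_of d es * ?P')"
    unfolding A_eq by (rule adj) (rule es_real)
  with A_adj have A': "A = ?Q' * (diag_of d es * ?P')"
    by (rule trans)
  \<comment> \<open>The same matrix is evaluated once through A = P D Q and once through the adjoint
    of this factorisation, using that A is self-adjoint.\<close>
  have "?P' * (A * P) = ?G * diag_of d es"
    unfolding A_eq using P P' Q by (simp add: assoc QP)
  moreover have "?P' * (A * P) = diag_of d es * ?G"
    unfolding A' using P P' Q' by (simp add: assoc cancel')
  ultimately have comm: "?G * diag_of d es = diag_of d es * ?G" by simp
  \<comment> \<open>Read entrywise, the commutation says that the Gram matrix has no entries between
    distinct eigenvalues. This condition also makes it commute with every function of the
    eigenvalues.\<close>
  have G_es: "?G $$ (i, j) = 0 \<or> es i = es j" if "i < d" "j < d" for i j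
    using arg_cong[OF comm, of "\<lambda>M. M $$ (i, j)"]
    unfolding diag_of_mult_left_index[OF G that] diag_of_mult_right_index[OF G that] by auto
  let ?f = "\<lambda>i. es i powr of_real r"
  have f_real: "cnj (?f i) = ?f i" if i: "i < d" for i
  proof -
    have "es i = of_real (Re (es i))" "0 \<le> Re (es i)"
      using pos[OF i] by (auto simp: less_complex_def complex_eq_iff)
    then have "?f i = of_real (Re (es i) powr r)"
      using powr_of_real[of "Re (es i)" r] by simp
    then show ?thesis by (metis complex_cnj_complex_of_real)
  qed
  have "?G * diag_of d ?f = diag_of d ?f * ?G"
  proof (rule eq_matI)
    fix i j assume "i < dim_row (diag_of d ?f * ?G)" "j < dim_col (diag_of d ?f * ?G)"
    then have ij: "i < d" "j < d" using G by auto
    show "(?G * diag_of d ?f) $$ (i, j) = (diag_of d ?f * ?G) $$ (i, j)"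
      unfolding diag_of_mult_left_index[OF G ij] diag_of_mult_right_index[OF G ij]
      using G_es[OF ij] by auto
  qed (use G in auto)
  then have "?Q' * (?G * diag_of d ?f) * Q = ?Q' * (diag_of d ?f * ?G) * Q" by simp
  then have eq: "P * diag_of d ?f * Q = ?Q' * (diag_of d ?f * ?P')"
    using P P' Q Q' by (simp add: assoc cancel cancel' PQ)
  have "mat_adjoint (P * diag_of d ?f * Q) = ?Q' * (diag_of d ?f * ?P')"
    by (rule adj) (rule f_real)
  then show "mat_adjoint (mat_cpow A (of_real r)) = mat_cpow A (of_real r)"
    unfolding cpow using eq by (rule trans[OF _ sym])
qed

section \<open>Functionals and the adjoint of the multiplication\<close>

lemma mat_trace_mult:
  assumes "A \<in> carrier_mat d e" "B \<in> carrier_mat e d"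
  shows "mat_trace (A * B) = (\<Sum>i<d. \<Sum>j<e. A $$ (i, j) * B $$ (j, i))"
  using assms unfolding mat_trace_def
  by (auto simp: mat_mult_index[OF assms] simp del: index_mult_mat(1) intro!: sum.cong)

lemma mat_trace_comm:
  assumes "A \<in> carrier_mat d e" "B \<in> carrier_mat e d"
  shows "mat_trace (A * B) = mat_trace (B * A)"
  unfolding mat_trace_mult[OF assms] mat_trace_mult[OF assms(2,1)]
  by (subst sum.swap) (simp add: mult.commute)

lemma mlabels_eq_Sigma: "mlabels n = (SIGMA \<alpha>:UNIV. {..<n \<alpha>} \<times> {..<n \<alpha>})"
  by (auto simp: mlabels_def)

lemma mem_mlabels: "(\<alpha>, i, j) \<in> mlabels n \<longleftrightarrow> i < n \<alpha> \<and> j < n \<alpha>"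
  by (simp add: mlabels_def)

lemma finite_mlabels [simp]: "finite (mlabels n)"
  unfolding mlabels_eq_Sigma by (intro finite_SigmaI finite_cartesian_product) auto

lemma sum_mlabels:
  "(\<Sum>u\<in>mlabels n. f u) = (\<Sum>\<alpha>\<in>UNIV. \<Sum>i<n \<alpha>. \<Sum>j<n \<alpha>. f (\<alpha>, i, j))"
  unfolding mlabels_eq_Sigma by (simp add: sum.cartesian_product sum.Sigma split_def)

lemma sum_mlabels2:
  "(\<Sum>u\<in>mlabels n. \<Sum>v\<in>mlabels n. g u v) =
    (\<Sum>\<alpha>\<in>UNIV. \<Sum>i<n \<alpha>. \<Sum>j<n \<alpha>. \<Sum>\<beta>\<in>UNIV. \<Sum>k<n \<beta>. \<Sum>l<n \<beta>. g (\<alpha>, i, j) (\<beta>, k, l))"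
  by (simp add: sum_mlabels)

lemma sum_mlabels_row:
  fixes f :: "'k::finite mlabel \<Rightarrow> complex"
  assumes "k < n \<beta>"
  shows "(\<Sum>(\<alpha>, i, j)\<in>mlabels n. if \<alpha> = \<beta> \<and> i = k then f (\<alpha>, i, j) else 0) = (\<Sum>j<n \<beta>. f (\<beta>, k, j))"
proof -
  have "(\<Sum>i<n \<alpha>. \<Sum>j<n \<alpha>. if \<alpha> = \<beta> \<and> i = k then f (\<alpha>, i, j) else 0) =
      (if \<alpha> = \<beta> then \<Sum>j<n \<beta>. f (\<beta>, k, j) else 0)" for \<alpha>
  proof (cases "\<alpha> = \<beta>")
    case True
    have "(\<Sum>i<n \<beta>. \<Sum>j<n \<beta>. if i = k then f (\<beta>, i, j) else 0) =
        (\<Sum>i<n \<beta>. if i = k then \<Sum>j<n \<beta>. f (\<beta>, k, j) else 0)"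
      by (intro sum.cong) auto
    then show ?thesis unfolding True using assms by simp
  qed simp
  then show ?thesis
    by (simp add: sum_mlabels)
qed

lemma sum_swap_pairs:
  "(\<Sum>a\<in>A. \<Sum>b\<in>B. \<Sum>c\<in>C. \<Sum>d\<in>D. f a b c d) = (\<Sum>c\<in>C. \<Sum>d\<in>D. \<Sum>a\<in>A. \<Sum>b\<in>B. f a b c d)"
proof -
  have "(\<Sum>p\<in>A \<times> B. \<Sum>q\<in>C \<times> D. f (fst p) (snd p) (fst q) (snd q)) =
      (\<Sum>q\<in>C \<times> D. \<Sum>p\<in>A \<times> B. f (fst p) (snd p) (fst q) (snd q))"
    by (rule sum.swap)
  then show ?thesis
    by (simp add: sum.cartesian_product')
qed

section \<open>Elements of the algebra and the matrix of a functional\<close>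

lemma fd_algD: "x \<in> fd_alg n \<Longrightarrow> x \<alpha> \<in> carrier_mat (n \<alpha>) (n \<alpha>)"
  by (simp add: fd_alg_def)

lemma fd_alg_closed [simp]:
  "x \<in> fd_alg n \<Longrightarrow> y \<in> fd_alg n \<Longrightarrow> fd_add x y \<in> fd_alg n"
  "x \<in> fd_alg n \<Longrightarrow> fd_scale c x \<in> fd_alg n"
  "x \<in> fd_alg n \<Longrightarrow> y \<in> fd_alg n \<Longrightarrow> fd_mult x y \<in> fd_alg n"
  "x \<in> fd_alg n \<Longrightarrow> fd_star x \<in> fd_alg n"
  "munit n u \<in> fd_alg n" "fd_zero n \<in> fd_alg n" "mult_map n S \<in> fd_alg n"
  by (auto simp: fd_alg_def fd_add_def fd_scale_def fd_mult_def fd_star_def munit_def fd_zero_def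
      mult_map_def split: prod.splits intro!: mult_carrier_mat)

lemma fd_algI: "(\<And>\<alpha>. x \<alpha> \<in> carrier_mat (n \<alpha>) (n \<alpha>)) \<Longrightarrow> x \<in> fd_alg n"
  by (simp add: fd_alg_def)

lemma munit_index:
  "k < n \<beta> \<Longrightarrow> l < n \<beta> \<Longrightarrow>
    munit n (\<alpha>, i, j) \<beta> $$ (k, l) = (if \<beta> = \<alpha> \<and> k = i \<and> l = j then 1 else 0)"
  by (simp add: munit_def)

lemma fd_alg_eqI:
  assumes "x \<in> fd_alg n" "y \<in> fd_alg n"
    and "\<And>\<alpha> i j. i < n \<alpha> \<Longrightarrow> j < n \<alpha> \<Longrightarrow> x \<alpha> $$ (i, j) = y \<alpha> $$ (i, j)"
  shows "x = y"
proof
  fix \<alpha> show "x \<alpha> = y \<alpha>"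
    using assms fd_algD[OF assms(1), of \<alpha>] fd_algD[OF assms(2), of \<alpha>] by (intro eq_matI) auto
qed

lemma fd_functional_expand:
  assumes \<phi>: "fd_functional n \<phi>" and x: "x \<in> fd_alg n"
  shows "\<phi> x = (\<Sum>u\<in>mlabels n. mcoeff x u * \<phi> (munit n u))"
proof -
  \<comment> \<open>\<open>part S\<close> is the truncation of x to the labels in S. It turns the
    expansion into an induction that adds one matrix unit at a time.\<close>
  define part where "part = (\<lambda>S \<beta>. Matrix.mat (n \<beta>) (n \<beta>) (\<lambda>(k, l). if (\<beta>, k, l) \<in> S then x \<beta> $$ (k, l) else 0))"
  have part: "part S \<in> fd_alg n" for S
    by (simp add: part_def fd_alg_def)
  have add: "\<phi> (fd_add y z) = \<phi> y + \<phi> z" if "y \<in> fd_alg n" "z \<in> fd_alg n" for y z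
    using \<phi> that by (simp add: fd_functional_def)
  have scale: "\<phi> (fd_scale c y) = c * \<phi> y" if "y \<in> fd_alg n" for c y
    using \<phi> that by (simp add: fd_functional_def)
  have "\<phi> (part S) = (\<Sum>u\<in>S. mcoeff x u * \<phi> (munit n u))" if "finite S" "S \<subseteq> mlabels n" for S
    using that
  proof (induction S rule: finite_induct)
    case empty
    have "part {} = fd_scale 0 x"
      using fd_algD[OF x, THEN carrier_matD(1)] fd_algD[OF x, THEN carrier_matD(2)]
      by (intro fd_alg_eqI[OF part fd_alg_closed(2)[OF x]]) (simp add: part_def fd_scale_def)
    then show ?case using scale[OF x, of 0] by simp
  next
    case (insert u S)
    obtain \<alpha> i j where u: "u = (\<alpha>, i, j)" by (cases u)
    have "part (insert u S) = fd_add (fd_scale (mcoeff x u) (munit n u)) (part S)"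
    proof (rule fd_alg_eqI[OF part])
      fix \<beta> k l assume kl: "k < n \<beta>" "l < n \<beta>"
      then show "part (insert u S) \<beta> $$ (k, l) =
          fd_add (fd_scale (mcoeff x u) (munit n u)) (part S) \<beta> $$ (k, l)"
        using insert.hyps(2)
        by (auto simp: part_def fd_add_def fd_scale_def munit_def mcoeff_def u)
    qed (use part in simp)
    then show ?case
      using insert by (simp add: add scale part)
  qed
  moreover have "part (mlabels n) = x"
    by (intro fd_alg_eqI[OF part x]) (simp add: part_def mem_mlabels)
  ultimately show ?thesis by force
qed

text \<open>The matrix Q representing \<open>\<psi>\<close> against the plain trace. The indices are
  swapped because Tr(Q e_ji) is the entry Q_ij.\<close>

definition riesz_mat :: "('k::finite \<Rightarrow> nat) \<Rightarrow> (('k \<Rightarrow> complex mat) \<Rightarrow> complex) \<Rightarrow> 'k \<Rightarrow> complex mat" where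
  "riesz_mat n \<psi> = (\<lambda>\<alpha>. Matrix.mat (n \<alpha>) (n \<alpha>) (\<lambda>(i, j). \<psi> (munit n (\<alpha>, j, i))))"

lemma riesz_mat_carrier [simp]: "riesz_mat n \<psi> \<alpha> \<in> carrier_mat (n \<alpha>) (n \<alpha>)"
  by (simp add: riesz_mat_def)

lemma fd_functional_riesz:
  assumes "fd_functional n \<psi>" and x: "x \<in> fd_alg n"
  shows "\<psi> x = (\<Sum>\<alpha>\<in>UNIV. mat_trace (riesz_mat n \<psi> \<alpha> * x \<alpha>))"
proof -
  have "mat_trace (riesz_mat n \<psi> \<alpha> * x \<alpha>) =
      (\<Sum>j<n \<alpha>. \<Sum>i<n \<alpha>. mcoeff x (\<alpha>, j, i) * \<psi> (munit n (\<alpha>, j, i)))" for \<alpha>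
    unfolding mat_trace_mult[OF riesz_mat_carrier[of n \<psi>] fd_algD[OF x]]
    by (subst sum.swap) (simp add: riesz_mat_def mcoeff_def mult.commute)
  then show ?thesis
    using fd_functional_expand[OF assms] by (simp add: sum_mlabels)
qed

lemma star_mult_index:
  assumes "x \<in> fd_alg n" "y \<in> fd_alg n" "i < n \<alpha>" "j < n \<alpha>"
  shows "fd_mult (fd_star x) y \<alpha> $$ (i, j) = (\<Sum>p<n \<alpha>. cnj (x \<alpha> $$ (p, i)) * y \<alpha> $$ (p, j))"
proof -
  note x = fd_algD[OF assms(1), of \<alpha>] and y = fd_algD[OF assms(2), of \<alpha>]
  have "mat_adjoint (x \<alpha>) \<in> carrier_mat (n \<alpha>) (n \<alpha>)"
    using x by (rule mat_adjoint_carrier)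
  from mat_mult_index[OF this y assms(3,4)] show ?thesis
    using x assms by (auto simp: fd_mult_def fd_star_def mat_adjoint_index intro!: sum.cong)
qed

text \<open>Each rank one matrix v v^* has the form x^* x with x in the algebra, and
  \<open>\<psi>\<close> of it is <Q v, v>. Faithfulness then turns nonnegativity into strict
  positivity.\<close>

lemma riesz_mat_pos_def:
  assumes "faithful_positive_functional n \<psi>"
  shows "pos_def_mat (n \<alpha>) (riesz_mat n \<psi> \<alpha>)"
  unfolding pos_def_mat_def
proof (intro conjI ballI impI riesz_mat_carrier)
  fix v :: "complex Matrix.vec" assume v: "v \<in> carrier_vec (n \<alpha>)" "v \<noteq> 0\<^sub>v (n \<alpha>)"
  let ?Q = "riesz_mat n \<psi>"
  have lin: "fd_functional n \<psi>"
    and pos: "\<And>x. x \<in> fd_alg n \<Longrightarrow> 0 \<le> \<psi> (fd_mult (fd_star x) x)"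
    and faith: "\<And>x. x \<in> fd_alg n \<Longrightarrow> \<psi> (fd_mult (fd_star x) x) = 0 \<Longrightarrow> x = fd_zero n"
    using assms by (auto simp: faithful_positive_functional_def)
  obtain l where l: "l < n \<alpha>" "v $ l \<noteq> 0"
    using v by (metis carrier_vecD eq_vecI index_zero_vec)
  \<comment> \<open>The only nonzero row of x is the conjugate of v, placed in row 0 of block
    \<alpha>. That row exists because v is nonzero.\<close>
  define x where "x = (\<lambda>\<beta>. Matrix.mat (n \<beta>) (n \<beta>) (\<lambda>(k, l). if \<beta> = \<alpha> \<and> k = 0 then cnj (v $ l) else 0))"
  have x: "x \<in> fd_alg n"
    by (simp add: x_def fd_alg_def)
  have "x \<alpha> $$ (0, l) \<noteq> 0"
    using l by (simp add: x_def)
  then have "x \<noteq> fd_zero n"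
    using l by (auto simp: fd_zero_def)
  then have "0 < \<psi> (fd_mult (fd_star x) x)"
    using pos[OF x] faith[OF x] by (auto simp: less_le)
  also have "\<psi> (fd_mult (fd_star x) x) = (\<Sum>\<beta>\<in>UNIV. mat_trace (?Q \<beta> * fd_mult (fd_star x) x \<beta>))"
    using x by (intro fd_functional_riesz[OF lin]) simp
  also have "\<dots> = (\<Sum>\<beta>\<in>UNIV. if \<beta> = \<alpha> then (?Q \<alpha> *\<^sub>v v) \<bullet>c v else 0)"
  proof (intro sum.cong refl)
    fix \<beta> :: 'a
    have "fd_mult (fd_star x) x \<beta> $$ (j, i) = (if \<beta> = \<alpha> then v $ j * cnj (v $ i) else 0)"
      if "i < n \<beta>" "j < n \<beta>" for i j
    proof -
      have "fd_mult (fd_star x) x \<beta> $$ (j, i) = (\<Sum>p<n \<beta>. if p = 0 then (if \<beta> = \<alpha> then v $ j * cnj (v $ i) else 0) else 0)"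
        unfolding star_mult_index[OF x x that(2,1)] using that by (intro sum.cong) (auto simp: x_def)
      then show ?thesis using that by simp
    qed
    then have "mat_trace (?Q \<beta> * fd_mult (fd_star x) x \<beta>) =
        (\<Sum>i<n \<beta>. \<Sum>j<n \<beta>. ?Q \<beta> $$ (i, j) * (if \<beta> = \<alpha> then v $ j * cnj (v $ i) else 0))"
      unfolding mat_trace_mult[OF riesz_mat_carrier[of n \<psi>] fd_algD[OF fd_alg_closed(3)[OF fd_alg_closed(4)[OF x] x]]]
      by (intro sum.cong refl) simp
    also have "\<dots> = (if \<beta> = \<alpha> then (?Q \<alpha> *\<^sub>v v) \<bullet>c v else 0)"
      using mult_mat_vec_cscalar_prod[OF riesz_mat_carrier[of n \<psi> \<alpha>] v(1) v(1)] by (simp add: mult.assoc)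
    finally show "mat_trace (?Q \<beta> * fd_mult (fd_star x) x \<beta>) = (if \<beta> = \<alpha> then (?Q \<alpha> *\<^sub>v v) \<bullet>c v else 0)" .
  qed
  also have "\<dots> = (?Q \<alpha> *\<^sub>v v) \<bullet>c v"
    by simp
  finally show "0 < (?Q \<alpha> *\<^sub>v v) \<bullet>c v" .
qed

section \<open>The adjoint of the multiplication in coordinates\<close>

lemma tensor_spaceD: "S \<in> tensor_space n \<Longrightarrow> p \<notin> mlabels n \<times> mlabels n \<Longrightarrow> S p = 0"
  unfolding tensor_space_def by blast

lemma tensor_ip_iterated:
  "tensor_ip n ip T S = (\<Sum>u\<in>mlabels n. \<Sum>v\<in>mlabels n. \<Sum>u'\<in>mlabels n. \<Sum>v'\<in>mlabels n.
    cnj (T (u, v)) * S (u', v') * (ip (munit n u) (munit n u') * ip (munit n v) (munit n v')))"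
  by (simp add: tensor_ip_def sum.cartesian_product')

lemma tensor_ip_collect:
  "tensor_ip n ip T S = (\<Sum>u'\<in>mlabels n. \<Sum>v'\<in>mlabels n. S (u', v') *
    (\<Sum>u\<in>mlabels n. \<Sum>v\<in>mlabels n. cnj (T (u, v)) * (ip (munit n u) (munit n u') * ip (munit n v) (munit n v'))))"
proof -
  let ?t = "\<lambda>p q. S q * (cnj (T p) * (ip (munit n (fst p)) (munit n (fst q)) * ip (munit n (snd p)) (munit n (snd q))))"
  let ?M = "mlabels n \<times> mlabels n"
  have "tensor_ip n ip T S = (\<Sum>p\<in>?M. \<Sum>q\<in>?M. ?t p q)"
    unfolding tensor_ip_def split_def by (intro sum.cong refl) (simp add: mult_ac)
  also have "\<dots> = (\<Sum>q\<in>?M. \<Sum>p\<in>?M. ?t p q)"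
    by (rule sum.swap)
  also have "\<dots> = (\<Sum>q\<in>?M. S q * (\<Sum>p\<in>?M. cnj (T p) * (ip (munit n (fst p)) (munit n (fst q)) * ip (munit n (snd p)) (munit n (snd q)))))"
    by (simp only: sum_distrib_left)
  finally show ?thesis
    by (simp add: sum.cartesian_product')
qed

text \<open>The matrices are parameters because the formula for m^* is needed twice: with
  \<open>riesz_mat\<close>, to show that a density exists, and later with H^2 and H^-2, where H
  comes from the chosen density. The inverse \<open>R\<close> is carried along since it is what
  appears in m^*.\<close>

locale trace_functional =
  fixes n :: "'k::finite \<Rightarrow> nat" and \<psi> :: "('k \<Rightarrow> complex mat) \<Rightarrow> complex"
    and Q R :: "'k \<Rightarrow> complex mat"
  assumes Q: "\<And>\<alpha>. Q \<alpha> \<in> carrier_mat (n \<alpha>) (n \<alpha>)" and R: "\<And>\<alpha>. R \<alpha> \<in> carrier_mat (n \<alpha>) (n \<alpha>)"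
    and QR: "\<And>\<alpha>. Q \<alpha> * R \<alpha> = 1\<^sub>m (n \<alpha>)" and RQ: "\<And>\<alpha>. R \<alpha> * Q \<alpha> = 1\<^sub>m (n \<alpha>)"
    and R_hermitian: "\<And>\<alpha> i j. i < n \<alpha> \<Longrightarrow> j < n \<alpha> \<Longrightarrow> R \<alpha> $$ (j, i) = cnj (R \<alpha> $$ (i, j))"
    and trace_form: "\<And>x. x \<in> fd_alg n \<Longrightarrow> \<psi> x = (\<Sum>\<alpha>\<in>UNIV. mat_trace (Q \<alpha> * x \<alpha>))"
begin

lemma gns_ip_eq:
  assumes "x \<in> fd_alg n" "y \<in> fd_alg n"
  shows "gns_ip \<psi> x y =
    (\<Sum>\<alpha>\<in>UNIV. \<Sum>a<n \<alpha>. \<Sum>b<n \<alpha>. \<Sum>k<n \<alpha>. Q \<alpha> $$ (a, b) * cnj (x \<alpha> $$ (k, b)) * y \<alpha> $$ (k, a))"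
proof -
  have z: "fd_mult (fd_star x) y \<in> fd_alg n"
    using assms by simp
  show ?thesis
    unfolding gns_ip_def trace_form[OF z] mat_trace_mult[OF Q fd_algD[OF z]]
    using assms by (simp add: star_mult_index sum_distrib_left mult.assoc)
qed

lemma gns_ip_munit:
  assumes "u \<in> mlabels n" "v \<in> mlabels n"
  shows "gns_ip \<psi> (munit n u) (munit n v) =
    (case u of (\<alpha>, i, j) \<Rightarrow> case v of (\<beta>, k, l) \<Rightarrow> if \<alpha> = \<beta> \<and> i = k then Q \<alpha> $$ (l, j) else 0)"
proof -
  obtain \<alpha> i j \<beta> k l where uv: "u = (\<alpha>, i, j)" "v = (\<beta>, k, l)"
    by (cases u, cases v)
  have lt: "i < n \<alpha>" "j < n \<alpha>" "k < n \<beta>" "l < n \<beta>"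
    using assms by (auto simp: uv mem_mlabels)
  have "gns_ip \<psi> (munit n u) (munit n v) = (\<Sum>\<gamma>\<in>UNIV. \<Sum>a<n \<gamma>. \<Sum>b<n \<gamma>. \<Sum>p<n \<gamma>.
      if p = k then if b = j then if a = l then if \<gamma> = \<alpha> then if \<alpha> = \<beta> \<and> i = k then Q \<alpha> $$ (l, j) else 0 else 0 else 0 else 0 else 0)"
    unfolding gns_ip_eq[OF fd_alg_closed(5) fd_alg_closed(5)] uv
    by (intro sum.cong refl) (auto simp: munit_index)
  also have "\<dots> = (\<Sum>\<gamma>\<in>UNIV. if \<gamma> = \<alpha> then if \<alpha> = \<beta> \<and> i = k then Q \<alpha> $$ (l, j) else 0 else 0)"
  proof (intro sum.cong refl)
    fix \<gamma>
    show "(\<Sum>a<n \<gamma>. \<Sum>b<n \<gamma>. \<Sum>p<n \<gamma>.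
        if p = k then if b = j then if a = l then if \<gamma> = \<alpha> then if \<alpha> = \<beta> \<and> i = k then Q \<alpha> $$ (l, j) else 0 else 0 else 0 else 0 else 0) =
        (if \<gamma> = \<alpha> then if \<alpha> = \<beta> \<and> i = k then Q \<alpha> $$ (l, j) else 0 else 0)"
    proof (cases "\<gamma> = \<alpha> \<and> \<alpha> = \<beta> \<and> i = k")
      case True
      with lt show ?thesis by simp
    next
      case False
      then show ?thesis by (auto intro!: sum.neutral)
    qed
  qed
  also have "\<dots> = (if \<alpha> = \<beta> \<and> i = k then Q \<alpha> $$ (l, j) else 0)"
    by simp
  finally show ?thesis by (simp add: uv)
qed

lemma sum_gns_ip_munit:
  assumes "k < n \<beta>" "l < n \<beta>"
  shows "(\<Sum>u\<in>mlabels n. f u * gns_ip \<psi> (munit n u) (munit n (\<beta>, k, l))) = (\<Sum>j<n \<beta>. f (\<beta>, k, j) * Q \<beta> $$ (l, j))"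
proof -
  have "(\<Sum>u\<in>mlabels n. f u * gns_ip \<psi> (munit n u) (munit n (\<beta>, k, l))) =
      (\<Sum>(\<alpha>, i, j)\<in>mlabels n. if \<alpha> = \<beta> \<and> i = k then (\<lambda>(\<alpha>, i, j). f (\<alpha>, i, j) * Q \<alpha> $$ (l, j)) (\<alpha>, i, j) else 0)"
    using assms by (intro sum.cong refl) (auto simp: gns_ip_munit mem_mlabels)
  then show ?thesis
    using sum_mlabels_row[where n = n and \<beta> = \<beta> and k = k, OF assms(1), where f = "\<lambda>(\<alpha>, i, j). f (\<alpha>, i, j) * Q \<alpha> $$ (l, j)"] by simp
qed

lemma Q_R_index:
  assumes "i < n \<alpha>" "j < n \<alpha>"
  shows "(\<Sum>p<n \<alpha>. Q \<alpha> $$ (i, p) * R \<alpha> $$ (p, j)) = (if i = j then 1 else 0)"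
    and "(\<Sum>p<n \<alpha>. R \<alpha> $$ (i, p) * Q \<alpha> $$ (p, j)) = (if i = j then 1 else 0)"
  using mat_mult_index[OF Q R assms] mat_mult_index[OF R Q assms] assms by (simp_all add: QR RQ)

text \<open>For u = (\<alpha>, i, j) these are the coefficients of e_ij R, and such elements form
  the basis dual to the matrix units for the GNS inner product. Pairing with their tensor products
  reads off single coefficients of a tensor.\<close>

definition dual_unit :: "'k mlabel \<Rightarrow> 'k mlabel \<Rightarrow> complex" where
  "dual_unit = (\<lambda>(\<alpha>, i, j) (\<beta>, k, l). if (\<beta>, k, l) \<in> mlabels n \<and> \<alpha> = \<beta> \<and> i = k then R \<alpha> $$ (j, l) else 0)"

lemma sum_dual_unit:
  assumes u0: "u0 \<in> mlabels n" and u: "u \<in> mlabels n"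
  shows "(\<Sum>w\<in>mlabels n. dual_unit u0 w * gns_ip \<psi> (munit n u) (munit n w)) = (if u = u0 then 1 else 0)"
proof -
  obtain \<alpha> i j \<alpha>' i' j' where us: "u0 = (\<alpha>, i, j)" "u = (\<alpha>', i', j')"
    by (cases u0, cases u)
  have lt: "i < n \<alpha>" "j < n \<alpha>" "i' < n \<alpha>'" "j' < n \<alpha>'"
    using assms by (auto simp: us mem_mlabels)
  let ?f = "\<lambda>(\<beta>, k, l). if \<alpha>' = \<alpha> \<and> i' = i then R \<alpha> $$ (j, l) * Q \<alpha> $$ (l, j') else 0"
  have "(\<Sum>w\<in>mlabels n. dual_unit u0 w * gns_ip \<psi> (munit n u) (munit n w)) =
      (\<Sum>(\<beta>, k, l)\<in>mlabels n. if \<beta> = \<alpha> \<and> k = i then ?f (\<beta>, k, l) else 0)"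
    using u by (intro sum.cong refl) (auto simp: gns_ip_munit dual_unit_def us)
  also have "\<dots> = (\<Sum>l<n \<alpha>. if \<alpha>' = \<alpha> \<and> i' = i then R \<alpha> $$ (j, l) * Q \<alpha> $$ (l, j') else 0)"
    using sum_mlabels_row[where n = n and \<beta> = \<alpha> and k = i, OF lt(1), where f = ?f] by simp
  also have "\<dots> = (if u = u0 then 1 else 0)"
    using lt by (cases "\<alpha>' = \<alpha> \<and> i' = i") (auto simp: us Q_R_index)
  finally show ?thesis .
qed

lemma tensor_ip_dual_unit:
  assumes u0: "u0 \<in> mlabels n" and v0: "v0 \<in> mlabels n"
  shows "tensor_ip n (gns_ip \<psi>) T (\<lambda>(u, v). dual_unit u0 u * dual_unit v0 v) = cnj (T (u0, v0))"
proof -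
  let ?G = "\<lambda>u v. gns_ip \<psi> (munit n u) (munit n v)"
  have "tensor_ip n (gns_ip \<psi>) T (\<lambda>(u, v). dual_unit u0 u * dual_unit v0 v) =
      (\<Sum>u\<in>mlabels n. \<Sum>v\<in>mlabels n. cnj (T (u, v)) *
        ((\<Sum>w\<in>mlabels n. dual_unit u0 w * ?G u w) * (\<Sum>w\<in>mlabels n. dual_unit v0 w * ?G v w)))"
    unfolding tensor_ip_iterated sum_product unfolding sum_distrib_left
    by (intro sum.cong refl) (simp add: mult_ac)
  also have "\<dots> = (\<Sum>u\<in>mlabels n. \<Sum>v\<in>mlabels n. if v = v0 then if u = u0 then cnj (T (u0, v0)) else 0 else 0)"
    using u0 v0 by (intro sum.cong refl) (simp add: sum_dual_unit)
  also have "\<dots> = cnj (T (u0, v0))"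
    using u0 v0 by simp
  finally show ?thesis .
qed

text \<open>In other words, m^* sends e_ir to the sum of R_qp e_ip (x) e_qr over p and q. For the
  plain trace R is the identity and this is the usual comultiplication. In general the pairing
  brings one factor Q per leg: R cancels the one on the first leg, and the other is the Q of the
  inner product on B.\<close>

lemma mult_adj_eq:
  assumes x: "x \<in> fd_alg n"
  shows "mult_adj n \<psi> x = (\<lambda>((\<alpha>, i, p), (\<beta>, q, r)).
    if \<alpha> = \<beta> \<and> i < n \<alpha> \<and> p < n \<alpha> \<and> q < n \<alpha> \<and> r < n \<alpha> then x \<alpha> $$ (i, r) * R \<alpha> $$ (q, p) else 0)"
    (is "_ = ?T")
proof -
  let ?G = "\<lambda>u v. gns_ip \<psi> (munit n u) (munit n v)"
  have T: "?T \<in> tensor_space n"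
    by (auto simp: tensor_space_def mem_mlabels)
  have pull: "(\<Sum>u\<in>U. \<Sum>v\<in>V. t u v * (a u * b v)) = (\<Sum>u\<in>U. (\<Sum>v\<in>V. t u v * b v) * a u)"
    for U V :: "'k mlabel set" and t :: "'k mlabel \<Rightarrow> 'k mlabel \<Rightarrow> complex" and a b
    by (simp add: sum_distrib_left sum_distrib_right mult_ac)
  have L: "(\<Sum>u\<in>mlabels n. \<Sum>v\<in>mlabels n. cnj (?T (u, v)) * (?G u (\<alpha>, k, l) * ?G v (\<beta>, k', l'))) =
      (if \<beta> = \<alpha> then if l = k' then \<Sum>j<n \<alpha>. cnj (x \<alpha> $$ (k, j)) * Q \<alpha> $$ (l', j) else 0 else 0)"
    if lt: "k < n \<alpha>" "l < n \<alpha>" "k' < n \<beta>" "l' < n \<beta>" for \<alpha> \<beta> k l k' l'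
  proof -
    have "(\<Sum>u\<in>mlabels n. \<Sum>v\<in>mlabels n. cnj (?T (u, v)) * (?G u (\<alpha>, k, l) * ?G v (\<beta>, k', l'))) =
        (\<Sum>u\<in>mlabels n. (\<Sum>v\<in>mlabels n. cnj (?T (u, v)) * ?G v (\<beta>, k', l')) * ?G u (\<alpha>, k, l))"
      by (rule pull)
    also have "\<dots> = (\<Sum>j<n \<alpha>. \<Sum>j'<n \<beta>. cnj (?T ((\<alpha>, k, j), (\<beta>, k', j'))) * Q \<beta> $$ (l', j') * Q \<alpha> $$ (l, j))"
      unfolding sum_gns_ip_munit[OF lt(1,2)] sum_gns_ip_munit[OF lt(3,4)]
      by (simp add: sum_distrib_right)
    also have "\<dots> = (if \<beta> = \<alpha> then if l = k' then \<Sum>j<n \<alpha>. cnj (x \<alpha> $$ (k, j)) * Q \<alpha> $$ (l', j) else 0 else 0)"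
    proof (cases "\<beta> = \<alpha>")
      \<comment> \<open>The sum over j is an entry of Q R = 1; it forces l = k', which is the
        contraction performed by m. Hermitian symmetry of R removes the conjugate on its
        entry.\<close>
      case True
      have "(\<Sum>j<n \<alpha>. \<Sum>j'<n \<beta>. cnj (?T ((\<alpha>, k, j), (\<beta>, k', j'))) * Q \<beta> $$ (l', j') * Q \<alpha> $$ (l, j)) =
          (\<Sum>j<n \<alpha>. Q \<alpha> $$ (l, j) * R \<alpha> $$ (j, k')) * (\<Sum>j'<n \<alpha>. cnj (x \<alpha> $$ (k, j')) * Q \<alpha> $$ (l', j'))"
        using lt unfolding sum_product True
        by (intro sum.cong refl) (simp add: R_hermitian[of k' \<alpha>, symmetric])
      then show ?thesis
        using lt unfolding True by (simp add: Q_R_index)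
    qed simp
    finally show ?thesis .
  qed
  have adj: "tensor_ip n (gns_ip \<psi>) ?T S = gns_ip \<psi> x (mult_map n S)" for S
  proof -
    have "tensor_ip n (gns_ip \<psi>) ?T S = (\<Sum>u'\<in>mlabels n. \<Sum>v'\<in>mlabels n. S (u', v') *
        (\<Sum>u\<in>mlabels n. \<Sum>v\<in>mlabels n. cnj (?T (u, v)) * (?G u u' * ?G v v')))"
      by (rule tensor_ip_collect)
    also have "\<dots> = (\<Sum>\<alpha>\<in>UNIV. \<Sum>k<n \<alpha>. \<Sum>l<n \<alpha>. \<Sum>\<beta>\<in>UNIV. \<Sum>k'<n \<beta>. \<Sum>l'<n \<beta>. S ((\<alpha>, k, l), (\<beta>, k', l')) *
        (if \<beta> = \<alpha> then if l = k' then \<Sum>j<n \<alpha>. cnj (x \<alpha> $$ (k, j)) * Q \<alpha> $$ (l', j) else 0 else 0))"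
      by (rule trans[OF sum_mlabels2]) (intro sum.cong refl arg_cong[where f = "(*) _"] L; simp)
    also have "\<dots> = (\<Sum>\<alpha>\<in>UNIV. \<Sum>k<n \<alpha>. \<Sum>l<n \<alpha>. \<Sum>l'<n \<alpha>. \<Sum>j<n \<alpha>.
        S ((\<alpha>, k, l), (\<alpha>, l, l')) * (cnj (x \<alpha> $$ (k, j)) * Q \<alpha> $$ (l', j)))"
    proof (intro sum.cong refl)
      fix \<alpha> k l assume "l \<in> {..<n \<alpha>}"
      let ?c = "\<lambda>l'. \<Sum>j<n \<alpha>. cnj (x \<alpha> $$ (k, j)) * Q \<alpha> $$ (l', j)"
      have "(\<Sum>\<beta>\<in>UNIV. \<Sum>k'<n \<beta>. \<Sum>l'<n \<beta>. S ((\<alpha>, k, l), (\<beta>, k', l')) * (if \<beta> = \<alpha> then if l = k' then ?c l' else 0 else 0)) =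
          (\<Sum>\<beta>\<in>UNIV. if \<beta> = \<alpha> then \<Sum>k'<n \<alpha>. if k' = l then \<Sum>l'<n \<alpha>. S ((\<alpha>, k, l), (\<alpha>, l, l')) * ?c l' else 0 else 0)"
      proof (intro sum.cong refl)
        fix \<beta>
        have "(\<Sum>l'<n \<alpha>. S ((\<alpha>, k, l), (\<alpha>, k', l')) * (if l = k' then ?c l' else 0)) =
            (if k' = l then \<Sum>l'<n \<alpha>. S ((\<alpha>, k, l), (\<alpha>, l, l')) * ?c l' else 0)" for k'
          by (cases "k' = l") auto
        then show "(\<Sum>k'<n \<beta>. \<Sum>l'<n \<beta>. S ((\<alpha>, k, l), (\<beta>, k', l')) * (if \<beta> = \<alpha> then if l = k' then ?c l' else 0 else 0)) =
            (if \<beta> = \<alpha> then \<Sum>k'<n \<alpha>. if k' = l then \<Sum>l'<n \<alpha>. S ((\<alpha>, k, l), (\<alpha>, l, l')) * ?c l' else 0 else 0)"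
          by (cases "\<beta> = \<alpha>") (simp_all only: simp_thms if_True if_False mult_zero_right sum.neutral_const)
      qed
      also have "\<dots> = (\<Sum>l'<n \<alpha>. S ((\<alpha>, k, l), (\<alpha>, l, l')) * ?c l')"
        using \<open>l \<in> {..<n \<alpha>}\<close> by simp
      finally show "(\<Sum>\<beta>\<in>UNIV. \<Sum>k'<n \<beta>. \<Sum>l'<n \<beta>. S ((\<alpha>, k, l), (\<beta>, k', l')) * (if \<beta> = \<alpha> then if l = k' then ?c l' else 0 else 0)) =
          (\<Sum>l'<n \<alpha>. \<Sum>j<n \<alpha>. S ((\<alpha>, k, l), (\<alpha>, l, l')) * (cnj (x \<alpha> $$ (k, j)) * Q \<alpha> $$ (l', j)))"
        by (simp only: sum_distrib_left)
    qed
    also have "\<dots> = (\<Sum>\<alpha>\<in>UNIV. \<Sum>l'<n \<alpha>. \<Sum>j<n \<alpha>. \<Sum>k<n \<alpha>. \<Sum>l<n \<alpha>.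
        S ((\<alpha>, k, l), (\<alpha>, l, l')) * (cnj (x \<alpha> $$ (k, j)) * Q \<alpha> $$ (l', j)))"
      by (rule sum.cong[OF refl], rule sum_swap_pairs)
    also have "\<dots> = gns_ip \<psi> x (mult_map n S)"
      unfolding gns_ip_eq[OF x fd_alg_closed(7)]
      by (intro sum.cong refl) (simp add: mult_map_def sum_distrib_left mult_ac)
    finally show ?thesis .
  qed
  show ?thesis
    unfolding mult_adj_def
  proof (rule the_equality)
    show "?T \<in> tensor_space n \<and> (\<forall>S\<in>tensor_space n. tensor_ip n (gns_ip \<psi>) ?T S = gns_ip \<psi> x (mult_map n S))"
      using T adj by blast
  next
    fix T' assume T': "T' \<in> tensor_space n \<and> (\<forall>S\<in>tensor_space n. tensor_ip n (gns_ip \<psi>) T' S = gns_ip \<psi> x (mult_map n S))"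
    show "T' = ?T"
    proof
      fix p :: "'k mlabel \<times> 'k mlabel"
      obtain u0 v0 where p: "p = (u0, v0)" by (cases p) auto
      show "T' p = ?T p"
      proof (cases "u0 \<in> mlabels n \<and> v0 \<in> mlabels n")
        case True
        then have uv: "u0 \<in> mlabels n" "v0 \<in> mlabels n" by auto
        \<comment> \<open>A product of two dual units isolates one coefficient, so any tensor with
          the defining property of m^* agrees with ?T at this pair of labels.\<close>
        let ?D = "\<lambda>(u, v). dual_unit u0 u * dual_unit v0 v"
        have zero: "dual_unit u w = 0" if "w \<notin> mlabels n" for u w
          using that by (cases u, cases w) (simp add: dual_unit_def)
        have "?D q = 0" if "q \<notin> mlabels n \<times> mlabels n" for q
          using that zero[of "fst q" u0] zero[of "snd q" v0]
          by (cases "fst q \<in> mlabels n") (simp_all add: mem_Times_iff split_def)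
        then have D: "?D \<in> tensor_space n"
          by (simp only: tensor_space_def mem_Collect_eq) blast
        have "cnj (T' (u0, v0)) = tensor_ip n (gns_ip \<psi>) T' ?D"
          by (rule tensor_ip_dual_unit[OF uv, symmetric])
        also have "\<dots> = gns_ip \<psi> x (mult_map n ?D)"
          using T' D by blast
        also have "\<dots> = tensor_ip n (gns_ip \<psi>) ?T ?D"
          by (rule adj[symmetric])
        also have "\<dots> = cnj (?T (u0, v0))"
          by (rule tensor_ip_dual_unit[OF uv])
        finally have "cnj (T' (u0, v0)) = cnj (?T (u0, v0))" .
        then show ?thesis unfolding p complex_cnj_cancel_iff .
      next
        case False
        then have np: "p \<notin> mlabels n \<times> mlabels n" by (simp add: p)
        show ?thesis
          using tensor_spaceD[OF conjunct1[OF T'] np] tensor_spaceD[OF T np] by (rule trans[OF _ sym])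
      qed
    qed
  qed
qed

end

section \<open>The density and the KMS inner product\<close>

lemma mat_inverse_eqI:
  assumes A: "A \<in> carrier_mat d d" and B: "B \<in> carrier_mat d d"
    and AB: "A * B = 1\<^sub>m d" and BA: "B * A = 1\<^sub>m d"
  shows "mat_inverse A = Some B"
proof (cases "mat_inverse A")
  case None
  have "A \<in> Units (ring_mat TYPE('a) d ())"
    unfolding Units_def ring_mat_def using A B AB BA by auto
  with mat_inverse(1)[OF A None, of "()"] show ?thesis by blast
next
  case (Some C)
  from mat_inverse(2)[OF A this] have C: "C * A = 1\<^sub>m d" "C \<in> carrier_mat d d" by auto
  have "C = C * (A * B)"
    using C by (simp add: AB)
  also have "\<dots> = (C * A) * B"
    using A B C(2) by (intro assoc_mult_mat[symmetric]) auto
  also have "\<dots> = B"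
    using B by (simp add: C)
  finally show ?thesis using Some by simp
qed

lemma pos_def_mat_inverse:
  assumes A: "pos_def_mat d A"
  shows "mat_inverse A = Some (mat_cpow A (- 1))"
    and "A * mat_cpow A (- 1) = 1\<^sub>m d" and "mat_cpow A (- 1) * A = 1\<^sub>m d"
proof -
  note cpow = pos_def_mat_cpow[OF A]
  show 1: "A * mat_cpow A (- 1) = 1\<^sub>m d" and 2: "mat_cpow A (- 1) * A = 1\<^sub>m d"
    using cpow(2)[of 1 "- 1"] cpow(2)[of "- 1" 1] by (simp_all add: cpow(3,4))
  show "mat_inverse A = Some (mat_cpow A (- 1))"
    using A cpow(1) 1 2 by (intro mat_inverse_eqI) (auto simp: pos_def_mat_def)
qed

lemma mat_trace_smult: "A \<in> carrier_mat d d \<Longrightarrow> mat_trace (c \<cdot>\<^sub>m A) = c * mat_trace A"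
  by (auto simp: mat_trace_def sum_distrib_left intro!: sum.cong)

lemma density_exists:
  assumes fp: "faithful_positive_functional n \<psi>"
    and mm: "\<forall>x\<in>fd_alg n. mult_map n (mult_adj n \<psi> x) = x"
  shows "is_density n \<psi> (riesz_mat n \<psi>)"
proof -
  let ?Q = "riesz_mat n \<psi>" and ?R = "\<lambda>\<alpha>. mat_cpow (riesz_mat n \<psi> \<alpha>) (- 1)"
  note pd = riesz_mat_pos_def[OF fp]
  have lin: "fd_functional n \<psi>"
    using fp by (simp add: faithful_positive_functional_def)
  have R: "?R \<alpha> \<in> carrier_mat (n \<alpha>) (n \<alpha>)" for \<alpha>
    by (rule pos_def_mat_cpow(1)[OF pd])
  interpret trace_functional n \<psi> ?Q ?R
  proof
    fix \<alpha> i j assume "i < n \<alpha>" "j < n \<alpha>"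
    moreover have "mat_adjoint (?R \<alpha>) = ?R \<alpha>"
      using pos_def_mat_cpow(5)[OF pd, of \<alpha> "- 1"] by simp
    ultimately show "?R \<alpha> $$ (j, i) = cnj (?R \<alpha> $$ (i, j))"
      unfolding mat_adjoint_eq_iff[OF R] by blast
  qed (use R fd_functional_riesz[OF lin] pos_def_mat_inverse[OF pd] in auto)
  have tr: "mat_trace (the (mat_inverse (?Q \<alpha>))) * mat_trace (?Q \<alpha> * x \<alpha>) = mat_trace (?Q \<alpha> * x \<alpha>)"
    if x: "x \<in> fd_alg n" for x \<alpha>
  proof (cases "n \<alpha> = 0")
    \<comment> \<open>On an empty block m m^* = Id gives no information, and the trace of the
      inverse is 0 instead of 1. The claim survives because the other factor is an empty trace as
      well.\<close>
    case True
    then show ?thesis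
      using riesz_mat_carrier[of n \<psi> \<alpha>] by (simp add: mat_trace_def)
  next
    case False
    \<comment> \<open>The map m m^* multiplies each block by the trace of R; a single diagonal
      matrix unit reveals that this scalar is 1.\<close>
    let ?e = "munit n (\<alpha>, 0, 0)"
    have "1 = ?e \<alpha> $$ (0, 0)"
      using False by (simp add: munit_index)
    also have "\<dots> = mult_map n (mult_adj n \<psi> ?e) \<alpha> $$ (0, 0)"
      using mm by simp
    also have "\<dots> = (\<Sum>p<n \<alpha>. ?R \<alpha> $$ (p, p))"
      using False by (simp add: mult_map_def mult_adj_eq munit_index)
    also have "\<dots> = mat_trace (?R \<alpha>)"
      using R[of \<alpha>] by (simp add: mat_trace_def)
    finally show ?thesis
      by (simp add: pos_def_mat_inverse(1)[OF pd])
  qed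
  show ?thesis
    unfolding is_density_def
  proof (intro conjI allI ballI)
    fix x assume x: "x \<in> fd_alg n"
    show "\<psi> x = (\<Sum>\<alpha>\<in>UNIV. mat_trace (the (mat_inverse (?Q \<alpha>))) * mat_trace (?Q \<alpha> * x \<alpha>))"
      by (simp add: tr[OF x] trace_form[OF x])
  qed (rule pd)
qed

text \<open>The inverse is the square of the self-adjoint matrix A^(-1/2), so its trace is a squared
  Hilbert-Schmidt norm. Positivity is what permits taking the square root of this scalar in the
  construction of H.\<close>

lemma pos_def_mat_trace_inverse_pos:
  assumes A: "pos_def_mat d A" and d: "0 < d"
  shows "0 < mat_trace (the (mat_inverse A))"
proof -
  note cpow = pos_def_mat_cpow[OF A]
  let ?S = "mat_cpow A (- (1/2))" and ?T = "mat_cpow A (1/2)"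
  have "mat_adjoint ?S = ?S"
    using cpow(5)[of "- (1/2)"] by simp
  then have S: "?S $$ (j, i) = cnj (?S $$ (i, j))" if "i < d" "j < d" for i j
    using that unfolding mat_adjoint_eq_iff[OF cpow(1)] by blast
  have "mat_trace (the (mat_inverse A)) = mat_trace (?S * ?S)"
    by (simp add: pos_def_mat_inverse[OF A] cpow(2))
  also have "\<dots> = (\<Sum>i<d. \<Sum>j<d. of_real ((cmod (?S $$ (i, j)))\<^sup>2))"
    unfolding mat_trace_mult[OF cpow(1) cpow(1)]
  proof (intro sum.cong refl)
    fix i j assume "i \<in> {..<d}" "j \<in> {..<d}"
    then show "?S $$ (i, j) * ?S $$ (j, i) = of_real ((cmod (?S $$ (i, j)))\<^sup>2)"
      by (simp only: S[of i j] complex_norm_square lessThan_iff)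
  qed
  also have "\<dots> = of_real (\<Sum>i<d. \<Sum>j<d. (cmod (?S $$ (i, j)))\<^sup>2)"
    by simp
  finally have tr: "mat_trace (the (mat_inverse A)) = of_real (\<Sum>i<d. \<Sum>j<d. (cmod (?S $$ (i, j)))\<^sup>2)" .
  \<comment> \<open>Row 0 of an invertible matrix is not zero, so at least one of the squares is
    strictly positive.\<close>
  have "1 = (?S * ?T) $$ (0, 0)"
    using d by (simp add: cpow(2,3))
  also have "\<dots> = (\<Sum>p<d. ?S $$ (0, p) * ?T $$ (p, 0))"
    by (rule mat_mult_index[OF cpow(1) cpow(1) d d])
  finally have "\<exists>p<d. ?S $$ (0, p) \<noteq> 0"
    by (metis (no_types, lifting) lessThan_iff mult_zero_left sum.neutral zero_neq_one)
  then obtain p where p: "p < d" "?S $$ (0, p) \<noteq> 0" by blast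
  have "0 < (cmod (?S $$ (0, p)))\<^sup>2"
    using p by simp
  also have "\<dots> \<le> (\<Sum>j<d. (cmod (?S $$ (0, j)))\<^sup>2)"
    using p by (intro member_le_sum) auto
  also have "\<dots> \<le> (\<Sum>i<d. \<Sum>j<d. (cmod (?S $$ (i, j)))\<^sup>2)"
    using d by (intro member_le_sum[where f = "\<lambda>i. \<Sum>j<d. (cmod (?S $$ (i, j)))\<^sup>2"]) (auto intro: sum_nonneg)
  finally show ?thesis
    unfolding tr by (simp add: less_complex_def)
qed

text \<open>For self-adjoint H this is the operator relating the KMS and Hilbert-Schmidt inner
  products: <x, y>_KMS is the Hilbert-Schmidt product of H x H and y.\<close>

definition sandwich :: "('k::finite \<Rightarrow> complex mat) \<Rightarrow> ('k \<Rightarrow> complex mat) \<Rightarrow> 'k \<Rightarrow> complex mat" where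
  "sandwich H x = (\<lambda>\<alpha>. H \<alpha> * x \<alpha> * H \<alpha>)"

text \<open>All that is used of the density from here on. The arbitrary choice behind
  \<open>density\<close>, the scalar Tr(\<rho>^-1) and the complex powers are hidden in
  \<open>H\<close> and its inverse \<open>K\<close>.\<close>

locale kms_form =
  fixes n :: "'k::finite \<Rightarrow> nat" and \<psi> :: "('k \<Rightarrow> complex mat) \<Rightarrow> complex"
    and H K :: "'k \<Rightarrow> complex mat"
  assumes H: "\<And>\<alpha>. H \<alpha> \<in> carrier_mat (n \<alpha>) (n \<alpha>)" and K: "\<And>\<alpha>. K \<alpha> \<in> carrier_mat (n \<alpha>) (n \<alpha>)"
    and HK: "\<And>\<alpha>. H \<alpha> * K \<alpha> = 1\<^sub>m (n \<alpha>)" and KH: "\<And>\<alpha>. K \<alpha> * H \<alpha> = 1\<^sub>m (n \<alpha>)"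
    and H_adj: "\<And>\<alpha>. mat_adjoint (H \<alpha>) = H \<alpha>" and K_adj: "\<And>\<alpha>. mat_adjoint (K \<alpha>) = K \<alpha>"
    and psi_eq: "\<And>x. x \<in> fd_alg n \<Longrightarrow> \<psi> x = (\<Sum>\<alpha>\<in>UNIV. mat_trace (H \<alpha> * H \<alpha> * x \<alpha>))"
    and kms_ip_trace: "\<And>x y. x \<in> fd_alg n \<Longrightarrow> y \<in> fd_alg n \<Longrightarrow>
      kms_ip n \<psi> x y = (\<Sum>\<alpha>\<in>UNIV. mat_trace (H \<alpha> * mat_adjoint (x \<alpha>) * H \<alpha> * y \<alpha>))"

lemma smult_smult_mat:
  fixes A :: "complex mat"
  shows "a \<cdot>\<^sub>m (b \<cdot>\<^sub>m A) = (a * b) \<cdot>\<^sub>m A"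
  by (intro eq_matI) auto

lemma smult_smult_mult_mat:
  fixes A B :: "complex mat"
  assumes "A \<in> carrier_mat d d" "B \<in> carrier_mat d d"
  shows "(a \<cdot>\<^sub>m A) * (b \<cdot>\<^sub>m B) = (a * b) \<cdot>\<^sub>m (A * B)"
  using assms by (simp add: mult_smult_distrib[of _ d d _ d] mult_smult_assoc_mat[of _ d d _ d] smult_smult_mat mult.commute)

lemma mat_adjoint_smult:
  fixes A :: "complex mat"
  assumes "A \<in> carrier_mat d d"
  shows "mat_adjoint (c \<cdot>\<^sub>m A) = cnj c \<cdot>\<^sub>m mat_adjoint A"
  using assms carrier_matD[OF mat_adjoint_carrier[OF assms]]
    carrier_matD[OF mat_adjoint_carrier[OF smult_carrier_mat[OF assms]]]
  by (intro eq_matI) (auto simp: mat_adjoint_index)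

text \<open>\<open>SOME\<close> may return a density other than \<open>riesz_mat\<close>, one whose
  inverse need not have trace 1. So H is sqrt(t) \<rho>^(1/2), with t = Tr(\<rho>^-1) on every
  nonempty block, for whichever \<rho> was chosen.\<close>

lemma kms_form_exists:
  assumes fp: "faithful_positive_functional n \<psi>"
    and mm: "\<forall>x\<in>fd_alg n. mult_map n (mult_adj n \<psi> x) = x"
  shows "\<exists>H K. kms_form n \<psi> H K"
proof -
  define \<rho> where "\<rho> = density n \<psi>"
  have "is_density n \<psi> \<rho>"
    unfolding \<rho>_def density_def by (rule someI[of "is_density n \<psi>"], rule density_exists[OF assms])
  then have pd: "\<And>\<alpha>. pos_def_mat (n \<alpha>) (\<rho> \<alpha>)"
    and psi: "\<And>x. x \<in> fd_alg n \<Longrightarrow>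
      \<psi> x = (\<Sum>\<alpha>\<in>UNIV. mat_trace (the (mat_inverse (\<rho> \<alpha>))) * mat_trace (\<rho> \<alpha> * x \<alpha>))"
    by (auto simp: is_density_def)
  note cpow = pos_def_mat_cpow[OF pd]
  \<comment> \<open>On a block of size 0 the trace of the inverse is 0, and any positive number may replace it.\<close>
  define t where "t = (\<lambda>\<alpha>. if n \<alpha> = 0 then 1 else Re (mat_trace (the (mat_inverse (\<rho> \<alpha>)))))"
  have t_pos: "0 < t \<alpha>" for \<alpha>
    using pos_def_mat_trace_inverse_pos[OF pd, of \<alpha>] by (auto simp: t_def less_complex_def)
  have t_eq: "mat_trace (the (mat_inverse (\<rho> \<alpha>))) * mat_trace (\<rho> \<alpha> * x) = of_real (t \<alpha>) * mat_trace (\<rho> \<alpha> * x)" for \<alpha> x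
  proof (cases "n \<alpha> = 0")
    case True
    then have "dim_row (\<rho> \<alpha>) = 0"
      using pd[of \<alpha>] by (auto simp: pos_def_mat_def)
    then show ?thesis by (simp add: mat_trace_def)
  next
    case False
    then have "mat_trace (the (mat_inverse (\<rho> \<alpha>))) = of_real (t \<alpha>)"
      using pos_def_mat_trace_inverse_pos[OF pd, of \<alpha>] by (auto simp: t_def less_complex_def complex_eq_iff)
    then show ?thesis by simp
  qed
  define s where "s = (\<lambda>\<alpha>. complex_of_real (sqrt (t \<alpha>)))"
  have s: "s \<alpha> * s \<alpha> = of_real (t \<alpha>)" "s \<alpha> \<noteq> 0" "cnj (s \<alpha>) = s \<alpha>" "cnj (inverse (s \<alpha>)) = inverse (s \<alpha>)" for \<alpha>
    using t_pos[of \<alpha>] by (auto simp: s_def simp flip: of_real_mult)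
  define G L where "G = (\<lambda>\<alpha>. mat_cpow (\<rho> \<alpha>) (1/2))" and "L = (\<lambda>\<alpha>. mat_cpow (\<rho> \<alpha>) (- (1/2)))"
  have G: "G \<alpha> \<in> carrier_mat (n \<alpha>) (n \<alpha>)" and L: "L \<alpha> \<in> carrier_mat (n \<alpha>) (n \<alpha>)" for \<alpha>
    using cpow(1) by (auto simp: G_def L_def)
  have GL: "G \<alpha> * L \<alpha> = 1\<^sub>m (n \<alpha>)" and LG: "L \<alpha> * G \<alpha> = 1\<^sub>m (n \<alpha>)" and GG: "G \<alpha> * G \<alpha> = \<rho> \<alpha>" for \<alpha>
    by (simp_all add: G_def L_def cpow(2,3,4))
  have adj: "mat_adjoint (G \<alpha>) = G \<alpha>" "mat_adjoint (L \<alpha>) = L \<alpha>" for \<alpha>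
    using cpow(5)[of \<alpha> "1/2"] cpow(5)[of \<alpha> "- (1/2)"] by (simp_all add: G_def L_def)
  have psi_eq: "\<psi> x = (\<Sum>\<alpha>\<in>UNIV. of_real (t \<alpha>) * mat_trace (G \<alpha> * G \<alpha> * x \<alpha>))" if "x \<in> fd_alg n" for x
    unfolding psi[OF that] by (simp add: t_eq GG)
  define H K where "H = (\<lambda>\<alpha>. s \<alpha> \<cdot>\<^sub>m G \<alpha>)" and "K = (\<lambda>\<alpha>. inverse (s \<alpha>) \<cdot>\<^sub>m L \<alpha>)"
  have one: "(1::complex) \<cdot>\<^sub>m 1\<^sub>m d = 1\<^sub>m d" for d
    by (intro eq_matI) auto
  have "kms_form n \<psi> H K"
  proof
    fix \<alpha>
    show "H \<alpha> \<in> carrier_mat (n \<alpha>) (n \<alpha>)" "K \<alpha> \<in> carrier_mat (n \<alpha>) (n \<alpha>)"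
      using G L by (auto simp: H_def K_def)
    show "H \<alpha> * K \<alpha> = 1\<^sub>m (n \<alpha>)" "K \<alpha> * H \<alpha> = 1\<^sub>m (n \<alpha>)"
      using s(2)[of \<alpha>] by (simp_all add: one H_def K_def smult_smult_mult_mat[OF G L] smult_smult_mult_mat[OF L G] GL LG)
    show "mat_adjoint (H \<alpha>) = H \<alpha>" "mat_adjoint (K \<alpha>) = K \<alpha>"
      by (simp_all only: H_def K_def mat_adjoint_smult[OF G] mat_adjoint_smult[OF L] s adj)
  next
    fix x assume x: "x \<in> fd_alg n"
    have "of_real (t \<alpha>) * mat_trace (G \<alpha> * G \<alpha> * x \<alpha>) = mat_trace (H \<alpha> * H \<alpha> * x \<alpha>)" for \<alpha>
    proof -
      have "H \<alpha> * H \<alpha> * x \<alpha> = of_real (t \<alpha>) \<cdot>\<^sub>m (G \<alpha> * G \<alpha> * x \<alpha>)"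
        unfolding H_def smult_smult_mult_mat[OF G G] s(1)
        by (rule mult_smult_assoc_mat[OF mult_carrier_mat[OF G G] fd_algD[OF x]])
      then show ?thesis
        using G[of \<alpha>] fd_algD[OF x, of \<alpha>] by (simp add: mat_trace_smult[of _ "n \<alpha>"] mult_carrier_mat[of _ "n \<alpha>" "n \<alpha>" _ "n \<alpha>"])
    qed
    then show "\<psi> x = (\<Sum>\<alpha>\<in>UNIV. mat_trace (H \<alpha> * H \<alpha> * x \<alpha>))"
      by (simp add: psi_eq[OF x])
  next
    fix x y assume x: "x \<in> fd_alg n" and y: "y \<in> fd_alg n"
    \<comment> \<open>At z = -i/2 the exponent i z is 1/2. Under the trace, cyclicity then carries
      the trailing \<rho>^(-1/2) to the front, where it reduces \<rho> to \<rho>^(1/2) and leaves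
      the symmetric expression.\<close>
    have mg: "modular_group \<rho> (- (\<i> / 2)) y = (\<lambda>\<alpha>. G \<alpha> * y \<alpha> * L \<alpha>)"
      by (simp add: modular_group_def G_def L_def)
    have z: "fd_mult (fd_star x) (\<lambda>\<alpha>. G \<alpha> * y \<alpha> * L \<alpha>) \<in> fd_alg n"
    proof (intro fd_alg_closed(3,4) x fd_algI)
      fix \<alpha> show "G \<alpha> * y \<alpha> * L \<alpha> \<in> carrier_mat (n \<alpha>) (n \<alpha>)"
        using G[of \<alpha>] L[of \<alpha>] fd_algD[OF y, of \<alpha>]
        by (simp add: mult_carrier_mat[of _ "n \<alpha>" "n \<alpha>" _ "n \<alpha>"])
    qed
    have "of_real (t \<alpha>) * mat_trace (G \<alpha> * G \<alpha> * (mat_adjoint (x \<alpha>) * (G \<alpha> * y \<alpha> * L \<alpha>))) =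
        mat_trace (H \<alpha> * mat_adjoint (x \<alpha>) * H \<alpha> * y \<alpha>)" for \<alpha>
    proof -
      let ?d = "n \<alpha>" and ?x = "mat_adjoint (x \<alpha>)"
      note carr = G[of \<alpha>] L[of \<alpha>] mat_adjoint_carrier[OF fd_algD[OF x, of \<alpha>]] fd_algD[OF y, of \<alpha>]
      note assoc = assoc_mult_mat[of _ ?d ?d _ ?d _ ?d] mult_carrier_mat[of _ ?d ?d _ ?d]
      have "mat_trace (G \<alpha> * G \<alpha> * (?x * (G \<alpha> * y \<alpha> * L \<alpha>))) = mat_trace ((G \<alpha> * G \<alpha> * ?x * G \<alpha> * y \<alpha>) * L \<alpha>)"
        using carr by (simp add: assoc)
      also have "\<dots> = mat_trace (L \<alpha> * (G \<alpha> * G \<alpha> * ?x * G \<alpha> * y \<alpha>))"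
        using carr by (intro mat_trace_comm[of _ ?d ?d]) (auto simp: assoc)
      also have "L \<alpha> * (G \<alpha> * G \<alpha> * ?x * G \<alpha> * y \<alpha>) = (L \<alpha> * G \<alpha>) * (G \<alpha> * ?x * G \<alpha> * y \<alpha>)"
        using carr by (simp add: assoc)
      also have "\<dots> = G \<alpha> * ?x * G \<alpha> * y \<alpha>"
        unfolding LG using carr by (intro left_mult_one_mat) (auto simp: assoc)
      finally have eq: "mat_trace (G \<alpha> * G \<alpha> * (?x * (G \<alpha> * y \<alpha> * L \<alpha>))) = mat_trace (G \<alpha> * ?x * G \<alpha> * y \<alpha>)" .
      have "H \<alpha> * ?x * H \<alpha> * y \<alpha> = of_real (t \<alpha>) \<cdot>\<^sub>m (G \<alpha> * ?x * G \<alpha> * y \<alpha>)"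
        unfolding H_def using carr
        by (simp add: mult_smult_assoc_mat[of _ ?d ?d _ ?d] mult_smult_distrib[of _ ?d ?d _ ?d] assoc
            smult_smult_mat s(1))
      moreover have "G \<alpha> * ?x * G \<alpha> * y \<alpha> \<in> carrier_mat ?d ?d"
        using carr by (simp add: assoc)
      ultimately show ?thesis
        by (simp only: eq mat_trace_smult)
    qed
    then show "kms_ip n \<psi> x y = (\<Sum>\<alpha>\<in>UNIV. mat_trace (H \<alpha> * mat_adjoint (x \<alpha>) * H \<alpha> * y \<alpha>))"
      unfolding kms_ip_def \<rho>_def[symmetric] mg psi_eq[OF z] by (simp add: fd_mult_def fd_star_def)
  qed
  then show ?thesis by blast
qed

section \<open>Endomorphisms as tensors\<close>

lemma fd_star_star: "x \<in> fd_alg n \<Longrightarrow> fd_star (fd_star x) = x"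
proof -
  assume x: "x \<in> fd_alg n"
  have d: "dim_row (x \<alpha>) = n \<alpha>" "dim_col (x \<alpha>) = n \<alpha>"
    "dim_row (mat_adjoint (x \<alpha>)) = n \<alpha>" "dim_col (mat_adjoint (x \<alpha>)) = n \<alpha>" for \<alpha>
    using fd_algD[OF x, of \<alpha>] carrier_matD[OF mat_adjoint_carrier[OF fd_algD[OF x, of \<alpha>]]] by auto
  show ?thesis
    by (rule fd_alg_eqI[of _ n]) (use x d in \<open>simp_all add: fd_star_def mat_adjoint_index\<close>, use x in \<open>simp add: fd_star_def[symmetric]\<close>)
qed

lemma fd_star_index: "x \<in> fd_alg n \<Longrightarrow> i < n \<alpha> \<Longrightarrow> j < n \<alpha> \<Longrightarrow> fd_star x \<alpha> $$ (i, j) = cnj (x \<alpha> $$ (j, i))"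
  using fd_algD[of x n \<alpha>] by (auto simp: fd_star_def mat_adjoint_index)

lemma fd_add_index: "x \<in> fd_alg n \<Longrightarrow> y \<in> fd_alg n \<Longrightarrow> i < n \<alpha> \<Longrightarrow> j < n \<alpha> \<Longrightarrow>
    fd_add x y \<alpha> $$ (i, j) = x \<alpha> $$ (i, j) + y \<alpha> $$ (i, j)"
  using fd_algD[of y n \<alpha>] by (auto simp: fd_add_def)

lemma fd_scale_index: "x \<in> fd_alg n \<Longrightarrow> i < n \<alpha> \<Longrightarrow> j < n \<alpha> \<Longrightarrow> fd_scale c x \<alpha> $$ (i, j) = c * x \<alpha> $$ (i, j)"
  using fd_algD[of x n \<alpha>] by (auto simp: fd_scale_def)

lemma mcoeff_linear:
  assumes "x \<in> fd_alg n" "y \<in> fd_alg n" "u \<in> mlabels n"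
  shows "mcoeff (fd_add x y) u = mcoeff x u + mcoeff y u" "mcoeff (fd_scale c x) u = c * mcoeff x u"
  using assms by (cases u; simp add: mcoeff_def mem_mlabels fd_add_index fd_scale_index)+

lemma fd_endD:
  assumes "A \<in> fd_end n"
  shows "x \<in> fd_alg n \<Longrightarrow> A x \<in> fd_alg n"
    and "x \<in> fd_alg n \<Longrightarrow> y \<in> fd_alg n \<Longrightarrow> A (fd_add x y) = fd_add (A x) (A y)"
    and "x \<in> fd_alg n \<Longrightarrow> A (fd_scale c x) = fd_scale c (A x)"
    and "x \<notin> fd_alg n \<Longrightarrow> A x = undefined"
  using assms by (auto simp: fd_end_def PiE_def extensional_def)

lemma fd_add_scale_end:
  assumes "A \<in> fd_end n" "B \<in> fd_end n"
  shows "(\<lambda>x\<in>fd_alg n. fd_add (A x) (B x)) \<in> fd_end n" "(\<lambda>x\<in>fd_alg n. fd_scale c (A x)) \<in> fd_end n"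
proof -
  note A = fd_endD[OF assms(1)] and B = fd_endD[OF assms(2)]
  show "(\<lambda>x\<in>fd_alg n. fd_add (A x) (B x)) \<in> fd_end n"
    unfolding fd_end_def
    by (auto simp: A B intro!: fd_alg_eqI[of _ n] simp: fd_add_index[of _ n] fd_scale_index[of _ n] algebra_simps)
  show "(\<lambda>x\<in>fd_alg n. fd_scale c (A x)) \<in> fd_end n"
    unfolding fd_end_def
    by (auto simp: A B intro!: fd_alg_eqI[of _ n] simp: fd_add_index[of _ n] fd_scale_index[of _ n] algebra_simps)
qed

lemma sandwich_in_alg:
  assumes "\<And>\<alpha>. H \<alpha> \<in> carrier_mat (n \<alpha>) (n \<alpha>)" "x \<in> fd_alg n"
  shows "sandwich H x \<in> fd_alg n"
  using assms(1) fd_algD[OF assms(2)]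
  by (intro fd_algI) (auto simp: sandwich_def intro!: mult_carrier_mat)

lemma sandwich_linear:
  assumes H: "\<And>\<alpha>. H \<alpha> \<in> carrier_mat (n \<alpha>) (n \<alpha>)" and x: "x \<in> fd_alg n" and y: "y \<in> fd_alg n"
  shows "sandwich H (fd_add x y) = fd_add (sandwich H x) (sandwich H y)"
    and "sandwich H (fd_scale c x) = fd_scale c (sandwich H x)"
proof -
  have "H \<alpha> * (x \<alpha> + y \<alpha>) * H \<alpha> = H \<alpha> * x \<alpha> * H \<alpha> + H \<alpha> * y \<alpha> * H \<alpha>" for \<alpha>
  proof -
    have "H \<alpha> * (x \<alpha> + y \<alpha>) = H \<alpha> * x \<alpha> + H \<alpha> * y \<alpha>"
      by (rule mult_add_distrib_mat[OF H fd_algD[OF x] fd_algD[OF y]])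
    then show ?thesis
      by (simp add: add_mult_distrib_mat[OF mult_carrier_mat[OF H fd_algD[OF x]] mult_carrier_mat[OF H fd_algD[OF y]] H])
  qed
  then show "sandwich H (fd_add x y) = fd_add (sandwich H x) (sandwich H y)"
    by (simp add: sandwich_def fd_add_def)
  have "H \<alpha> * (c \<cdot>\<^sub>m x \<alpha>) * H \<alpha> = c \<cdot>\<^sub>m (H \<alpha> * x \<alpha> * H \<alpha>)" for \<alpha>
    by (simp add: mult_smult_distrib[OF H fd_algD[OF x]]
        mult_smult_assoc_mat[OF mult_carrier_mat[OF H fd_algD[OF x]] H])
  then show "sandwich H (fd_scale c x) = fd_scale c (sandwich H x)"
    by (simp add: sandwich_def fd_scale_def)
qed

section \<open>The KMS inner product as a twisted Hilbert-Schmidt product\<close>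

context kms_form
begin

lemma cancel:
  assumes "X \<in> carrier_mat (n \<alpha>) (n \<alpha>)"
  shows "H \<alpha> * (K \<alpha> * X) = X" "K \<alpha> * (H \<alpha> * X) = X"
  using assoc_mult_mat[OF H K assms] assoc_mult_mat[OF K H assms] assms by (simp_all add: HK KH)

lemma sandwich_cancel:
  assumes x: "x \<in> fd_alg n"
  shows "sandwich H (sandwich K x) = x" "sandwich K (sandwich H x) = x"
proof -
  have "H \<alpha> * (K \<alpha> * x \<alpha> * K \<alpha>) * H \<alpha> = x \<alpha>" "K \<alpha> * (H \<alpha> * x \<alpha> * H \<alpha>) * K \<alpha> = x \<alpha>" for \<alpha>
  proof -
    note assoc = assoc_mult_mat[of _ "n \<alpha>" "n \<alpha>" _ "n \<alpha>" _ "n \<alpha>"]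
      and mult_closed = mult_carrier_mat[of _ "n \<alpha>" "n \<alpha>" _ "n \<alpha>"]
    show "H \<alpha> * (K \<alpha> * x \<alpha> * K \<alpha>) * H \<alpha> = x \<alpha>" "K \<alpha> * (H \<alpha> * x \<alpha> * H \<alpha>) * K \<alpha> = x \<alpha>"
      using fd_algD[OF x, of \<alpha>] H[of \<alpha>] K[of \<alpha>] HK KH
      by (simp_all add: assoc mult_closed cancel)
  qed
  then show "sandwich H (sandwich K x) = x" "sandwich K (sandwich H x) = x"
    by (simp_all add: sandwich_def)
qed

lemma sandwich_H [simp]: "x \<in> fd_alg n \<Longrightarrow> sandwich H x \<in> fd_alg n"
  and sandwich_K [simp]: "x \<in> fd_alg n \<Longrightarrow> sandwich K x \<in> fd_alg n"
  using sandwich_in_alg H K by blast+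

lemma sandwich_adjoint:
  assumes x: "x \<in> fd_alg n"
  shows "H \<alpha> * mat_adjoint (x \<alpha>) * H \<alpha> = mat_adjoint (sandwich H x \<alpha>)"
  unfolding sandwich_def mat_adjoint_mult[OF mult_carrier_mat[OF H fd_algD[OF x]] H] mat_adjoint_mult[OF H fd_algD[OF x]] H_adj
  by (rule assoc_mult_mat[OF H mat_adjoint_carrier[OF fd_algD[OF x]] H])

text \<open>Cyclicity of the trace lets the twist sit on either argument. With the twist on the
  second one, the elements K e K for matrix units e act as a dual basis; having both forms makes the
  computation of the KMS adjoint symmetric.\<close>

lemma kms_ip_eq:
  assumes x: "x \<in> fd_alg n" and y: "y \<in> fd_alg n"
  shows "kms_ip n \<psi> x y = (\<Sum>\<alpha>\<in>UNIV. \<Sum>i<n \<alpha>. \<Sum>j<n \<alpha>. cnj (sandwich H x \<alpha> $$ (i, j)) * y \<alpha> $$ (i, j))"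
    and "kms_ip n \<psi> x y = (\<Sum>\<alpha>\<in>UNIV. \<Sum>i<n \<alpha>. \<Sum>j<n \<alpha>. cnj (x \<alpha> $$ (i, j)) * sandwich H y \<alpha> $$ (i, j))"
proof -
  have tr: "mat_trace (mat_adjoint (a \<alpha>) * b \<alpha>) = (\<Sum>i<n \<alpha>. \<Sum>j<n \<alpha>. cnj (a \<alpha> $$ (i, j)) * b \<alpha> $$ (i, j))"
    if a: "a \<in> fd_alg n" and b: "b \<in> fd_alg n" for a b \<alpha>
    unfolding mat_trace_mult[OF mat_adjoint_carrier[OF fd_algD[OF a]] fd_algD[OF b]]
    using fd_algD[OF a, of \<alpha>]
    by (subst sum.swap) (intro sum.cong refl, simp add: mat_adjoint_index)
  show "kms_ip n \<psi> x y = (\<Sum>\<alpha>\<in>UNIV. \<Sum>i<n \<alpha>. \<Sum>j<n \<alpha>. cnj (sandwich H x \<alpha> $$ (i, j)) * y \<alpha> $$ (i, j))"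
    unfolding kms_ip_trace[OF x y] sandwich_adjoint[OF x] tr[OF sandwich_H[OF x] y] ..
  have "mat_trace (H \<alpha> * mat_adjoint (x \<alpha>) * H \<alpha> * y \<alpha>) = mat_trace (mat_adjoint (x \<alpha>) * sandwich H y \<alpha>)" for \<alpha>
  proof -
    note carr = H[of \<alpha>] mat_adjoint_carrier[OF fd_algD[OF x, of \<alpha>]] fd_algD[OF y, of \<alpha>]
    note assoc = assoc_mult_mat[of _ "n \<alpha>" "n \<alpha>" _ "n \<alpha>" _ "n \<alpha>"]
      and mult_closed = mult_carrier_mat[of _ "n \<alpha>" "n \<alpha>" _ "n \<alpha>"]
    have "mat_trace (H \<alpha> * mat_adjoint (x \<alpha>) * H \<alpha> * y \<alpha>) = mat_trace (H \<alpha> * (mat_adjoint (x \<alpha>) * H \<alpha> * y \<alpha>))"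
      using carr by (simp add: assoc mult_closed)
    also have "\<dots> = mat_trace ((mat_adjoint (x \<alpha>) * H \<alpha> * y \<alpha>) * H \<alpha>)"
      using carr by (intro mat_trace_comm[of _ "n \<alpha>" "n \<alpha>"]) (auto simp: mult_closed)
    also have "(mat_adjoint (x \<alpha>) * H \<alpha> * y \<alpha>) * H \<alpha> = mat_adjoint (x \<alpha>) * sandwich H y \<alpha>"
      using carr by (simp add: sandwich_def assoc mult_closed)
    finally show ?thesis .
  qed
  then show "kms_ip n \<psi> x y = (\<Sum>\<alpha>\<in>UNIV. \<Sum>i<n \<alpha>. \<Sum>j<n \<alpha>. cnj (x \<alpha> $$ (i, j)) * sandwich H y \<alpha> $$ (i, j))"
    unfolding kms_ip_trace[OF x y] using tr[OF x sandwich_H[OF y]] by simp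
qed

section \<open>Tensors and endomorphisms\<close>

definition slice :: "'k fd_tensor \<Rightarrow> 'k mlabel \<Rightarrow> 'k \<Rightarrow> complex mat" where
  "slice S u = (\<lambda>\<beta>. Matrix.mat (n \<beta>) (n \<beta>) (\<lambda>(k, l). S (u, (\<beta>, k, l))))"

lemma slice_carrier [simp]: "slice S u \<beta> \<in> carrier_mat (n \<beta>) (n \<beta>)"
  by (simp add: slice_def)

text \<open>The map T_S = (id (x) Tr)(S (1 (x) H x H)), with the partial trace written out through
  slices. The restriction to \<open>fd_alg n\<close> places it in \<open>fd_end n\<close>, whose
  members are undefined elsewhere.\<close>

definition tensor_op :: "'k fd_tensor \<Rightarrow> ('k \<Rightarrow> complex mat) \<Rightarrow> 'k \<Rightarrow> complex mat" where
  "tensor_op S = (\<lambda>x\<in>fd_alg n. \<lambda>\<alpha>. Matrix.mat (n \<alpha>) (n \<alpha>)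
     (\<lambda>(i, j). \<Sum>\<beta>\<in>UNIV. mat_trace (slice S (\<alpha>, i, j) \<beta> * sandwich H x \<beta>)))"

lemma tensor_op_in_alg [simp]: "x \<in> fd_alg n \<Longrightarrow> tensor_op S x \<in> fd_alg n"
  by (simp add: tensor_op_def fd_alg_def)

lemma tensor_op_index:
  assumes "x \<in> fd_alg n" "i < n \<alpha>" "j < n \<alpha>"
  shows "tensor_op S x \<alpha> $$ (i, j) = (\<Sum>\<beta>\<in>UNIV. mat_trace (slice S (\<alpha>, i, j) \<beta> * sandwich H x \<beta>))"
  using assms by (simp add: tensor_op_def)

lemma slice_trace:
  assumes x: "x \<in> fd_alg n"
  shows "mat_trace (slice S u \<beta> * x \<beta>) = (\<Sum>k<n \<beta>. \<Sum>l<n \<beta>. S (u, (\<beta>, k, l)) * x \<beta> $$ (l, k))"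
  unfolding mat_trace_mult[OF slice_carrier fd_algD[OF x]] by (simp add: slice_def)

lemma tensor_op_index':
  assumes "x \<in> fd_alg n" "i < n \<alpha>" "j < n \<alpha>"
  shows "tensor_op S x \<alpha> $$ (i, j) =
    (\<Sum>\<beta>\<in>UNIV. \<Sum>k<n \<beta>. \<Sum>l<n \<beta>. S ((\<alpha>, i, j), (\<beta>, k, l)) * sandwich H x \<beta> $$ (l, k))"
  unfolding tensor_op_index[OF assms] using assms by (simp add: slice_trace)

lemma tensor_op_end: "tensor_op S \<in> fd_end n"
  unfolding fd_end_def
proof (intro CollectI conjI ballI allI)
  show "tensor_op S \<in> fd_alg n \<rightarrow>\<^sub>E fd_alg n"
    by (auto simp: tensor_op_def fd_alg_def)
  fix x assume x: "x \<in> fd_alg n"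
  { fix y assume y: "y \<in> fd_alg n"
    show "tensor_op S (fd_add x y) = fd_add (tensor_op S x) (tensor_op S y)"
      using x y
      by (intro fd_alg_eqI[of _ n])
        (simp_all add: fd_add_index[of _ n] tensor_op_index' sandwich_linear[OF H] distrib_left sum.distrib) }
  fix c show "tensor_op S (fd_scale c x) = fd_scale c (tensor_op S x)"
    using x
    by (intro fd_alg_eqI[of _ n])
      (simp_all add: fd_scale_index[of _ n] tensor_op_index' sandwich_linear[OF H] sum_distrib_left mult_ac)
qed

text \<open>The inverse construction. Applying T_S to K e_lk K undoes the twist, and the trace of a
  slice against e_lk is its entry (k, l); hence the transposed label.\<close>

definition op_tensor :: "(('k \<Rightarrow> complex mat) \<Rightarrow> 'k \<Rightarrow> complex mat) \<Rightarrow> 'k fd_tensor" where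
  "op_tensor A = (\<lambda>(u, (\<beta>, k, l)). if u \<in> mlabels n \<and> (\<beta>, k, l) \<in> mlabels n
     then mcoeff (A (sandwich K (munit n (\<beta>, l, k)))) u else 0)"

lemma op_tensor_space: "op_tensor A \<in> tensor_space n"
  by (auto simp: tensor_space_def op_tensor_def)

lemma tensor_op_sandwich_munit:
  assumes "i < n \<alpha>" "j < n \<alpha>" "k < n \<beta>" "l < n \<beta>"
  shows "tensor_op S (sandwich K (munit n (\<beta>, l, k))) \<alpha> $$ (i, j) = S ((\<alpha>, i, j), (\<beta>, k, l))"
proof -
  have "tensor_op S (sandwich K (munit n (\<beta>, l, k))) \<alpha> $$ (i, j) =
      (\<Sum>\<gamma>\<in>UNIV. if \<gamma> = \<beta> then S ((\<alpha>, i, j), (\<beta>, k, l)) else 0)"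
  proof (unfold tensor_op_index'[OF sandwich_K[OF fd_alg_closed(5)] assms(1,2)], rule sum.cong[OF refl])
    fix \<gamma>
    have "(\<Sum>p<n \<gamma>. \<Sum>q<n \<gamma>. S ((\<alpha>, i, j), \<gamma>, p, q) * sandwich H (sandwich K (munit n (\<beta>, l, k))) \<gamma> $$ (q, p)) =
        (\<Sum>p<n \<gamma>. \<Sum>q<n \<gamma>. if q = l then if p = k then if \<gamma> = \<beta> then S ((\<alpha>, i, j), (\<beta>, k, l)) else 0 else 0 else 0)"
      by (intro sum.cong refl) (auto simp: sandwich_cancel munit_index)
    also have "\<dots> = (if \<gamma> = \<beta> then S ((\<alpha>, i, j), (\<beta>, k, l)) else 0)"
      using assms by (cases "\<gamma> = \<beta>") auto
    finally show "(\<Sum>p<n \<gamma>. \<Sum>q<n \<gamma>. S ((\<alpha>, i, j), \<gamma>, p, q) * sandwich H (sandwich K (munit n (\<beta>, l, k))) \<gamma> $$ (q, p)) =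
        (if \<gamma> = \<beta> then S ((\<alpha>, i, j), (\<beta>, k, l)) else 0)" .
  qed
  then show ?thesis by simp
qed

lemma op_tensor_tensor_op:
  assumes S: "S \<in> tensor_space n"
  shows "op_tensor (tensor_op S) = S"
proof
  fix p :: "'k mlabel \<times> 'k mlabel"
  obtain \<alpha> i j \<beta> k l where p: "p = ((\<alpha>, i, j), (\<beta>, k, l))"
    by (cases p) auto
  show "op_tensor (tensor_op S) p = S p"
  proof (cases "(\<alpha>, i, j) \<in> mlabels n \<and> (\<beta>, k, l) \<in> mlabels n")
    case True
    then show ?thesis
      by (simp add: p op_tensor_def mcoeff_def mem_mlabels tensor_op_sandwich_munit)
  next
    case False
    then show ?thesis
      using tensor_spaceD[OF S, of p] by (auto simp: p op_tensor_def)
  qed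
qed

lemma tensor_op_op_tensor:
  assumes A: "A \<in> fd_end n"
  shows "tensor_op (op_tensor A) = A"
proof
  fix x show "tensor_op (op_tensor A) x = A x"
  proof (cases "x \<in> fd_alg n")
    case False
    then show ?thesis by (simp add: tensor_op_def fd_endD(4)[OF A])
  next
    case x: True
    show ?thesis
    proof (rule fd_alg_eqI[OF tensor_op_in_alg[OF x] fd_endD(1)[OF A x]])
      fix \<alpha> i j assume ij: "i < n \<alpha>" "j < n \<alpha>"
      then have u: "(\<alpha>, i, j) \<in> mlabels n" by (simp add: mem_mlabels)
      \<comment> \<open>Each entry of A (K y K) is a linear functional of y. Expanding it in matrix
        units at y = H x H yields the coefficients of \<open>op_tensor A\<close> and evaluates A at
        x.\<close>
      define \<phi> where "\<phi> = (\<lambda>y. mcoeff (A (sandwich K y)) (\<alpha>, i, j))"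
      have "fd_functional n \<phi>"
        unfolding fd_functional_def \<phi>_def
        by (simp add: sandwich_linear[OF K] fd_endD[OF A] mcoeff_linear[OF _ _ u])
      from fd_functional_expand[OF this sandwich_H[OF x]]
      have "\<phi> (sandwich H x) = (\<Sum>\<beta>\<in>UNIV. \<Sum>l<n \<beta>. \<Sum>k<n \<beta>. sandwich H x \<beta> $$ (l, k) * \<phi> (munit n (\<beta>, l, k)))"
        by (simp add: sum_mlabels mcoeff_def)
      also have "\<dots> = (\<Sum>\<beta>\<in>UNIV. \<Sum>l<n \<beta>. \<Sum>k<n \<beta>. op_tensor A ((\<alpha>, i, j), (\<beta>, k, l)) * sandwich H x \<beta> $$ (l, k))"
        using u by (intro sum.cong refl) (simp add: op_tensor_def \<phi>_def mem_mlabels)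
      also have "\<dots> = tensor_op (op_tensor A) x \<alpha> $$ (i, j)"
        unfolding tensor_op_index'[OF x ij] by (intro sum.cong[OF refl] sum.swap)
      finally show "tensor_op (op_tensor A) x \<alpha> $$ (i, j) = A x \<alpha> $$ (i, j)"
        by (simp add: \<phi>_def sandwich_cancel[OF x] mcoeff_def)
    qed
  qed
qed

lemma op_tensor_inj:
  assumes "A \<in> fd_end n" "B \<in> fd_end n" "op_tensor A = op_tensor B"
  shows "A = B"
  by (metis assms tensor_op_op_tensor)

lemma op_tensor_linear:
  assumes A: "A \<in> fd_end n" and B: "B \<in> fd_end n"
  shows "op_tensor (\<lambda>x\<in>fd_alg n. fd_add (A x) (B x)) = (\<lambda>p. op_tensor A p + op_tensor B p)"
    and "op_tensor (\<lambda>x\<in>fd_alg n. fd_scale c (A x)) = (\<lambda>p. c * op_tensor A p)"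
  by (auto simp: op_tensor_def fun_eq_iff fd_endD[OF A] fd_endD[OF B] mcoeff_linear[of _ n] mcoeff_linear(2)[of _ n "fd_zero n"])

section \<open>Rank one maps and the uniqueness of the correspondence\<close>

lemma kms_ip_linear:
  assumes "b \<in> fd_alg n" "x \<in> fd_alg n" "y \<in> fd_alg n"
  shows "kms_ip n \<psi> b (fd_add x y) = kms_ip n \<psi> b x + kms_ip n \<psi> b y"
    and "kms_ip n \<psi> b (fd_scale c x) = c * kms_ip n \<psi> b x"
  using assms
  by (simp_all add: kms_ip_eq(1) fd_add_index[of _ n] fd_scale_index[of _ n] distrib_left sum.distrib sum_distrib_left mult_ac)

lemma rank_one_end:
  assumes a: "a \<in> fd_alg n" and b: "b \<in> fd_alg n"
  shows "rank_one n \<psi> a b \<in> fd_end n"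
  unfolding fd_end_def rank_one_def using a
  by (auto simp: kms_ip_linear[OF b] intro!: fd_alg_eqI[of _ n] simp: fd_add_index[of _ n] fd_scale_index[of _ n] algebra_simps)

lemma op_tensor_rank_one:
  assumes a: "a \<in> fd_alg n" and b: "b \<in> fd_alg n"
  shows "op_tensor (rank_one n \<psi> a b) = fd_tens n a (fd_star b)"
proof
  fix p :: "'k mlabel \<times> 'k mlabel"
  obtain u \<beta> k l where p: "p = (u, (\<beta>, k, l))"
    by (cases p) auto
  show "op_tensor (rank_one n \<psi> a b) p = fd_tens n a (fd_star b) p"
  proof (cases "u \<in> mlabels n \<and> (\<beta>, k, l) \<in> mlabels n")
    case True
    then have kl: "k < n \<beta>" "l < n \<beta>" by (auto simp: mem_mlabels)
    have "kms_ip n \<psi> b (sandwich K (munit n (\<beta>, l, k))) =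
        (\<Sum>\<gamma>\<in>UNIV. if \<gamma> = \<beta> then cnj (b \<beta> $$ (l, k)) else 0)"
    proof (unfold kms_ip_eq(2)[OF b sandwich_K[OF fd_alg_closed(5)]], rule sum.cong[OF refl])
      fix \<gamma>
      have "(\<Sum>i<n \<gamma>. \<Sum>j<n \<gamma>. cnj (b \<gamma> $$ (i, j)) * sandwich H (sandwich K (munit n (\<beta>, l, k))) \<gamma> $$ (i, j)) =
          (\<Sum>i<n \<gamma>. \<Sum>j<n \<gamma>. if j = k then if i = l then if \<gamma> = \<beta> then cnj (b \<beta> $$ (l, k)) else 0 else 0 else 0)"
        by (intro sum.cong refl) (auto simp: sandwich_cancel munit_index)
      also have "\<dots> = (if \<gamma> = \<beta> then cnj (b \<beta> $$ (l, k)) else 0)"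
        using kl by (cases "\<gamma> = \<beta>") auto
      finally show "(\<Sum>i<n \<gamma>. \<Sum>j<n \<gamma>. cnj (b \<gamma> $$ (i, j)) * sandwich H (sandwich K (munit n (\<beta>, l, k))) \<gamma> $$ (i, j)) =
          (if \<gamma> = \<beta> then cnj (b \<beta> $$ (l, k)) else 0)" .
    qed
    then have "kms_ip n \<psi> b (sandwich K (munit n (\<beta>, l, k))) = mcoeff (fd_star b) (\<beta>, k, l)"
      using b kl by (simp add: mcoeff_def fd_star_index)
    then show ?thesis
      using True by (simp add: p op_tensor_def fd_tens_def rank_one_def mcoeff_linear(2)[OF a a])
  next
    case False
    then show ?thesis by (auto simp: p op_tensor_def fd_tens_def)
  qed
qed

text \<open>This gives the uniqueness hidden in the \<open>THE\<close> of \<open>Psi_KMS\<close>.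
  Rank one maps span the endomorphisms; the induction peels off one coefficient of
  \<open>op_tensor A\<close> at a time, so its measure is the support of that tensor.\<close>

lemma op_tensor_unique:
  assumes F_add: "\<And>A B. A \<in> fd_end n \<Longrightarrow> B \<in> fd_end n \<Longrightarrow>
      F (\<lambda>x\<in>fd_alg n. fd_add (A x) (B x)) = (\<lambda>p. F A p + F B p)"
    and F_scale: "\<And>c A. A \<in> fd_end n \<Longrightarrow> F (\<lambda>x\<in>fd_alg n. fd_scale c (A x)) = (\<lambda>p. c * F A p)"
    and F_rank: "\<And>a b. a \<in> fd_alg n \<Longrightarrow> b \<in> fd_alg n \<Longrightarrow> F (rank_one n \<psi> a b) = fd_tens n a (fd_star b)"
    and A: "A \<in> fd_end n"
  shows "F A = op_tensor A"
proof -
  have "F A = op_tensor A" if "finite U" "A \<in> fd_end n" "\<And>p. p \<notin> U \<Longrightarrow> op_tensor A p = 0" for U A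
    using that
  proof (induction U arbitrary: A rule: finite_induct)
    case empty
    \<comment> \<open>With empty support A is the zero map, which equals 0 times A; homogeneity
      alone then determines the value of F.\<close>
    let ?Z = "\<lambda>x\<in>fd_alg n. fd_scale 0 (A x)"
    have 0: "op_tensor A = (\<lambda>p. 0)"
      using empty.prems by auto
    have "?Z = A"
      using empty.prems(1) by (intro op_tensor_inj fd_add_scale_end(2)[of A n A]) (simp_all add: op_tensor_linear(2)[of A A] 0)
    moreover have "F ?Z = (\<lambda>p. 0)"
      using F_scale[OF empty.prems(1), of 0] by simp
    ultimately show ?case by (simp add: 0)
  next
    case (insert p U)
    obtain u v where p: "p = (u, v)" by (cases p) auto
    show ?case
    proof (cases "u \<in> mlabels n \<and> v \<in> mlabels n")
      case False
      then have "op_tensor A p = 0"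
        using tensor_spaceD[OF op_tensor_space, of p A] by (auto simp: p)
      with insert.prems(2) have "op_tensor A q = 0" if "q \<notin> U" for q
        using that by (cases "q = p") auto
      with insert.IH[OF insert.prems(1)] show ?thesis by blast
    next
      case True
      \<comment> \<open>Erasing the coefficient at p shrinks the support, so the induction
        hypothesis covers ?B, and ?C restores the erased part.\<close>
      let ?S = "(op_tensor A)(p := 0)"
      let ?B = "tensor_op ?S"
      \<comment> \<open>The star on the second argument compensates the one in the rank one rule, so
        that ?E corresponds to the basis tensor e_u (x) e_v.\<close>
      let ?E = "rank_one n \<psi> (munit n u) (fd_star (munit n v))"
      let ?C = "\<lambda>x\<in>fd_alg n. fd_scale (op_tensor A p) (?E x)"
      have S: "?S \<in> tensor_space n"
        using op_tensor_space[of A] by (auto simp: tensor_space_def)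
      have B: "?B \<in> fd_end n" "op_tensor ?B = ?S"
        by (simp_all add: tensor_op_end op_tensor_tensor_op[OF S])
      have E: "?E \<in> fd_end n"
        by (intro rank_one_end) simp_all
      have C: "?C \<in> fd_end n"
        by (rule fd_add_scale_end(2)[OF E E])
      have FE: "F ?E = op_tensor ?E"
        by (simp add: F_rank op_tensor_rank_one)
      have E_eq: "op_tensor ?E q = (if q = p then 1 else 0)" for q
        using True
        by (cases u, cases v, cases q)
          (auto simp: p op_tensor_rank_one fd_star_star[of _ n] fd_tens_def mcoeff_def munit_index mem_mlabels split: if_splits)
      have C_eq: "op_tensor ?C = (\<lambda>q. op_tensor A p * op_tensor ?E q)"
        by (rule op_tensor_linear(2)[OF E E])
      have A_eq: "(\<lambda>x\<in>fd_alg n. fd_add (?B x) (?C x)) = A"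
      proof (rule op_tensor_inj[OF fd_add_scale_end(1)[OF B(1) C] insert.prems(1)])
        show "op_tensor (\<lambda>x\<in>fd_alg n. fd_add (?B x) (?C x)) = op_tensor A"
          unfolding op_tensor_linear(1)[OF B(1) C] B(2) C_eq E_eq by (rule ext) simp
      qed
      have FB: "F ?B = op_tensor ?B"
      proof (rule insert.IH[OF B(1)])
        fix q assume "q \<notin> U"
        then show "op_tensor ?B q = 0"
          unfolding B(2) using insert.prems(2)[of q] by simp
      qed
      have FC: "F ?C = op_tensor ?C"
        unfolding F_scale[OF E] C_eq FE ..
      have "F A = F (\<lambda>x\<in>fd_alg n. fd_add (?B x) (?C x))"
        by (simp only: A_eq)
      also have "\<dots> = (\<lambda>q. op_tensor ?B q + op_tensor ?C q)"
        unfolding F_add[OF B(1) C] FB FC ..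
      also have "\<dots> = op_tensor (\<lambda>x\<in>fd_alg n. fd_add (?B x) (?C x))"
        by (rule op_tensor_linear(1)[OF B(1) C, symmetric])
      also have "\<dots> = op_tensor A"
        by (simp only: A_eq)
      finally show ?thesis .
    qed
  qed
  from this[of "mlabels n \<times> mlabels n", OF _ A] show ?thesis
    using tensor_spaceD[OF op_tensor_space, of _ A] by auto
qed

lemma Psi_KMS_eq:
  assumes A: "A \<in> fd_end n"
  shows "Psi_KMS n \<psi> A = op_tensor A"
proof -
  have "Psi_KMS n \<psi> = (\<lambda>A\<in>fd_end n. op_tensor A)"
    unfolding Psi_KMS_def
  proof (rule the_equality, intro conjI ballI allI)
    show "(\<lambda>A\<in>fd_end n. op_tensor A) \<in> fd_end n \<rightarrow>\<^sub>E tensor_space n"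
      using op_tensor_space by auto
  next
    fix A B assume "A \<in> fd_end n" "B \<in> fd_end n"
    then show "(\<lambda>A\<in>fd_end n. op_tensor A) (\<lambda>x\<in>fd_alg n. fd_add (A x) (B x)) =
        (\<lambda>p. (\<lambda>A\<in>fd_end n. op_tensor A) A p + (\<lambda>A\<in>fd_end n. op_tensor A) B p)"
      by (simp add: fd_add_scale_end op_tensor_linear(1))
  next
    fix c A assume "A \<in> fd_end n"
    then show "(\<lambda>A\<in>fd_end n. op_tensor A) (\<lambda>x\<in>fd_alg n. fd_scale c (A x)) =
        (\<lambda>p. c * (\<lambda>A\<in>fd_end n. op_tensor A) A p)"
      by (simp add: fd_add_scale_end(2)[of A n A] op_tensor_linear(2)[of A A])
  next
    fix a b assume "a \<in> fd_alg n" "b \<in> fd_alg n"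
    then show "(\<lambda>A\<in>fd_end n. op_tensor A) (rank_one n \<psi> a b) = fd_tens n a (fd_star b)"
      by (simp add: rank_one_end op_tensor_rank_one)
  next
    fix F assume F: "F \<in> fd_end n \<rightarrow>\<^sub>E tensor_space n \<and>
      (\<forall>A\<in>fd_end n. \<forall>B\<in>fd_end n. F (\<lambda>x\<in>fd_alg n. fd_add (A x) (B x)) = (\<lambda>p. F A p + F B p)) \<and>
      (\<forall>c. \<forall>A\<in>fd_end n. F (\<lambda>x\<in>fd_alg n. fd_scale c (A x)) = (\<lambda>p. c * F A p)) \<and>
      (\<forall>a\<in>fd_alg n. \<forall>b\<in>fd_alg n. F (rank_one n \<psi> a b) = fd_tens n a (fd_star b))"
    then have *:
      "\<And>A B. A \<in> fd_end n \<Longrightarrow> B \<in> fd_end n \<Longrightarrow> F (\<lambda>x\<in>fd_alg n. fd_add (A x) (B x)) = (\<lambda>p. F A p + F B p)"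
      "\<And>c A. A \<in> fd_end n \<Longrightarrow> F (\<lambda>x\<in>fd_alg n. fd_scale c (A x)) = (\<lambda>p. c * F A p)"
      "\<And>a b. a \<in> fd_alg n \<Longrightarrow> b \<in> fd_alg n \<Longrightarrow> F (rank_one n \<psi> a b) = fd_tens n a (fd_star b)"
      by blast+
    have "F A = op_tensor A" if "A \<in> fd_end n" for A
      using op_tensor_unique[OF * that] .
    with F show "F = (\<lambda>A\<in>fd_end n. op_tensor A)"
      by (auto simp: fun_eq_iff PiE_def extensional_def)
  qed
  then show ?thesis using A by simp
qed

end

section \<open>Schur idempotents and complete positivity\<close>

text \<open>Moves the outer self-adjoint factors onto the vectors. The Kraus decomposition uses this
  with H, the positivity of the Choi input with K.\<close>

lemma sandwich_cscalar_prod: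
  fixes A X :: "complex mat"
  assumes A: "A \<in> carrier_mat d d" and adj: "mat_adjoint A = A" and X: "X \<in> carrier_mat d d"
    and v: "v \<in> carrier_vec d" and w: "w \<in> carrier_vec d"
  shows "((A * X * A) *\<^sub>v v) \<bullet>c w = (X *\<^sub>v (A *\<^sub>v v)) \<bullet>c (A *\<^sub>v w)"
proof -
  have Av: "A *\<^sub>v v \<in> carrier_vec d"
    using A v by simp
  have "(A * X * A) *\<^sub>v v = (A * X) *\<^sub>v (A *\<^sub>v v)"
    using A X v by (intro assoc_mult_mat_vec[of _ d d _ d]) auto
  also have "\<dots> = A *\<^sub>v (X *\<^sub>v (A *\<^sub>v v))"
    by (rule assoc_mult_mat_vec[OF A X Av])
  finally have eq: "(A * X * A) *\<^sub>v v = A *\<^sub>v (X *\<^sub>v (A *\<^sub>v v))" .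
  have XAv: "X *\<^sub>v (A *\<^sub>v v) \<in> carrier_vec d"
    using X Av by simp
  show ?thesis
    unfolding eq using adj mat_adjoint_eq_iff[OF A]
    by (intro hermitian_cscalar_prod[OF A _ XAv w]) blast
qed

section \<open>Schur products as products in the tensor product with the opposite algebra\<close>

context kms_form
begin

text \<open>Provides the coordinate formula for m^* in terms of the chosen density: its inverse
  matrix is K K.\<close>

lemma trace_functional_square: "trace_functional n \<psi> (\<lambda>\<alpha>. H \<alpha> * H \<alpha>) (\<lambda>\<alpha>. K \<alpha> * K \<alpha>)"
proof
  fix \<alpha>
  note assoc = assoc_mult_mat[of _ "n \<alpha>" "n \<alpha>" _ "n \<alpha>" _ "n \<alpha>"]
    and mult_closed = mult_carrier_mat[of _ "n \<alpha>" "n \<alpha>" _ "n \<alpha>"]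
  show "H \<alpha> * H \<alpha> \<in> carrier_mat (n \<alpha>) (n \<alpha>)" "K \<alpha> * K \<alpha> \<in> carrier_mat (n \<alpha>) (n \<alpha>)"
    using H K by (auto simp: mult_closed)
  show "H \<alpha> * H \<alpha> * (K \<alpha> * K \<alpha>) = 1\<^sub>m (n \<alpha>)" "K \<alpha> * K \<alpha> * (H \<alpha> * H \<alpha>) = 1\<^sub>m (n \<alpha>)"
    using H[of \<alpha>] K[of \<alpha>] by (simp_all add: assoc mult_closed cancel HK KH)
  fix i j assume ij: "i < n \<alpha>" "j < n \<alpha>"
  have "mat_adjoint (K \<alpha> * K \<alpha>) = K \<alpha> * K \<alpha>"
    by (simp add: mat_adjoint_mult[OF K K] K_adj)
  then show "(K \<alpha> * K \<alpha>) $$ (j, i) = cnj ((K \<alpha> * K \<alpha>) $$ (i, j))"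
    using ij mat_adjoint_eq_iff[OF mult_carrier_mat[OF K K]] by blast
qed (rule psi_eq)

lemma tensor_op_munit:
  assumes "i < n \<alpha>" "j < n \<alpha>" "c < n \<gamma>" "d < n \<gamma>"
  shows "tensor_op S (munit n (\<gamma>, c, d)) \<alpha> $$ (i, j) = (H \<gamma> * slice S (\<alpha>, i, j) \<gamma> * H \<gamma>) $$ (d, c)"
proof -
  have "tensor_op S (munit n (\<gamma>, c, d)) \<alpha> $$ (i, j) =
      (\<Sum>\<beta>\<in>UNIV. if \<beta> = \<gamma> then (H \<gamma> * slice S (\<alpha>, i, j) \<gamma> * H \<gamma>) $$ (d, c) else 0)"
  proof (unfold tensor_op_index[OF fd_alg_closed(5) assms(1,2)], rule sum.cong[OF refl])
    fix \<beta>
    let ?M = "slice S (\<alpha>, i, j) \<beta>" and ?e = "munit n (\<gamma>, c, d) \<beta>"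
    note assoc = assoc_mult_mat[of _ "n \<beta>" "n \<beta>" _ "n \<beta>" _ "n \<beta>"]
      and mult_closed = mult_carrier_mat[of _ "n \<beta>" "n \<beta>" _ "n \<beta>"]
    have e: "?e \<in> carrier_mat (n \<beta>) (n \<beta>)"
      by (rule fd_algD) simp
    have "mat_trace (?M * sandwich H (munit n (\<gamma>, c, d)) \<beta>) = mat_trace ((?M * H \<beta> * ?e) * H \<beta>)"
      using H[of \<beta>] e by (simp add: sandwich_def assoc mult_closed)
    also have "\<dots> = mat_trace (H \<beta> * (?M * H \<beta> * ?e))"
      using H[of \<beta>] e by (intro mat_trace_comm[of _ "n \<beta>" "n \<beta>"]) (auto simp: mult_closed)
    also have "\<dots> = mat_trace ((H \<beta> * ?M * H \<beta>) * ?e)"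
      using H[of \<beta>] e by (simp add: assoc mult_closed)
    also have "\<dots> = (\<Sum>p<n \<beta>. \<Sum>q<n \<beta>. (H \<beta> * ?M * H \<beta>) $$ (p, q) * ?e $$ (q, p))"
      using H[of \<beta>] e by (intro mat_trace_mult) (auto simp: mult_closed)
    also have "\<dots> = (\<Sum>p<n \<beta>. \<Sum>q<n \<beta>. if q = c then if p = d then if \<beta> = \<gamma> then (H \<gamma> * slice S (\<alpha>, i, j) \<gamma> * H \<gamma>) $$ (d, c) else 0 else 0 else 0)"
      by (intro sum.cong refl) (auto simp: munit_index simp del: index_mult_mat(1))
    also have "\<dots> = (if \<beta> = \<gamma> then (H \<gamma> * slice S (\<alpha>, i, j) \<gamma> * H \<gamma>) $$ (d, c) else 0)"
      using assms by (cases "\<beta> = \<gamma>") auto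
    finally show "mat_trace (?M * sandwich H (munit n (\<gamma>, c, d)) \<beta>) = (if \<beta> = \<gamma> then (H \<gamma> * slice S (\<alpha>, i, j) \<gamma> * H \<gamma>) $$ (d, c) else 0)" .
  qed
  then show ?thesis by simp
qed

lemma mat_trace_mult4:
  assumes "A \<in> carrier_mat d d" "B \<in> carrier_mat d d" "C \<in> carrier_mat d d" "E \<in> carrier_mat d d"
  shows "mat_trace (A * B * C * E) = (\<Sum>c<d. \<Sum>r<d. \<Sum>q<d. \<Sum>p<d. A $$ (c, r) * B $$ (r, q) * C $$ (q, p) * E $$ (p, c))"
proof -
  have "mat_trace (A * B * C * E) = mat_trace (A * (B * (C * E)))"
    using assms by (simp add: assoc_mult_mat[of _ d d _ d _ d] mult_carrier_mat[of _ d d _ d])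
  also have "\<dots> = (\<Sum>c<d. \<Sum>r<d. A $$ (c, r) * (\<Sum>q<d. B $$ (r, q) * (\<Sum>p<d. C $$ (q, p) * E $$ (p, c))))"
    using assms
    by (simp add: mat_trace_mult[of _ d d] mat_mult_index[of _ d d _ d] mult_carrier_mat[of _ d d _ d]
        del: index_mult_mat(1))
  finally show ?thesis
    by (simp add: sum_distrib_left mult.assoc)
qed

text \<open>Fix the entry (i, j) and the index p contracted by m, and let M and N be the slices of S
  at (i, p) and (p, j). The formula for m^* gives the sum over blocks of Tr(x (H N H) K^2 (H M H)).
  The inner factors collapse to N M, the order of multiplication in the opposite algebra, and the
  sum over p is the product in the first leg.\<close>

lemma mult_tensor_map_mult_adj:
  assumes x: "x \<in> fd_alg n"
  shows "mult_map n (tensor_map n (tensor_op S) (tensor_op S) (mult_adj n \<psi> x)) = tensor_op (op_mult n S S) x"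
proof (rule fd_alg_eqI[OF fd_alg_closed(7) tensor_op_in_alg[OF x]])
  fix \<alpha> i j assume ij: "i < n \<alpha>" "j < n \<alpha>"
  interpret trace_functional n \<psi> "\<lambda>\<alpha>. H \<alpha> * H \<alpha>" "\<lambda>\<alpha>. K \<alpha> * K \<alpha>"
    by (rule trace_functional_square)
  let ?R = "\<lambda>\<alpha>. K \<alpha> * K \<alpha>" and ?W = "mult_adj n \<psi> x"
  let ?M = "\<lambda>p \<gamma>. slice S (\<alpha>, i, p) \<gamma>" and ?N = "\<lambda>p \<gamma>. slice S (\<alpha>, p, j) \<gamma>"
  let ?A = "\<lambda>p \<gamma>. H \<gamma> * ?M p \<gamma> * H \<gamma>" and ?B = "\<lambda>p \<gamma>. H \<gamma> * ?N p \<gamma> * H \<gamma>"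
  have W: "?W ((\<gamma>, c, d), (\<delta>, q, r)) = (if \<delta> = \<gamma> then x \<gamma> $$ (c, r) * ?R \<gamma> $$ (q, d) else 0)"
    if "c < n \<gamma>" "d < n \<gamma>" "q < n \<delta>" "r < n \<delta>" for \<gamma> \<delta> c d q r
    using that by (auto simp: mult_adj_eq[OF x] simp del: index_mult_mat(1))
  have inner: "(\<Sum>(u, v)\<in>mlabels n \<times> mlabels n. ?W (u, v) * fd_tens n (tensor_op S (munit n u)) (tensor_op S (munit n v)) ((\<alpha>, i, p), (\<alpha>, p, j))) =
      (\<Sum>\<gamma>\<in>UNIV. mat_trace (x \<gamma> * ?B p \<gamma> * ?R \<gamma> * ?A p \<gamma>))" if p: "p < n \<alpha>" for p
  proof -
    have "(\<Sum>(u, v)\<in>mlabels n \<times> mlabels n. ?W (u, v) * fd_tens n (tensor_op S (munit n u)) (tensor_op S (munit n v)) ((\<alpha>, i, p), (\<alpha>, p, j))) =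
        (\<Sum>u\<in>mlabels n. \<Sum>v\<in>mlabels n. ?W (u, v) * (tensor_op S (munit n u) \<alpha> $$ (i, p) * tensor_op S (munit n v) \<alpha> $$ (p, j)))"
      using ij p by (simp add: sum.cartesian_product' fd_tens_def mem_mlabels mcoeff_def)
    also have "\<dots> = (\<Sum>\<gamma>\<in>UNIV. \<Sum>c<n \<gamma>. \<Sum>d<n \<gamma>. \<Sum>\<delta>\<in>UNIV. \<Sum>q<n \<delta>. \<Sum>r<n \<delta>.
        (if \<delta> = \<gamma> then x \<gamma> $$ (c, r) * ?R \<gamma> $$ (q, d) * (?A p \<gamma> $$ (d, c) * ?B p \<gamma> $$ (r, q)) else 0))"
      unfolding sum_mlabels2
      by (intro sum.cong refl) (use ij p in \<open>simp add: W tensor_op_munit del: index_mult_mat(1)\<close>)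
    also have "\<dots> = (\<Sum>\<gamma>\<in>UNIV. \<Sum>c<n \<gamma>. \<Sum>d<n \<gamma>. \<Sum>q<n \<gamma>. \<Sum>r<n \<gamma>.
        x \<gamma> $$ (c, r) * ?R \<gamma> $$ (q, d) * (?A p \<gamma> $$ (d, c) * ?B p \<gamma> $$ (r, q)))"
    proof (intro sum.cong refl)
      fix \<gamma> c d
      let ?g = "\<lambda>q r. x \<gamma> $$ (c, r) * ?R \<gamma> $$ (q, d) * (?A p \<gamma> $$ (d, c) * ?B p \<gamma> $$ (r, q))"
      have "(\<Sum>q<n \<delta>. \<Sum>r<n \<delta>. if \<delta> = \<gamma> then ?g q r else 0) = (if \<delta> = \<gamma> then \<Sum>q<n \<gamma>. \<Sum>r<n \<gamma>. ?g q r else 0)" for \<delta>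
        by (cases "\<delta> = \<gamma>") (simp_all only: simp_thms if_True if_False sum.neutral_const)
      then show "(\<Sum>\<delta>\<in>UNIV. \<Sum>q<n \<delta>. \<Sum>r<n \<delta>. if \<delta> = \<gamma> then ?g q r else 0) = (\<Sum>q<n \<gamma>. \<Sum>r<n \<gamma>. ?g q r)"
        by (simp del: index_mult_mat(1))
    qed
    also have "\<dots> = (\<Sum>\<gamma>\<in>UNIV. mat_trace (x \<gamma> * ?B p \<gamma> * ?R \<gamma> * ?A p \<gamma>))"
    proof (rule sum.cong[OF refl])
      fix \<gamma>
      let ?h = "\<lambda>c d q r. x \<gamma> $$ (c, r) * ?R \<gamma> $$ (q, d) * (?A p \<gamma> $$ (d, c) * ?B p \<gamma> $$ (r, q))"
      let ?I = "{..<n \<gamma>}"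
      have carr: "?B p \<gamma> \<in> carrier_mat (n \<gamma>) (n \<gamma>)" "?R \<gamma> \<in> carrier_mat (n \<gamma>) (n \<gamma>)" "?A p \<gamma> \<in> carrier_mat (n \<gamma>) (n \<gamma>)"
        using H[of \<gamma>] K[of \<gamma>] by (simp_all add: mult_carrier_mat[of _ "n \<gamma>" "n \<gamma>" _ "n \<gamma>"])
      have "(\<Sum>c\<in>?I. \<Sum>d\<in>?I. \<Sum>q\<in>?I. \<Sum>r\<in>?I. ?h c d q r) = (\<Sum>c\<in>?I. \<Sum>d\<in>?I. \<Sum>r\<in>?I. \<Sum>q\<in>?I. ?h c d q r)"
        by (rule sum.cong[OF refl], rule sum.cong[OF refl], rule sum.swap)
      also have "\<dots> = (\<Sum>c\<in>?I. \<Sum>r\<in>?I. \<Sum>d\<in>?I. \<Sum>q\<in>?I. ?h c d q r)"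
        by (rule sum.cong[OF refl], rule sum.swap)
      also have "\<dots> = (\<Sum>c\<in>?I. \<Sum>r\<in>?I. \<Sum>q\<in>?I. \<Sum>d\<in>?I. ?h c d q r)"
        by (rule sum.cong[OF refl], rule sum.cong[OF refl], rule sum.swap)
      also have "\<dots> = mat_trace (x \<gamma> * ?B p \<gamma> * ?R \<gamma> * ?A p \<gamma>)"
        unfolding mat_trace_mult4[OF fd_algD[OF x] carr]
        by (intro sum.cong refl) (simp only: mult_ac)
      finally show "(\<Sum>c\<in>?I. \<Sum>d\<in>?I. \<Sum>q\<in>?I. \<Sum>r\<in>?I. ?h c d q r) = mat_trace (x \<gamma> * ?B p \<gamma> * ?R \<gamma> * ?A p \<gamma>)" .
    qed
    finally show ?thesis .
  qed
  have tr: "mat_trace (x \<gamma> * ?B p \<gamma> * ?R \<gamma> * ?A p \<gamma>) = (\<Sum>k<n \<gamma>. \<Sum>l<n \<gamma>.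
      (\<Sum>q<n \<gamma>. S ((\<alpha>, i, p), (\<gamma>, q, l)) * S ((\<alpha>, p, j), (\<gamma>, k, q))) * sandwich H x \<gamma> $$ (l, k))" for p \<gamma>
  proof -
    note assoc = assoc_mult_mat[of _ "n \<gamma>" "n \<gamma>" _ "n \<gamma>" _ "n \<gamma>"]
      and mult_closed = mult_carrier_mat[of _ "n \<gamma>" "n \<gamma>" _ "n \<gamma>"]
    note carr = H[of \<gamma>] K[of \<gamma>] fd_algD[OF x, of \<gamma>]
    \<comment> \<open>The factor K K from m^* meets one H from each of the two applications of T_S
      and disappears. The two outer factors H come to surround x by cyclicity.\<close>
    have "x \<gamma> * ?B p \<gamma> * ?R \<gamma> * ?A p \<gamma> = (x \<gamma> * H \<gamma> * ?N p \<gamma> * ?M p \<gamma>) * H \<gamma>"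
      using carr by (simp add: assoc mult_closed cancel)
    then have "mat_trace (x \<gamma> * ?B p \<gamma> * ?R \<gamma> * ?A p \<gamma>) = mat_trace (H \<gamma> * (x \<gamma> * H \<gamma> * ?N p \<gamma> * ?M p \<gamma>))"
      using carr by (simp only:) (intro mat_trace_comm[of _ "n \<gamma>" "n \<gamma>"], auto simp: mult_closed)
    also have "H \<gamma> * (x \<gamma> * H \<gamma> * ?N p \<gamma> * ?M p \<gamma>) = sandwich H x \<gamma> * (?N p \<gamma> * ?M p \<gamma>)"
      using carr by (simp add: sandwich_def assoc mult_closed)
    also have "mat_trace \<dots> = mat_trace ((?N p \<gamma> * ?M p \<gamma>) * sandwich H x \<gamma>)"
      using fd_algD[OF sandwich_H[OF x], of \<gamma>] by (intro mat_trace_comm[of _ "n \<gamma>" "n \<gamma>"]) (auto simp: mult_closed)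
    also have "\<dots> = (\<Sum>k<n \<gamma>. \<Sum>l<n \<gamma>. (?N p \<gamma> * ?M p \<gamma>) $$ (k, l) * sandwich H x \<gamma> $$ (l, k))"
      using fd_algD[OF sandwich_H[OF x], of \<gamma>] by (intro mat_trace_mult) (auto simp: mult_closed)
    also have "\<dots> = (\<Sum>k<n \<gamma>. \<Sum>l<n \<gamma>. (\<Sum>q<n \<gamma>. S ((\<alpha>, i, p), (\<gamma>, q, l)) * S ((\<alpha>, p, j), (\<gamma>, k, q))) * sandwich H x \<gamma> $$ (l, k))"
      by (intro sum.cong refl)
        (simp add: mat_mult_index[of _ "n \<gamma>" "n \<gamma>" _ "n \<gamma>"] slice_def mult.commute del: index_mult_mat(1))
    finally show ?thesis .
  qed
  have "mult_map n (tensor_map n (tensor_op S) (tensor_op S) ?W) \<alpha> $$ (i, j) =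
      (\<Sum>p<n \<alpha>. \<Sum>\<gamma>\<in>UNIV. mat_trace (x \<gamma> * ?B p \<gamma> * ?R \<gamma> * ?A p \<gamma>))"
    using ij by (simp add: mult_map_def tensor_map_def inner)
  also have "\<dots> = (\<Sum>\<gamma>\<in>UNIV. \<Sum>p<n \<alpha>. \<Sum>k<n \<gamma>. \<Sum>l<n \<gamma>.
      (\<Sum>q<n \<gamma>. S ((\<alpha>, i, p), (\<gamma>, q, l)) * S ((\<alpha>, p, j), (\<gamma>, k, q))) * sandwich H x \<gamma> $$ (l, k))"
    unfolding tr by (rule sum.swap)
  also have "\<dots> = (\<Sum>\<gamma>\<in>UNIV. \<Sum>k<n \<gamma>. \<Sum>l<n \<gamma>. \<Sum>p<n \<alpha>.
      (\<Sum>q<n \<gamma>. S ((\<alpha>, i, p), (\<gamma>, q, l)) * S ((\<alpha>, p, j), (\<gamma>, k, q))) * sandwich H x \<gamma> $$ (l, k))"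
    (is "(\<Sum>\<gamma>\<in>UNIV. \<Sum>p<n \<alpha>. \<Sum>k<n \<gamma>. \<Sum>l<n \<gamma>. ?f \<gamma> p k l) = _")
  proof (rule sum.cong[OF refl])
    fix \<gamma>
    have "(\<Sum>p<n \<alpha>. \<Sum>k<n \<gamma>. \<Sum>l<n \<gamma>. ?f \<gamma> p k l) = (\<Sum>k<n \<gamma>. \<Sum>p<n \<alpha>. \<Sum>l<n \<gamma>. ?f \<gamma> p k l)"
      by (rule sum.swap)
    also have "\<dots> = (\<Sum>k<n \<gamma>. \<Sum>l<n \<gamma>. \<Sum>p<n \<alpha>. ?f \<gamma> p k l)"
      by (rule sum.cong[OF refl], rule sum.swap)
    finally show "(\<Sum>p<n \<alpha>. \<Sum>k<n \<gamma>. \<Sum>l<n \<gamma>. ?f \<gamma> p k l) = (\<Sum>k<n \<gamma>. \<Sum>l<n \<gamma>. \<Sum>p<n \<alpha>. ?f \<gamma> p k l)" .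
  qed
  also have "\<dots> = tensor_op (op_mult n S S) x \<alpha> $$ (i, j)"
    unfolding tensor_op_index'[OF x ij] by (simp add: op_mult_def sum_distrib_right)
  finally show "mult_map n (tensor_map n (tensor_op S) (tensor_op S) ?W) \<alpha> $$ (i, j) = tensor_op (op_mult n S S) x \<alpha> $$ (i, j)" .
qed

end

lemma op_mult_space:
  assumes S: "S \<in> tensor_space n" and T: "T \<in> tensor_space n"
  shows "op_mult n S T \<in> tensor_space n"
  unfolding tensor_space_def
proof (intro CollectI allI impI)
  fix p assume np: "p \<notin> mlabels n \<times> mlabels n"
  obtain \<alpha> i j \<beta> k l where p: "p = ((\<alpha>, i, j), (\<beta>, k, l))"
    by (cases p) auto
  have "S ((\<alpha>, i, a), (\<beta>, b, l)) * T ((\<alpha>, a, j), (\<beta>, k, b)) = 0" for a b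
    using np tensor_spaceD[OF S, of "((\<alpha>, i, a), (\<beta>, b, l))"] tensor_spaceD[OF T, of "((\<alpha>, a, j), (\<beta>, k, b))"]
    by (auto simp: p mem_mlabels)
  then show "op_mult n S T p = 0"
    by (simp add: p op_mult_def)
qed

section \<open>Projections and completely positive maps\<close>

context kms_form
begin

lemma quantum_adjacency_tensor_op:
  assumes S: "S \<in> tensor_space n"
  shows "quantum_adjacency n \<psi> (tensor_op S) \<longleftrightarrow> completely_positive n (tensor_op S) \<and> op_mult n S S = S"
proof -
  have "(\<forall>x\<in>fd_alg n. mult_map n (tensor_map n (tensor_op S) (tensor_op S) (mult_adj n \<psi> x)) = tensor_op S x)
      \<longleftrightarrow> (\<forall>x\<in>fd_alg n. tensor_op (op_mult n S S) x = tensor_op S x)"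
    by (simp add: mult_tensor_map_mult_adj)
  also have "\<dots> \<longleftrightarrow> tensor_op (op_mult n S S) = tensor_op S"
  proof
    assume eq: "\<forall>x\<in>fd_alg n. tensor_op (op_mult n S S) x = tensor_op S x"
    show "tensor_op (op_mult n S S) = tensor_op S"
    proof
      fix x show "tensor_op (op_mult n S S) x = tensor_op S x"
        using eq by (cases "x \<in> fd_alg n") (auto simp: tensor_op_def)
    qed
  qed simp
  also have "\<dots> \<longleftrightarrow> op_mult n S S = S"
    using op_tensor_tensor_op[OF op_mult_space[OF S S]] op_tensor_tensor_op[OF S] by metis
  finally show ?thesis
    by (simp add: quantum_adjacency_def)
qed

text \<open>Every triple of a block \<gamma> and indices p, q contributes one Kraus operator, which
  sends v to H applied to the vector built from S and v. Two vectors v and w are kept apart because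
  matrix amplifications produce the off-diagonal pairings as well.\<close>

lemma projection_form_factor:
  assumes idem: "op_mult n S S = S" and sa: "op_star S = S"
    and X: "X \<in> fd_alg n" and v: "v \<in> carrier_vec (n \<alpha>)" and w: "w \<in> carrier_vec (n \<alpha>)"
  shows "(tensor_op S X \<alpha> *\<^sub>v v) \<bullet>c w = (\<Sum>\<gamma>\<in>UNIV. \<Sum>p<n \<alpha>. \<Sum>q<n \<gamma>.
    (X \<gamma> *\<^sub>v (H \<gamma> *\<^sub>v Matrix.vec (n \<gamma>) (\<lambda>k. \<Sum>j<n \<alpha>. S ((\<alpha>, p, j), (\<gamma>, k, q)) * v $ j))) \<bullet>c
    (H \<gamma> *\<^sub>v Matrix.vec (n \<gamma>) (\<lambda>k. \<Sum>j<n \<alpha>. S ((\<alpha>, p, j), (\<gamma>, k, q)) * w $ j)))"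
proof -
  have S_star: "S ((\<alpha>, i, p), (\<gamma>, q, l)) = cnj (S ((\<alpha>, p, i), (\<gamma>, l, q)))" for i p \<gamma> q l
    using fun_cong[OF sa, of "((\<alpha>, i, p), (\<gamma>, q, l))"] by (simp add: op_star_def)
  \<comment> \<open>Idempotence expands S as a product, and self-adjointness turns its left factor
    into the conjugate of a coefficient of the same shape as the right one.\<close>
  have S_fact: "S ((\<alpha>, i, j), (\<gamma>, k, l)) =
      (\<Sum>p<n \<alpha>. \<Sum>q<n \<gamma>. cnj (S ((\<alpha>, p, i), (\<gamma>, l, q))) * S ((\<alpha>, p, j), (\<gamma>, k, q)))" for i j \<gamma> k l
    using fun_cong[OF idem, of "((\<alpha>, i, j), (\<gamma>, k, l))"]
    unfolding op_mult_def by (simp only: prod.case S_star[of i _ \<gamma> _ l]) 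
  let ?Y = "sandwich H X"
  let ?t = "\<lambda>\<gamma> i j k l p q. cnj (S ((\<alpha>, p, i), (\<gamma>, l, q))) * S ((\<alpha>, p, j), (\<gamma>, k, q)) *
    ?Y \<gamma> $$ (l, k) * v $ j * cnj (w $ i)"
  have "(tensor_op S X \<alpha> *\<^sub>v v) \<bullet>c w = (\<Sum>i<n \<alpha>. \<Sum>j<n \<alpha>. tensor_op S X \<alpha> $$ (i, j) * v $ j * cnj (w $ i))"
    by (rule mult_mat_vec_cscalar_prod[OF fd_algD[OF tensor_op_in_alg[OF X]] v w])
  also have "\<dots> = (\<Sum>i<n \<alpha>. \<Sum>j<n \<alpha>. \<Sum>\<gamma>\<in>UNIV. \<Sum>k<n \<gamma>. \<Sum>l<n \<gamma>. \<Sum>p<n \<alpha>. \<Sum>q<n \<gamma>. ?t \<gamma> i j k l p q)"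
  proof (rule sum.cong[OF refl], rule sum.cong[OF refl])
    fix i j assume "i \<in> {..<n \<alpha>}" "j \<in> {..<n \<alpha>}"
    then have ij: "i < n \<alpha>" "j < n \<alpha>" by auto
    show "tensor_op S X \<alpha> $$ (i, j) * v $ j * cnj (w $ i) =
        (\<Sum>\<gamma>\<in>UNIV. \<Sum>k<n \<gamma>. \<Sum>l<n \<gamma>. \<Sum>p<n \<alpha>. \<Sum>q<n \<gamma>. ?t \<gamma> i j k l p q)"
      unfolding tensor_op_index'[OF X ij] S_fact[of i j] sum_distrib_right ..
  qed
  also have "\<dots> = (\<Sum>\<gamma>\<in>UNIV. \<Sum>i<n \<alpha>. \<Sum>j<n \<alpha>. \<Sum>k<n \<gamma>. \<Sum>l<n \<gamma>. \<Sum>p<n \<alpha>. \<Sum>q<n \<gamma>. ?t \<gamma> i j k l p q)"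
    (is "(\<Sum>i<n \<alpha>. \<Sum>j<n \<alpha>. \<Sum>\<gamma>\<in>UNIV. ?g \<gamma> i j) = _")
  proof -
    have "(\<Sum>i<n \<alpha>. \<Sum>j<n \<alpha>. \<Sum>\<gamma>\<in>UNIV. ?g \<gamma> i j) = (\<Sum>i<n \<alpha>. \<Sum>\<gamma>\<in>UNIV. \<Sum>j<n \<alpha>. ?g \<gamma> i j)"
      by (rule sum.cong[OF refl], rule sum.swap)
    also have "\<dots> = (\<Sum>\<gamma>\<in>UNIV. \<Sum>i<n \<alpha>. \<Sum>j<n \<alpha>. ?g \<gamma> i j)"
      by (rule sum.swap)
    finally show ?thesis .
  qed
  also have "\<dots> = (\<Sum>\<gamma>\<in>UNIV. \<Sum>p<n \<alpha>. \<Sum>q<n \<gamma>.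
    (X \<gamma> *\<^sub>v (H \<gamma> *\<^sub>v Matrix.vec (n \<gamma>) (\<lambda>k. \<Sum>j<n \<alpha>. S ((\<alpha>, p, j), (\<gamma>, k, q)) * v $ j))) \<bullet>c
    (H \<gamma> *\<^sub>v Matrix.vec (n \<gamma>) (\<lambda>k. \<Sum>j<n \<alpha>. S ((\<alpha>, p, j), (\<gamma>, k, q)) * w $ j)))"
  proof (rule sum.cong[OF refl])
    fix \<gamma>
    let ?v = "\<lambda>p q. Matrix.vec (n \<gamma>) (\<lambda>k. \<Sum>j<n \<alpha>. S ((\<alpha>, p, j), (\<gamma>, k, q)) * v $ j)"
    let ?w = "\<lambda>p q. Matrix.vec (n \<gamma>) (\<lambda>k. \<Sum>j<n \<alpha>. S ((\<alpha>, p, j), (\<gamma>, k, q)) * w $ j)"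
    let ?I = "{..<n \<alpha>}" and ?J = "{..<n \<gamma>}"
    have "(\<Sum>i\<in>?I. \<Sum>j\<in>?I. \<Sum>k\<in>?J. \<Sum>l\<in>?J. \<Sum>p\<in>?I. \<Sum>q\<in>?J. ?t \<gamma> i j k l p q) =
        (\<Sum>i\<in>?I. \<Sum>j\<in>?I. \<Sum>p\<in>?I. \<Sum>q\<in>?J. \<Sum>k\<in>?J. \<Sum>l\<in>?J. ?t \<gamma> i j k l p q)"
      by (rule sum.cong[OF refl], rule sum.cong[OF refl], rule sum_swap_pairs)
    also have "\<dots> = (\<Sum>p\<in>?I. \<Sum>q\<in>?J. \<Sum>i\<in>?I. \<Sum>j\<in>?I. \<Sum>k\<in>?J. \<Sum>l\<in>?J. ?t \<gamma> i j k l p q)"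
      by (rule sum_swap_pairs)
    also have "\<dots> = (\<Sum>p\<in>?I. \<Sum>q\<in>?J. (X \<gamma> *\<^sub>v (H \<gamma> *\<^sub>v ?v p q)) \<bullet>c (H \<gamma> *\<^sub>v ?w p q))"
    proof (rule sum.cong[OF refl], rule sum.cong[OF refl])
      fix p q
      have "(\<Sum>i\<in>?I. \<Sum>j\<in>?I. \<Sum>k\<in>?J. \<Sum>l\<in>?J. ?t \<gamma> i j k l p q) = (\<Sum>k\<in>?J. \<Sum>l\<in>?J. \<Sum>i\<in>?I. \<Sum>j\<in>?I. ?t \<gamma> i j k l p q)"
        by (rule sum_swap_pairs)
      also have "\<dots> = (\<Sum>k\<in>?J. \<Sum>l\<in>?J. \<Sum>j\<in>?I. \<Sum>i\<in>?I. ?t \<gamma> i j k l p q)"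
        by (rule sum.cong[OF refl], rule sum.cong[OF refl], rule sum.swap)
      also have "\<dots> = (\<Sum>l\<in>?J. \<Sum>k\<in>?J. \<Sum>j\<in>?I. \<Sum>i\<in>?I. ?t \<gamma> i j k l p q)"
        by (rule sum.swap)
      also have "\<dots> = (\<Sum>l\<in>?J. \<Sum>k\<in>?J. ?Y \<gamma> $$ (l, k) * ?v p q $ k * cnj (?w p q $ l))"
        by (intro sum.cong refl) (simp add: sum_distrib_left sum_distrib_right mult_ac)
      also have "\<dots> = (?Y \<gamma> *\<^sub>v ?v p q) \<bullet>c ?w p q"
        by (rule mult_mat_vec_cscalar_prod[OF fd_algD[OF sandwich_H[OF X]], symmetric]) simp_all
      also have "\<dots> = (X \<gamma> *\<^sub>v (H \<gamma> *\<^sub>v ?v p q)) \<bullet>c (H \<gamma> *\<^sub>v ?w p q)"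
        unfolding sandwich_def by (rule sandwich_cscalar_prod[OF H H_adj fd_algD[OF X]]) simp_all
      finally show "(\<Sum>i\<in>?I. \<Sum>j\<in>?I. \<Sum>k\<in>?J. \<Sum>l\<in>?J. ?t \<gamma> i j k l p q) = (X \<gamma> *\<^sub>v (H \<gamma> *\<^sub>v ?v p q)) \<bullet>c (H \<gamma> *\<^sub>v ?w p q)" .
    qed
    finally show "(\<Sum>i\<in>?I. \<Sum>j\<in>?I. \<Sum>k\<in>?J. \<Sum>l\<in>?J. \<Sum>p\<in>?I. \<Sum>q\<in>?J. ?t \<gamma> i j k l p q) =
        (\<Sum>p\<in>?I. \<Sum>q\<in>?J. (X \<gamma> *\<^sub>v (H \<gamma> *\<^sub>v ?v p q)) \<bullet>c (H \<gamma> *\<^sub>v ?w p q))" .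
  qed
  finally show ?thesis .
qed

text \<open>The Kraus operators do not depend on the position (a, b) in the matrix X. For a fixed
  Kraus operator the double sum over a and b is therefore the positivity of X itself, tested on the
  images of the vectors v a.\<close>

lemma completely_positive_tensor_op:
  assumes idem: "op_mult n S S = S" and sa: "op_star S = S"
  shows "completely_positive n (tensor_op S)"
  unfolding completely_positive_def
proof (intro conjI allI impI tensor_op_end)
  fix d X assume X: "(\<forall>a<d. \<forall>b<d. X a b \<in> fd_alg n) \<and> matrix_positive n d X"
  show "matrix_positive n d (\<lambda>a b. tensor_op S (X a b))"
    unfolding matrix_positive_def
  proof (intro allI impI)
    fix \<alpha> and v :: "nat \<Rightarrow> complex Matrix.vec"
    assume v: "\<forall>a<d. v a \<in> carrier_vec (n \<alpha>)"
    let ?w = "\<lambda>\<gamma> p q a. H \<gamma> *\<^sub>v Matrix.vec (n \<gamma>) (\<lambda>k. \<Sum>j<n \<alpha>. S ((\<alpha>, p, j), (\<gamma>, k, q)) * v a $ j)"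
    have "(\<Sum>a<d. \<Sum>b<d. (tensor_op S (X a b) \<alpha> *\<^sub>v v b) \<bullet>c v a) =
        (\<Sum>a<d. \<Sum>b<d. \<Sum>\<gamma>\<in>UNIV. \<Sum>p<n \<alpha>. \<Sum>q<n \<gamma>. (X a b \<gamma> *\<^sub>v ?w \<gamma> p q b) \<bullet>c ?w \<gamma> p q a)"
      using X v by (intro sum.cong refl projection_form_factor[OF idem sa]) auto
    also have "\<dots> = (\<Sum>\<gamma>\<in>UNIV. \<Sum>a<d. \<Sum>b<d. \<Sum>p<n \<alpha>. \<Sum>q<n \<gamma>. (X a b \<gamma> *\<^sub>v ?w \<gamma> p q b) \<bullet>c ?w \<gamma> p q a)"
      (is "(\<Sum>a<d. \<Sum>b<d. \<Sum>\<gamma>\<in>UNIV. ?g \<gamma> a b) = _")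
    proof -
      have "(\<Sum>a<d. \<Sum>b<d. \<Sum>\<gamma>\<in>UNIV. ?g \<gamma> a b) = (\<Sum>a<d. \<Sum>\<gamma>\<in>UNIV. \<Sum>b<d. ?g \<gamma> a b)"
        by (rule sum.cong[OF refl], rule sum.swap)
      also have "\<dots> = (\<Sum>\<gamma>\<in>UNIV. \<Sum>a<d. \<Sum>b<d. ?g \<gamma> a b)"
        by (rule sum.swap)
      finally show ?thesis .
    qed
    also have "\<dots> = (\<Sum>\<gamma>\<in>UNIV. \<Sum>p<n \<alpha>. \<Sum>q<n \<gamma>. \<Sum>a<d. \<Sum>b<d. (X a b \<gamma> *\<^sub>v ?w \<gamma> p q b) \<bullet>c ?w \<gamma> p q a)"
      by (rule sum.cong[OF refl], rule sum_swap_pairs)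
    also have "0 \<le> \<dots>"
    proof (rule sum_nonneg, rule sum_nonneg, rule sum_nonneg)
      fix \<gamma> p q
      have carr: "?w \<gamma> p q a \<in> carrier_vec (n \<gamma>)" for a
        using H[of \<gamma>] by (intro mult_mat_vec_carrier) auto
      have pos: "0 \<le> (\<Sum>a<d. \<Sum>b<d. (X a b \<gamma> *\<^sub>v w b) \<bullet>c w a)"
        if "\<And>a. w a \<in> carrier_vec (n \<gamma>)" for w
        using X that unfolding matrix_positive_def by blast
      show "0 \<le> (\<Sum>a<d. \<Sum>b<d. (X a b \<gamma> *\<^sub>v ?w \<gamma> p q b) \<bullet>c ?w \<gamma> p q a)"
        by (rule pos[of "?w \<gamma> p q"]) (rule carr)
    qed
    finally show "0 \<le> (\<Sum>a<d. \<Sum>b<d. (tensor_op S (X a b) \<alpha> *\<^sub>v v b) \<bullet>c v a)" .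
  qed
qed

text \<open>The positive matrix that tests for a Choi matrix, twisted by K so that T_S returns the
  coefficients of S. On block \<beta> its form is the squared modulus of the sum of the a-th entries
  of K v_a, and on other blocks it vanishes.\<close>

lemma matrix_positive_munit:
  "matrix_positive n (n \<beta>) (\<lambda>a b. sandwich K (munit n (\<beta>, a, b)))"
  unfolding matrix_positive_def
proof (intro allI impI)
  fix \<alpha> and v :: "nat \<Rightarrow> complex Matrix.vec"
    assume v: "\<forall>a<n \<beta>. v a \<in> carrier_vec (n \<alpha>)"
  let ?u = "\<lambda>a. K \<alpha> *\<^sub>v v a"
  have "(sandwich K (munit n (\<beta>, a, b)) \<alpha> *\<^sub>v v b) \<bullet>c v a = (if \<alpha> = \<beta> then ?u b $ b * cnj (?u a $ a) else 0)"
    if ab: "a < n \<beta>" "b < n \<beta>" for a b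
  proof -
    have u: "?u c \<in> carrier_vec (n \<alpha>)" if "c < n \<beta>" for c
      using K[of \<alpha>] v that by (intro mult_mat_vec_carrier) auto
    have "(sandwich K (munit n (\<beta>, a, b)) \<alpha> *\<^sub>v v b) \<bullet>c v a = (munit n (\<beta>, a, b) \<alpha> *\<^sub>v ?u b) \<bullet>c ?u a"
      unfolding sandwich_def using v ab
      by (intro sandwich_cscalar_prod[OF K K_adj fd_algD]) auto
    also have "\<dots> = (\<Sum>i<n \<alpha>. \<Sum>j<n \<alpha>. munit n (\<beta>, a, b) \<alpha> $$ (i, j) * ?u b $ j * cnj (?u a $ i))"
      by (rule mult_mat_vec_cscalar_prod[OF _ u[OF ab(2)] u[OF ab(1)]]) (rule fd_algD, simp)
    also have "\<dots> = (\<Sum>i<n \<alpha>. \<Sum>j<n \<alpha>. if j = b then if i = a then if \<alpha> = \<beta> then ?u b $ b * cnj (?u a $ a) else 0 else 0 else 0)"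
      by (intro sum.cong refl) (auto simp: munit_index simp del: index_mult_mat_vec)
    also have "\<dots> = (if \<alpha> = \<beta> then ?u b $ b * cnj (?u a $ a) else 0)"
      using ab by (cases "\<alpha> = \<beta>") (simp_all del: index_mult_mat_vec)
    finally show ?thesis .
  qed
  then have "(\<Sum>a<n \<beta>. \<Sum>b<n \<beta>. (sandwich K (munit n (\<beta>, a, b)) \<alpha> *\<^sub>v v b) \<bullet>c v a) =
      (\<Sum>a<n \<beta>. \<Sum>b<n \<beta>. if \<alpha> = \<beta> then ?u b $ b * cnj (?u a $ a) else 0)"
    by (intro sum.cong refl) auto
  also have "\<dots> = (if \<alpha> = \<beta> then (\<Sum>b<n \<beta>. ?u b $ b) * cnj (\<Sum>b<n \<beta>. ?u b $ b) else 0)"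
  proof (cases "\<alpha> = \<beta>")
    case True
    have "(\<Sum>a<n \<beta>. \<Sum>b<n \<beta>. ?u b $ b * cnj (?u a $ a)) = (\<Sum>b<n \<beta>. ?u b $ b) * cnj (\<Sum>b<n \<beta>. ?u b $ b)"
      unfolding cnj_sum sum_product by (rule sum.swap)
    with True show ?thesis by (simp only: if_True simp_thms)
  qed simp
  also have "0 \<le> \<dots>"
    using conjugate_square_positive[of "\<Sum>b<n \<beta>. ?u b $ b"]
    by (cases "\<alpha> = \<beta>") (simp_all only: if_True if_False order_refl conjugate_complex_def simp_thms)
  finally show "0 \<le> (\<Sum>a<n \<beta>. \<Sum>b<n \<beta>. (sandwich K (munit n (\<beta>, a, b)) \<alpha> *\<^sub>v v b) \<bullet>c v a)" .
qed

text \<open>Complete positivity is used for one input only, the twisted matrix units of block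
  \<beta>. From the resulting nonnegative form just the Hermitian symmetry is extracted; together
  with idempotence this makes S a projection.\<close>

lemma completely_positive_op_star:
  assumes S: "S \<in> tensor_space n" and cp: "completely_positive n (tensor_op S)"
  shows "op_star S = S"
proof
  fix p :: "'k mlabel \<times> 'k mlabel"
  obtain \<alpha> i j \<beta> k l where p: "p = ((\<alpha>, i, j), (\<beta>, k, l))"
    by (cases p) auto
  show "op_star S p = S p"
  proof (cases "i < n \<alpha> \<and> j < n \<alpha> \<and> k < n \<beta> \<and> l < n \<beta>")
    case False
    then show ?thesis
      using tensor_spaceD[OF S, of "((\<alpha>, i, j), (\<beta>, k, l))"] tensor_spaceD[OF S, of "((\<alpha>, j, i), (\<beta>, l, k))"]
      by (auto simp: p op_star_def mem_mlabels)
  next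
    case True
    let ?I = "{..<n \<alpha>} \<times> {..<n \<beta>}"
    \<comment> \<open>The relabelling of S as a Choi matrix: rows are pairs (i, a) and columns pairs
      (j, b). The second leg enters as (b, a) because the value of T_S at K e_ab K carries the
      coefficient at the transposed label.\<close>
    define M where "M = (\<lambda>(i, a) (j, b). S ((\<alpha>, i, j), (\<beta>, b, a)))"
    have pos: "matrix_positive n (n \<beta>) (\<lambda>a b. tensor_op S (sandwich K (munit n (\<beta>, a, b))))"
      using cp matrix_positive_munit[of \<beta>] unfolding completely_positive_def by simp
    have "0 \<le> (\<Sum>x\<in>?I. \<Sum>y\<in>?I. M x y * f y * cnj (f x))" for f
    proof -
      let ?v = "\<lambda>a. Matrix.vec (n \<alpha>) (\<lambda>i. f (i, a))"
      have "0 \<le> (\<Sum>a<n \<beta>. \<Sum>b<n \<beta>. (tensor_op S (sandwich K (munit n (\<beta>, a, b))) \<alpha> *\<^sub>v ?v b) \<bullet>c ?v a)"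
        using pos unfolding matrix_positive_def by simp
      also have "\<dots> = (\<Sum>a<n \<beta>. \<Sum>b<n \<beta>. \<Sum>i<n \<alpha>. \<Sum>j<n \<alpha>. M (i, a) (j, b) * f (j, b) * cnj (f (i, a)))"
      proof (rule sum.cong[OF refl], rule sum.cong[OF refl])
        fix a b assume ab: "a \<in> {..<n \<beta>}" "b \<in> {..<n \<beta>}"
        have "(tensor_op S (sandwich K (munit n (\<beta>, a, b))) \<alpha> *\<^sub>v ?v b) \<bullet>c ?v a =
            (\<Sum>i<n \<alpha>. \<Sum>j<n \<alpha>. tensor_op S (sandwich K (munit n (\<beta>, a, b))) \<alpha> $$ (i, j) * ?v b $ j * cnj (?v a $ i))"
          by (rule mult_mat_vec_cscalar_prod[OF fd_algD[OF tensor_op_in_alg]]) simp_all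
        also have "\<dots> = (\<Sum>i<n \<alpha>. \<Sum>j<n \<alpha>. M (i, a) (j, b) * f (j, b) * cnj (f (i, a)))"
          using ab by (intro sum.cong refl) (simp add: tensor_op_sandwich_munit M_def)
        finally show "(tensor_op S (sandwich K (munit n (\<beta>, a, b))) \<alpha> *\<^sub>v ?v b) \<bullet>c ?v a =
            (\<Sum>i<n \<alpha>. \<Sum>j<n \<alpha>. M (i, a) (j, b) * f (j, b) * cnj (f (i, a)))" .
      qed
      also have "\<dots> = (\<Sum>i<n \<alpha>. \<Sum>j<n \<alpha>. \<Sum>a<n \<beta>. \<Sum>b<n \<beta>. M (i, a) (j, b) * f (j, b) * cnj (f (i, a)))"
        by (rule sum_swap_pairs)
      also have "\<dots> = (\<Sum>i<n \<alpha>. \<Sum>a<n \<beta>. \<Sum>j<n \<alpha>. \<Sum>b<n \<beta>. M (i, a) (j, b) * f (j, b) * cnj (f (i, a)))"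
        by (rule sum.cong[OF refl], rule sum.swap)
      finally show ?thesis
        by (simp add: sum.cartesian_product')
    qed
    then have "M (j, k) (i, l) = cnj (M (i, l) (j, k))"
      using True by (intro nonneg_form_hermitian[of ?I]) auto
    then show ?thesis
      by (simp add: p M_def op_star_def)
  qed
qed

section \<open>The KMS adjoint as the tensor flip\<close>

lemma kms_nondegenerate:
  assumes x: "x \<in> fd_alg n" and y: "y \<in> fd_alg n"
    and eq: "\<And>z. z \<in> fd_alg n \<Longrightarrow> kms_ip n \<psi> x z = kms_ip n \<psi> y z"
  shows "x = y"
proof (rule fd_alg_eqI[OF x y])
  fix \<alpha> i j assume ij: "i < n \<alpha>" "j < n \<alpha>"
  \<comment> \<open>Testing against K e_ij K cancels the twist and leaves a single conjugated
    entry.\<close>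
  have "kms_ip n \<psi> z (sandwich K (munit n (\<alpha>, i, j))) = cnj (z \<alpha> $$ (i, j))" if z: "z \<in> fd_alg n" for z
  proof -
    have "kms_ip n \<psi> z (sandwich K (munit n (\<alpha>, i, j))) = (\<Sum>\<gamma>\<in>UNIV. if \<gamma> = \<alpha> then cnj (z \<alpha> $$ (i, j)) else 0)"
    proof (unfold kms_ip_eq(2)[OF z sandwich_K[OF fd_alg_closed(5)]], rule sum.cong[OF refl])
      fix \<gamma>
      have "(\<Sum>a<n \<gamma>. \<Sum>b<n \<gamma>. cnj (z \<gamma> $$ (a, b)) * sandwich H (sandwich K (munit n (\<alpha>, i, j))) \<gamma> $$ (a, b)) =
          (\<Sum>a<n \<gamma>. \<Sum>b<n \<gamma>. if b = j then if a = i then if \<gamma> = \<alpha> then cnj (z \<alpha> $$ (i, j)) else 0 else 0 else 0)"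
        by (intro sum.cong refl) (auto simp: sandwich_cancel munit_index)
      also have "\<dots> = (if \<gamma> = \<alpha> then cnj (z \<alpha> $$ (i, j)) else 0)"
        using ij by (cases "\<gamma> = \<alpha>") auto
      finally show "(\<Sum>a<n \<gamma>. \<Sum>b<n \<gamma>. cnj (z \<gamma> $$ (a, b)) * sandwich H (sandwich K (munit n (\<alpha>, i, j))) \<gamma> $$ (a, b)) =
          (if \<gamma> = \<alpha> then cnj (z \<alpha> $$ (i, j)) else 0)" .
    qed
    then show ?thesis by simp
  qed
  from this[OF x] this[OF y] eq[of "sandwich K (munit n (\<alpha>, i, j))"]
  show "x \<alpha> $$ (i, j) = y \<alpha> $$ (i, j)" by simp
qed

text \<open>With the twist on x on one side and on z on the other, both inner products involve H x H
  and H z H symmetrically. What remains is one sum over pairs of labels: exchanging the legs is the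
  flip, while conjugation and the transposed labels are the star.\<close>

lemma tensor_op_adjoint:
  assumes x: "x \<in> fd_alg n" and z: "z \<in> fd_alg n"
  shows "kms_ip n \<psi> (tensor_op (tensor_flip (op_star S)) x) z = kms_ip n \<psi> x (tensor_op S z)"
proof -
  let ?t = "\<lambda>\<alpha> i j \<beta> k l. cnj (sandwich H x \<alpha> $$ (i, j)) * (S ((\<alpha>, i, j), (\<beta>, k, l)) * sandwich H z \<beta> $$ (l, k))"
  have "kms_ip n \<psi> x (tensor_op S z) =
      (\<Sum>\<alpha>\<in>UNIV. \<Sum>i<n \<alpha>. \<Sum>j<n \<alpha>. \<Sum>\<beta>\<in>UNIV. \<Sum>k<n \<beta>. \<Sum>l<n \<beta>. ?t \<alpha> i j \<beta> k l)"
    unfolding kms_ip_eq(1)[OF x tensor_op_in_alg[OF z]]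
    by (intro sum.cong refl) (simp add: tensor_op_index'[OF z] sum_distrib_left)
  also have "\<dots> = (\<Sum>u\<in>mlabels n. \<Sum>v\<in>mlabels n. case u of (\<alpha>, i, j) \<Rightarrow> case v of (\<beta>, k, l) \<Rightarrow> ?t \<alpha> i j \<beta> k l)"
    unfolding sum_mlabels2 by simp
  also have "\<dots> = (\<Sum>v\<in>mlabels n. \<Sum>u\<in>mlabels n. case u of (\<alpha>, i, j) \<Rightarrow> case v of (\<beta>, k, l) \<Rightarrow> ?t \<alpha> i j \<beta> k l)"
    by (rule sum.swap)
  also have "\<dots> = (\<Sum>\<beta>\<in>UNIV. \<Sum>k<n \<beta>. \<Sum>l<n \<beta>. \<Sum>\<alpha>\<in>UNIV. \<Sum>i<n \<alpha>. \<Sum>j<n \<alpha>. ?t \<alpha> i j \<beta> k l)"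
    unfolding sum_mlabels2 by simp
  also have "\<dots> = (\<Sum>\<beta>\<in>UNIV. \<Sum>l<n \<beta>. \<Sum>k<n \<beta>. \<Sum>\<alpha>\<in>UNIV. \<Sum>j<n \<alpha>. \<Sum>i<n \<alpha>. ?t \<alpha> i j \<beta> k l)"
  proof (rule sum.cong[OF refl])
    fix \<beta>
    have "(\<Sum>\<alpha>\<in>UNIV. \<Sum>i<n \<alpha>. \<Sum>j<n \<alpha>. ?t \<alpha> i j \<beta> k l) = (\<Sum>\<alpha>\<in>UNIV. \<Sum>j<n \<alpha>. \<Sum>i<n \<alpha>. ?t \<alpha> i j \<beta> k l)" for k l
      by (rule sum.cong[OF refl], rule sum.swap)
    then show "(\<Sum>k<n \<beta>. \<Sum>l<n \<beta>. \<Sum>\<alpha>\<in>UNIV. \<Sum>i<n \<alpha>. \<Sum>j<n \<alpha>. ?t \<alpha> i j \<beta> k l) =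
        (\<Sum>l<n \<beta>. \<Sum>k<n \<beta>. \<Sum>\<alpha>\<in>UNIV. \<Sum>j<n \<alpha>. \<Sum>i<n \<alpha>. ?t \<alpha> i j \<beta> k l)"
      by (simp only:) (rule sum.swap)
  qed
  also have "\<dots> = kms_ip n \<psi> (tensor_op (tensor_flip (op_star S)) x) z"
    unfolding kms_ip_eq(2)[OF tensor_op_in_alg[OF x] z]
    by (intro sum.cong refl)
      (simp add: tensor_op_index'[OF x] tensor_flip_def op_star_def sum_distrib_left sum_distrib_right mult_ac)
  finally show ?thesis ..
qed

lemma kms_adjoint_tensor_op: "kms_adjoint n \<psi> (tensor_op S) = tensor_op (tensor_flip (op_star S))"
proof
  fix x
  let ?T = "tensor_op (tensor_flip (op_star S))"
  show "kms_adjoint n \<psi> (tensor_op S) x = ?T x"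
  proof (cases "x \<in> fd_alg n")
    case False
    then show ?thesis by (simp add: kms_adjoint_def tensor_op_def)
  next
    case x: True
    have "(THE y. y \<in> fd_alg n \<and> (\<forall>z\<in>fd_alg n. kms_ip n \<psi> y z = kms_ip n \<psi> x (tensor_op S z))) = ?T x"
    proof (rule the_equality)
      show "?T x \<in> fd_alg n \<and> (\<forall>z\<in>fd_alg n. kms_ip n \<psi> (?T x) z = kms_ip n \<psi> x (tensor_op S z))"
        using x tensor_op_adjoint by simp
    next
      fix y assume y: "y \<in> fd_alg n \<and> (\<forall>z\<in>fd_alg n. kms_ip n \<psi> y z = kms_ip n \<psi> x (tensor_op S z))"
      show "y = ?T x"
        using x y by (intro kms_nondegenerate) (simp_all add: tensor_op_adjoint)
    qed
    then show ?thesis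
      using x by (simp add: kms_adjoint_def)
  qed
qed

text \<open>The two conditions are not matched one by one: complete positivity yields
  self-adjointness, but its recovery uses self-adjointness and idempotence together.\<close>

lemma quantum_adjacency_iff_projection:
  assumes S: "S \<in> tensor_space n"
  shows "quantum_adjacency n \<psi> (tensor_op S) \<longleftrightarrow> S \<in> op_projections n"
  unfolding quantum_adjacency_tensor_op[OF S] op_projections_def
  using S completely_positive_op_star[OF S] completely_positive_tensor_op by blast

section \<open>The correspondence and the flip\<close>

lemma Psi_KMS_tensor_op:
  assumes "S \<in> tensor_space n"
  shows "Psi_KMS n \<psi> (tensor_op S) = S"
  using Psi_KMS_eq[OF tensor_op_end] op_tensor_tensor_op[OF assms] by simp

lemma quantum_adjacency_obtain:
  assumes "quantum_adjacency n \<psi> A"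
  obtains S where "S \<in> op_projections n" "S \<in> tensor_space n" "A = tensor_op S"
proof -
  have "A \<in> fd_end n"
    using assms by (simp add: quantum_adjacency_def completely_positive_def)
  then have A: "A = tensor_op (op_tensor A)"
    by (simp add: tensor_op_op_tensor)
  with assms have "op_tensor A \<in> op_projections n"
    using quantum_adjacency_iff_projection[OF op_tensor_space, of A] by simp
  with A show thesis
    using that op_tensor_space by blast
qed

lemma bij_betw_Psi_KMS: "bij_betw (Psi_KMS n \<psi>) {A. quantum_adjacency n \<psi> A} (op_projections n)"
proof (rule bij_betwI[where g = tensor_op])
  show "Psi_KMS n \<psi> \<in> {A. quantum_adjacency n \<psi> A} \<rightarrow> op_projections n"
    by (auto elim!: quantum_adjacency_obtain simp: Psi_KMS_tensor_op)
  show "tensor_op \<in> op_projections n \<rightarrow> {A. quantum_adjacency n \<psi> A}"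
    by (auto simp: quantum_adjacency_iff_projection op_projections_def)
  show "tensor_op (Psi_KMS n \<psi> A) = A" if "A \<in> {A. quantum_adjacency n \<psi> A}" for A
    using that by (auto elim!: quantum_adjacency_obtain simp: Psi_KMS_tensor_op)
  show "Psi_KMS n \<psi> (tensor_op S) = S" if "S \<in> op_projections n" for S
    using that by (simp add: Psi_KMS_tensor_op op_projections_def)
qed

text \<open>In general the KMS adjoint of T_S belongs to the flip of the star of S. For a quantum
  adjacency matrix S is a projection, so the star disappears.\<close>

lemma tensor_flip_Psi_KMS:
  assumes "quantum_adjacency n \<psi> A"
  shows "tensor_flip (Psi_KMS n \<psi> A) = Psi_KMS n \<psi> (kms_adjoint n \<psi> A)"
proof -
  obtain S where S: "S \<in> op_projections n" "S \<in> tensor_space n" "A = tensor_op S"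
    using assms by (rule quantum_adjacency_obtain)
  have "op_star S = S"
    using S(1) by (simp add: op_projections_def)
  moreover have "tensor_flip S \<in> tensor_space n"
    using S(2) by (auto simp: tensor_space_def tensor_flip_def)
  ultimately show ?thesis
    by (simp add: S Psi_KMS_tensor_op kms_adjoint_tensor_op)
qed

end

theorem theorem1:
  fixes n :: "'k::finite \<Rightarrow> nat"
    and \<psi> :: "('k \<Rightarrow> complex mat) \<Rightarrow> complex"
  assumes "faithful_positive_functional n \<psi>"
    and "\<forall>x\<in>fd_alg n. mult_map n (mult_adj n \<psi> x) = x"
  shows "bij_betw (Psi_KMS n \<psi>) {A. quantum_adjacency n \<psi> A} (op_projections n) \<and>
    (\<forall>A. quantum_adjacency n \<psi> A \<longrightarrow>
       tensor_flip (Psi_KMS n \<psi> A) = Psi_KMS n \<psi> (kms_adjoint n \<psi> A))"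
proof -
  obtain H K where "kms_form n \<psi> H K"
    using kms_form_exists[OF assms] by blast
  then interpret kms_form n \<psi> H K .
  show ?thesis
    using bij_betw_Psi_KMS tensor_flip_Psi_KMS by blast
qed

end
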